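(* Let $p=1$ and $q\ge 2$, and let $F:\mathbb{R}^n\to\mathbb{R}$ satisfy, for some constants $\alpha,\lambda,\Lambda>0$ and all $\xi,\eta\in\mathbb{R}^n$, $$2F\Big(\frac{\xi+\eta}{2}\Big)+\alpha|\xi-\eta|^q\le F(\xi)+F(\eta)\qquad\text{and}\qquad \lambda|\xi|^q\le F(\xi)\le\Lambda|\xi|^q .$$ Let $f\in L^{q'}(\omega_2)$, where $\frac1q+\frac1{q'}=1$. For $\ell>0$ let $u_\ell$ be the unique minimizer of $E_{\Omega_\ell}$ over $W^{1,q}_0(\Omega_\ell)$, and let $u_\infty$ be the unique minimizer of $E_{\omega_2}$ over $W^{1,q}_0(\omega_2)$. Then there is a constant $A>0$, independent of $\ell$, such that $$\int_{\Omega_{\ell/2}}|\nabla(u_\ell-u_\infty)|^q\,dX\le\frac{A}{\ell^{\frac1{q-1}}}\qquad\text{for all }\ell>0 .$$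
   Context: Let $n\ge2$ and $p=1$. The set $\omega_1\subset\mathbb{R}^p=\mathbb{R}$ is open, bounded and star-shaped with respect to the origin, $\omega_2\subset\mathbb{R}^{n-p}=\mathbb{R}^{n-1}$ is open and bounded, and for $\ell>0$, $\Omega_\ell=\ell\omega_1\times\omega_2\subset\mathbb{R}^n$. Points are written $X=(X_1,X_2)$ with $X_1\in\ell\omega_1$, $X_2\in\omega_2$; $\nabla$ and $\nabla_{X_2}$ are the gradients in $X$ and in $X_2$. The function $f=f(X_2)$ depends only on $X_2$. The functionals are $$E_{\Omega_\ell}(u)=\int_{\Omega_\ell}\big(F(\nabla u)-fu\big)\,dX,\quad u\in W_0^{1,q}(\Omega_\ell),\qquad E_{\omega_2}(u)=\int_{\omega_2}\big(F(0,\nabla_{X_2}u)-fu\big)\,dX_2,\quad u\in W^{1,q}_0(\omega_2),$$ where $0$ is the zero vector of $\mathbb{R}^p$. The minimizers exist and are unique under the stated hypotheses. The function $u_\infty$ is regarded as a function on $\Omega_\ell$ independent of $X_1$. *)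

theory Defs
  imports "HOL-Analysis.Analysis"
begin

fun Ck :: "nat \<Rightarrow> ('a::euclidean_space \<Rightarrow> real) \<Rightarrow> bool" where
  "Ck 0 f \<longleftrightarrow> continuous_on UNIV f"
| "Ck (Suc k) f \<longleftrightarrow> (\<forall>x. f differentiable (at x)) \<and>
     (\<forall>b\<in>Basis. Ck k (\<lambda>x. frechet_derivative f (at x) b))"

definition gradient :: "('a::euclidean_space \<Rightarrow> real) \<Rightarrow> 'a \<Rightarrow> 'a" where
  "gradient f x = (\<Sum>b\<in>Basis. frechet_derivative f (at x) b *\<^sub>R b)"

text \<open>The space of smooth functions with compact support in \<open>\<Omega>\<close>, extended by zero.\<close>

definition test_functions :: "'a::euclidean_space set \<Rightarrow> ('a \<Rightarrow> real) set" where
  "test_functions \<Omega> = {\<phi>. (\<forall>k. Ck k \<phi>) \<and>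
     compact (closure {x. \<phi> x \<noteq> 0}) \<and> closure {x. \<phi> x \<noteq> 0} \<subseteq> \<Omega>}"

text \<open>
  All function spaces over \<open>\<Omega>\<close> consist of total functions of which only the values on \<open>\<Omega>\<close> matter,
  not of classes modulo equality almost everywhere.
\<close>

definition Lp :: "'a::euclidean_space set \<Rightarrow> real \<Rightarrow> ('a \<Rightarrow> 'b::euclidean_space) set" where
  "Lp \<Omega> q = {u. u \<in> borel_measurable (lebesgue_on \<Omega>) \<and>
     integrable (lebesgue_on \<Omega>) (\<lambda>x. norm (u x) powr q)}"

definition L1_loc :: "'a::euclidean_space set \<Rightarrow> ('a \<Rightarrow> 'b::euclidean_space) set" where
  "L1_loc \<Omega> = {u. \<forall>K. compact K \<and> K \<subseteq> \<Omega> \<longrightarrow> integrable (lebesgue_on K) u}"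

definition has_weak_gradient ::
    "'a::euclidean_space set \<Rightarrow> ('a \<Rightarrow> real) \<Rightarrow> ('a \<Rightarrow> 'a) \<Rightarrow> bool" where
  "has_weak_gradient \<Omega> u g \<longleftrightarrow> u \<in> L1_loc \<Omega> \<and> g \<in> L1_loc \<Omega> \<and>
     (\<forall>\<phi>\<in>test_functions \<Omega>.
        (LINT x|lebesgue_on \<Omega>. u x *\<^sub>R gradient \<phi> x) = - (LINT x|lebesgue_on \<Omega>. \<phi> x *\<^sub>R g x))"

text \<open>
  For open \<open>\<Omega>\<close> a weak gradient is determined up to a null set, so the choice of
  representative is immaterial under the integral sign.
\<close>

definition weak_gradient :: "'a::euclidean_space set \<Rightarrow> ('a \<Rightarrow> real) \<Rightarrow> 'a \<Rightarrow> 'a" where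
  "weak_gradient \<Omega> u = (SOME g. has_weak_gradient \<Omega> u g)"

definition W1 :: "'a::euclidean_space set \<Rightarrow> real \<Rightarrow> ('a \<Rightarrow> real) set" where
  "W1 \<Omega> q = {u \<in> Lp \<Omega> q. \<exists>g\<in>Lp \<Omega> q. has_weak_gradient \<Omega> u g}"

definition W1_norm :: "'a::euclidean_space set \<Rightarrow> real \<Rightarrow> ('a \<Rightarrow> real) \<Rightarrow> real" where
  "W1_norm \<Omega> q u =
     ((LINT x|lebesgue_on \<Omega>. \<bar>u x\<bar> powr q) +
      (LINT x|lebesgue_on \<Omega>. norm (weak_gradient \<Omega> u x) powr q)) powr (1 / q)"

text \<open>The closure of the test functions in the Sobolev space \<open>W1 \<Omega> q\<close>.\<close>

definition W1_0 :: "'a::euclidean_space set \<Rightarrow> real \<Rightarrow> ('a \<Rightarrow> real) set" where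
  "W1_0 \<Omega> q = {u \<in> W1 \<Omega> q. \<forall>\<epsilon>>0. \<exists>\<phi>\<in>test_functions \<Omega>. W1_norm \<Omega> q (\<lambda>x. u x - \<phi> x) < \<epsilon>}"

definition energy ::
    "'a::euclidean_space set \<Rightarrow> ('a \<Rightarrow> real) \<Rightarrow> ('a \<Rightarrow> real) \<Rightarrow> ('a \<Rightarrow> real) \<Rightarrow> real" where
  "energy \<Omega> F f u = (LINT x|lebesgue_on \<Omega>. F (weak_gradient \<Omega> u x) - f x * u x)"

definition cylinder :: "real set \<Rightarrow> 'a::euclidean_space set \<Rightarrow> real \<Rightarrow> (real \<times> 'a) set" where
  "cylinder \<omega>\<^sub>1 \<omega>\<^sub>2 l = ((\<lambda>x. l * x) ` \<omega>\<^sub>1) \<times> \<omega>\<^sub>2"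

end

theory Submission
  imports Defs
begin

text \<open>
  By definition of \<open>W1_0\<close>, the minimizers \<open>u\<^sub>l\<close> and \<open>u\<^sub>\<infinity>\<close> are approximated by test functions \<open>\<phi>\<close> and \<open>\<psi>\<close> that
  minimize up to a small error, so the main estimate only concerns smooth functions. Put
  \<open>w = \<phi> - \<psi>\<close> and let \<open>\<rho> = \<eta>\<^sup>2\<close> be a cutoff in \<open>X\<^sub>1\<close> that is \<open>1\<close> on \<open>(l/2) \<omega>\<^sub>1\<close>. The competitor
  \<open>\<phi> - \<rho> w / 2\<close> is admissible for \<open>\<phi>\<close>. The function \<open>\<psi> + \<rho> w / 2\<close> is not admissible on \<open>\<omega>\<^sub>2\<close>, but its mean
  in \<open>X\<^sub>1\<close> is, and as the mean of its \<open>X\<^sub>1\<close>-derivative vanishes, Jensen's inequality in \<open>X\<^sub>1\<close>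
  shows that its energy on the cylinder is at least that of \<open>\<psi>\<close>; here \<open>p = 1\<close> is used. Adding both comparisons, the
  uniform convexity and the growth of \<open>F\<close> give
  \<open>\<alpha> \<integral> \<rho> |\<nabla>w|\<^sup>q \<le> C \<integral> |w \<rho>'| (|\<nabla>\<phi>| + |\<nabla>\<psi>| + |w \<rho>'|)\<^sup>q\<^sup>-\<^sup>1\<close>
  up to a small error. Since \<open>|\<rho>'|\<^sup>q \<le> C l\<^sup>-\<^sup>q \<rho>\<close>, Poincare's inequality in \<open>X\<^sub>2\<close> and the bound
  \<open>\<integral> |\<nabla>\<phi>|\<^sup>q + |\<nabla>\<psi>|\<^sup>q \<le> C l\<close>, Young's inequality with parameter of order \<open>1/l\<close> absorbs the factor
  \<open>w \<rho>'\<close> and leaves a remainder of order \<open>l \<cdot> l powr (- q / (q - 1)) = l powr (- 1 / (q - 1))\<close>. For \<open>l < 1\<close> the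
  trivial bound \<open>C l\<close> suffices.
\<close>

section \<open>Smooth functions\<close>

text \<open>\<open>F\<close> is not assumed differentiable, so there is no Euler equation to test
  and every step compares energies. Convexity, continuity and the local Lipschitz bound with factor
  \<open>(norm x + norm h) powr (q - 1)\<close> are all extracted from the midpoint inequality
  together with the two growth bounds. Each competitor moves one of the two functions toward the
  other, halfway where the cutoff is 1. Their sum is therefore still \<phi> + \<psi>, which removes
  the terms with \<open>f\<close>, while strict convexity rewards the move.

  Test functions make product rule, slices and boundary values in X_1 elementary. About weak
  gradients it then suffices to know uniqueness, restriction to a smaller open set, and extension of
  a function of X_2 as a constant in X_1. The approximation errors are chosen after
  \<open>l\<close>, small against the target rate; only the bound on the gradient of \<psi> must be
  uniform in \<open>l\<close>.\<close>

lemma Ck_SucI: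
  fixes f :: "'a::euclidean_space \<Rightarrow> real"
  assumes "\<And>x. (f has_derivative D x) (at x)"
    and "\<And>b. b \<in> Basis \<Longrightarrow> Ck k (\<lambda>x. D x b)"
  shows "Ck (Suc k) f"
proof -
  have "frechet_derivative f (at x) = D x" for x
    using frechet_derivative_at[OF assms(1)] by simp
  then show ?thesis
    using assms by (auto simp: differentiable_def)
qed

lemma Ck_SucD:
  fixes f :: "'a::euclidean_space \<Rightarrow> real"
  assumes "Ck (Suc k) f"
  shows "(f has_derivative frechet_derivative f (at x)) (at x)"
    and "b \<in> Basis \<Longrightarrow> Ck k (\<lambda>x. frechet_derivative f (at x) b)"
  using assms by (auto simp: frechet_derivative_works)

lemma Ck_imp_continuous:
  fixes f :: "'a::euclidean_space \<Rightarrow> real"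
  assumes "Ck k f"
  shows "continuous_on UNIV f"
proof (cases k)
  case (Suc j)
  then show ?thesis
    using assms Ck_SucD(1)[of j f] has_derivative_continuous
    by (blast intro: continuous_at_imp_continuous_on)
qed (use assms in simp)

lemma Ck_Suc_imp_Ck: "Ck (Suc k) f \<Longrightarrow> Ck k f"
proof (induction k arbitrary: f)
  case 0
  then show ?case using Ck_imp_continuous by (metis Ck.simps(1))
next
  case (Suc k)
  then show ?case by (metis Ck.simps(2))
qed

lemma Ck_const [simp]: "Ck k (\<lambda>x. c)"
proof (induction k arbitrary: c)
  case (Suc k)
  show ?case by (rule Ck_SucI[of _ "\<lambda>_ _. 0"]) (auto simp: Suc)
qed auto

lemma Ck_add: "Ck k f \<Longrightarrow> Ck k g \<Longrightarrow> Ck k (\<lambda>x. f x + g x)"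
proof (induction k arbitrary: f g)
  case 0
  then show ?case by (auto intro: continuous_on_add)
next
  case (Suc k)
  show ?case
    by (rule Ck_SucI[OF has_derivative_add[OF Ck_SucD(1)[OF Suc.prems(1)] Ck_SucD(1)[OF Suc.prems(2)]]])
      (use Suc Ck_SucD(2) in blast)
qed

lemma Ck_mult:
  fixes f :: "'a::euclidean_space \<Rightarrow> real"
  shows "Ck k f \<Longrightarrow> Ck k g \<Longrightarrow> Ck k (\<lambda>x. f x * g x)"
proof (induction k arbitrary: f g)
  case 0
  then show ?case by (auto intro: continuous_on_mult)
next
  case (Suc k)
  show ?case
    by (rule Ck_SucI[OF has_derivative_mult[OF Ck_SucD(1)[OF Suc.prems(1)] Ck_SucD(1)[OF Suc.prems(2)]]])
      (intro Ck_add Suc.IH Ck_SucD(2) Suc.prems Ck_Suc_imp_Ck)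
qed

lemma Ck_sum: "(\<And>i. i \<in> I \<Longrightarrow> Ck k (f i)) \<Longrightarrow> Ck k (\<lambda>x. \<Sum>i\<in>I. f i x)"
  by (induction I rule: infinite_finite_induct) (auto intro: Ck_add)

lemma Ck_prod:
  fixes f :: "'i \<Rightarrow> 'a::euclidean_space \<Rightarrow> real"
  shows "(\<And>i. i \<in> I \<Longrightarrow> Ck k (f i)) \<Longrightarrow> Ck k (\<lambda>x. \<Prod>i\<in>I. f i x)"
  by (induction I rule: infinite_finite_induct) (auto intro: Ck_mult)

lemma Ck_diff: "Ck k f \<Longrightarrow> Ck k g \<Longrightarrow> Ck k (\<lambda>x. f x - g x)"
  using Ck_add[of k f "\<lambda>x. (-1) * g x"] Ck_mult[of k "\<lambda>_. -1" g] by simp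

text \<open>The derivative \<open>L\<close> is the same at all points, so the partial derivatives of
  the composition are combinations, with constant coefficients, of partial derivatives of
  \<open>f\<close> composed with \<open>A\<close>. The induction on \<open>k\<close> therefore stays
  within compositions of this form.\<close>

lemma Ck_compose_affine:
  fixes f :: "'b::euclidean_space \<Rightarrow> real" and A :: "'a::euclidean_space \<Rightarrow> 'b"
  assumes A: "\<And>x. (A has_derivative L) (at x)"
  shows "Ck k f \<Longrightarrow> Ck k (\<lambda>x. f (A x))"
proof (induction k arbitrary: f)
  case 0
  have "continuous_on UNIV A"
    using A by (meson continuous_at_imp_continuous_on has_derivative_continuous)
  with 0 show ?case
    by (auto intro: continuous_on_compose2)
next
  case (Suc k)
  let ?D = "\<lambda>x h. \<Sum>c\<in>Basis. (L h \<bullet> c) * frechet_derivative f (at (A x)) c"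
  show ?case
  proof (rule Ck_SucI[of _ ?D])
    fix x
    have lin: "linear (frechet_derivative f (at (A x)))"
      using Ck_SucD(1)[OF Suc.prems] has_derivative_linear by blast
    have "((\<lambda>x. f (A x)) has_derivative (\<lambda>h. frechet_derivative f (at (A x)) (L h))) (at x)"
      using has_derivative_compose[OF A Ck_SucD(1)[OF Suc.prems]] by simp
    moreover have "frechet_derivative f (at (A x)) v = (\<Sum>c\<in>Basis. (v \<bullet> c) * frechet_derivative f (at (A x)) c)" for v
    proof -
      have "frechet_derivative f (at (A x)) v = frechet_derivative f (at (A x)) (\<Sum>c\<in>Basis. (v \<bullet> c) *\<^sub>R c)"
        by (simp add: euclidean_representation)
      also have "\<dots> = (\<Sum>c\<in>Basis. (v \<bullet> c) * frechet_derivative f (at (A x)) c)"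
        by (simp add: linear_sum[OF lin] linear_cmul[OF lin])
      finally show ?thesis .
    qed
    ultimately show "((\<lambda>x. f (A x)) has_derivative ?D x) (at x)"
      by (metis (no_types, lifting) ext)
  next
    fix b :: 'a
    show "Ck k (\<lambda>x. ?D x b)"
      by (intro Ck_sum Ck_mult Ck_const Suc.IH Ck_SucD(2)[OF Suc.prems])
  qed
qed

text \<open>The derivative of the inverse is a product of the inverse itself, twice, and a partial
  derivative of \<open>f\<close>, so the case \<open>k\<close> for the same function feeds the case
  \<open>Suc k\<close>.\<close>

lemma Ck_inverse:
  fixes f :: "'a::euclidean_space \<Rightarrow> real"
  assumes "\<And>x. f x \<noteq> 0"
  shows "Ck k f \<Longrightarrow> Ck k (\<lambda>x. inverse (f x))"
proof (induction k)
  case 0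
  with assms show ?case by (auto intro: continuous_on_inverse)
next
  case (Suc k)
  have IH: "Ck k (\<lambda>x. inverse (f x))"
    using Suc Ck_Suc_imp_Ck by blast
  show ?case
  proof (rule Ck_SucI[of _ "\<lambda>x h. (-1) * (inverse (f x) * frechet_derivative f (at x) h * inverse (f x))"])
    show "((\<lambda>x. inverse (f x)) has_derivative (\<lambda>h. (-1) * (inverse (f x) * frechet_derivative f (at x) h * inverse (f x)))) (at x)" for x
      using Deriv.has_derivative_inverse[OF assms Ck_SucD(1)[OF Suc.prems, of x]] by simp
    show "Ck k (\<lambda>x. (-1) * (inverse (f x) * frechet_derivative f (at x) b * inverse (f x)))" if "b \<in> Basis" for b
      by (intro Ck_mult Ck_const IH Ck_SucD(2)[OF Suc.prems that])
  qed
qed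

lemma Ck_realI:
  fixes f :: "real \<Rightarrow> real"
  assumes "\<And>x. (f has_real_derivative D x) (at x)" and "Ck k D"
  shows "Ck (Suc k) f"
  by (rule Ck_SucI[of _ "\<lambda>x h. D x * h"])
    (use assms in \<open>auto simp: has_field_derivative_def\<close>)

section \<open>A smooth transition from 0 to 1\<close>

definition flat :: "nat \<Rightarrow> real \<Rightarrow> real" where
  "flat m t = (if t \<le> 0 then 0 else (1 / t) ^ m * exp (- 1 / t))"

lemma flat_tendsto_0: "((\<lambda>t. (1 / t) ^ m * exp (- 1 / t)) \<longlongrightarrow> 0) (at_right (0::real))"
proof -
  have "((\<lambda>x. x ^ m / exp x) \<longlongrightarrow> (0::real)) at_top"
    by (rule tendsto_power_div_exp_0)
  then have "((\<lambda>t. inverse t ^ m / exp (inverse t)) \<longlongrightarrow> (0::real)) (at_right 0)"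
    using filterlim_compose filterlim_inverse_at_top_right by blast
  then show ?thesis
    by (simp add: divide_inverse exp_minus)
qed

text \<open>Differentiation stays within the family \<open>flat m\<close>, which is why the powers
  of \<open>1 / t\<close> are carried along: smoothness of all members follows by one induction with
  \<open>m\<close> arbitrary.\<close>

lemma flat_has_derivative:
  "(flat m has_real_derivative (flat (m + 2) t - real m * flat (m + 1) t)) (at t)"
proof -
  consider "t < 0" | "t = 0" | "t > 0" by linarith
  then show ?thesis
  proof cases
    case 1
    have "((\<lambda>_. 0) has_real_derivative 0) (at t)" by simp
    then have "(flat m has_real_derivative 0) (at t)"
      by (rule has_field_derivative_transform_within_open[of _ _ _ "{..<0}"])
         (use 1 in \<open>auto simp: flat_def\<close>)
    with 1 show ?thesis by (simp add: flat_def)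
  next
    case 3
    have "((\<lambda>t. inverse t ^ m) has_real_derivative (- real m * inverse t ^ (m + 1))) (at t)"
      using DERIV_power[OF DERIV_inverse, of t m UNIV] 3 by (cases m) (auto simp: algebra_simps)
    moreover have "((\<lambda>t. exp (- inverse t)) has_real_derivative (exp (- inverse t) * inverse t ^ 2)) (at t)"
      using 3 by (auto intro!: derivative_eq_intros simp: power2_eq_square)
    ultimately have "((\<lambda>t. inverse t ^ m * exp (- inverse t)) has_real_derivative
       (- real m * inverse t ^ (m + 1) * exp (- inverse t) + exp (- inverse t) * inverse t ^ 2 * inverse t ^ m)) (at t)"
      by (rule DERIV_mult)
    then have "((\<lambda>t. (1 / t) ^ m * exp (- 1 / t)) has_real_derivative (flat (m + 2) t - real m * flat (m + 1) t)) (at t)"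
      using 3 by (simp add: flat_def divide_inverse power_add power2_eq_square algebra_simps)
    then show ?thesis
      by (rule has_field_derivative_transform_within_open[of _ _ _ "{0<..}"])
         (use 3 in \<open>auto simp: flat_def\<close>)
  next
    case 2
    \<comment> \<open>To the right of 0 this quotient is the formula for
      \<open>flat (Suc m)\<close>; to the left it is 0.\<close>
    have "((\<lambda>h. flat m h / h) \<longlongrightarrow> 0) (at_right 0)"
      by (rule Lim_transform_eventually[OF flat_tendsto_0[of "Suc m"]])
        (auto simp: eventually_at_filter flat_def intro!: always_eventually)
    moreover have "((\<lambda>h. flat m h / h) \<longlongrightarrow> 0) (at_left 0)"
      by (rule Lim_transform_eventually[OF tendsto_const])
        (auto simp: eventually_at_filter flat_def intro!: always_eventually)
    ultimately have "((\<lambda>h. flat m h / h) \<longlongrightarrow> 0) (at 0)"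
      by (simp add: filterlim_at_split)
    then show ?thesis
      by (simp add: 2 DERIV_def flat_def)
  qed
qed

lemma Ck_flat: "Ck k (flat m)"
proof (induction k arbitrary: m)
  case 0
  have "continuous_on UNIV (flat m)"
    by (rule DERIV_continuous_on) (use flat_has_derivative in blast)
  then show ?case by simp
next
  case (Suc k)
  show ?case
    by (rule Ck_realI[OF flat_has_derivative]) (intro Ck_diff Ck_mult Ck_const Suc)
qed

definition bump :: "real \<Rightarrow> real" where
  "bump = flat 0"

lemma bump_eq: "bump t = (if t \<le> 0 then 0 else exp (- 1 / t))"
  by (simp add: bump_def flat_def)

lemma bump_bounds: "0 \<le> bump t" "bump t \<le> 1"
  by (auto simp: bump_eq)

lemma bump_pos_iff: "bump t > 0 \<longleftrightarrow> t > 0" "bump t = 0 \<longleftrightarrow> t \<le> 0"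
  by (auto simp: bump_eq)

lemma Ck_bump: "Ck k bump"
  by (simp add: bump_def Ck_flat)

definition smooth_step :: "real \<Rightarrow> real" where
  "smooth_step t = bump t * inverse (bump t + bump (1 - t))"

text \<open>\<open>t\<close> and \<open>1 - t\<close> are never both nonpositive, and
  \<open>bump\<close> is positive on positive arguments.\<close>

lemma smooth_step_denom_pos: "bump t + bump (1 - t) > 0"
  using bump_bounds[of t] bump_bounds[of "1 - t"] bump_pos_iff[of t] bump_pos_iff[of "1 - t"] by linarith

lemma smooth_step:
  shows "0 \<le> smooth_step t" "smooth_step t \<le> 1" "t \<le> 0 \<Longrightarrow> smooth_step t = 0" "t \<ge> 1 \<Longrightarrow> smooth_step t = 1"
  using bump_bounds[of t] bump_bounds[of "1 - t"] bump_pos_iff[of t] bump_pos_iff[of "1 - t"] smooth_step_denom_pos[of t]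
  by (auto simp: smooth_step_def field_simps)

lemma Ck_smooth_step: "Ck k smooth_step"
proof -
  have "Ck k (\<lambda>t. bump (1 - t))"
    by (rule Ck_compose_affine[of "\<lambda>t. 1 - t" "\<lambda>h. - h"])
       (auto intro!: derivative_eq_intros Ck_bump)
  then have "Ck k (\<lambda>t. bump t * inverse (bump t + bump (1 - t)))"
    by (intro Ck_mult Ck_inverse Ck_add Ck_bump) (use smooth_step_denom_pos in \<open>auto simp: less_imp_neq[symmetric]\<close>)
  then show ?thesis by (simp add: smooth_step_def[abs_def])
qed

definition smooth :: "('a::euclidean_space \<Rightarrow> real) \<Rightarrow> bool" where
  "smooth f \<longleftrightarrow> (\<forall>k. Ck k f)"

lemma smooth_const: "smooth (\<lambda>x. c)"
  and smooth_add: "smooth f \<Longrightarrow> smooth g \<Longrightarrow> smooth (\<lambda>x. f x + g x)"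
  and smooth_diff: "smooth f \<Longrightarrow> smooth g \<Longrightarrow> smooth (\<lambda>x. f x - g x)"
  and smooth_mult: "smooth f \<Longrightarrow> smooth g \<Longrightarrow> smooth (\<lambda>x. f x * g x)"
  and smooth_sum: "(\<And>i. i \<in> I \<Longrightarrow> smooth (h i)) \<Longrightarrow> smooth (\<lambda>x. \<Sum>i\<in>I. h i x)"
  and smooth_prod: "(\<And>i. i \<in> I \<Longrightarrow> smooth (h i)) \<Longrightarrow> smooth (\<lambda>x. \<Prod>i\<in>I. h i x)"
  by (auto simp: smooth_def intro: Ck_add Ck_diff Ck_mult Ck_sum Ck_prod)

lemma smooth_power2: "smooth f \<Longrightarrow> smooth (\<lambda>x. (f x)\<^sup>2)"
  by (simp add: power2_eq_square smooth_mult)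

lemma smooth_divide: "smooth f \<Longrightarrow> smooth (\<lambda>x. f x / c)"
  using smooth_mult[OF _ smooth_const, of f "inverse c"] by (simp add: divide_inverse)

lemma smooth_compose_affine:
  fixes f :: "'b::euclidean_space \<Rightarrow> real" and A :: "'a::euclidean_space \<Rightarrow> 'b"
  assumes "smooth f" and "\<And>x. (A has_derivative L) (at x)"
  shows "smooth (\<lambda>x. f (A x))"
  using assms Ck_compose_affine unfolding smooth_def by blast

lemma smooth_bump: "smooth bump" and smooth_smooth_step: "smooth smooth_step"
  by (auto simp: smooth_def Ck_bump Ck_smooth_step)

lemma smooth_compose_fst: "smooth f \<Longrightarrow> smooth (\<lambda>X. f (fst X))"
  by (rule smooth_compose_affine[of f fst fst]) (auto intro!: derivative_eq_intros)

lemma smooth_compose_snd: "smooth f \<Longrightarrow> smooth (\<lambda>X. f (snd X))"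
  by (rule smooth_compose_affine[of f snd snd]) (auto intro!: derivative_eq_intros)

lemma smooth_slice:
  "smooth f \<Longrightarrow> smooth (\<lambda>y. f (x, y))"
  by (rule smooth_compose_affine[of f "\<lambda>y. (x, y)" "\<lambda>y. (0, y)"]) (auto intro!: derivative_eq_intros)

lemma smooth_continuous: "smooth f \<Longrightarrow> continuous_on A f"
  using Ck_imp_continuous continuous_on_subset unfolding smooth_def by blast

lemma smooth_partial: "smooth f \<Longrightarrow> b \<in> Basis \<Longrightarrow> smooth (\<lambda>x. frechet_derivative f (at x) b)"
  unfolding smooth_def using Ck_SucD(2) by blast

section \<open>Gradients of smooth functions and of their slices\<close>

lemma gradient_eqI:
  assumes "(f has_derivative (\<lambda>h. g \<bullet> h)) (at x)"
  shows "gradient f x = g"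
proof -
  have "frechet_derivative f (at x) = (\<lambda>h. g \<bullet> h)"
    using frechet_derivative_at[OF assms] by simp
  then show ?thesis
    by (simp add: gradient_def euclidean_representation)
qed

lemma inner_gradient_eq_frechet_derivative:
  fixes f :: "'a::euclidean_space \<Rightarrow> real"
  assumes "f differentiable (at x)"
  shows "gradient f x \<bullet> h = frechet_derivative f (at x) h"
proof -
  have lin: "linear (frechet_derivative f (at x))"
    using assms by (simp add: linear_frechet_derivative)
  have "frechet_derivative f (at x) h = frechet_derivative f (at x) (\<Sum>b\<in>Basis. (h \<bullet> b) *\<^sub>R b)"
    by (simp add: euclidean_representation)
  also have "\<dots> = (\<Sum>b\<in>Basis. (h \<bullet> b) * frechet_derivative f (at x) b)"
    by (simp add: linear_sum[OF lin] linear_cmul[OF lin])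
  also have "\<dots> = gradient f x \<bullet> h"
    unfolding gradient_def inner_sum_left by (intro sum.cong) (auto simp: inner_commute)
  finally show ?thesis by simp
qed

lemma smooth_differentiable: "smooth f \<Longrightarrow> f differentiable (at x)"
  unfolding smooth_def by (meson Ck_SucD(1) differentiableI)

lemma smooth_has_gradient:
  assumes "smooth f"
  shows "(f has_derivative (\<lambda>h. gradient f x \<bullet> h)) (at x)"
  using smooth_differentiable[OF assms, of x]
  by (simp add: inner_gradient_eq_frechet_derivative[OF smooth_differentiable[OF assms]] flip: frechet_derivative_works)

lemma smooth_inner_gradient:
  "smooth f \<Longrightarrow> b \<in> Basis \<Longrightarrow> smooth (\<lambda>x. gradient f x \<bullet> b)"
  using smooth_partial by (simp add: inner_gradient_eq_frechet_derivative smooth_differentiable)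

lemma smooth_continuous_gradient:
  assumes "smooth f" shows "continuous_on A (gradient f)"
  unfolding gradient_def[abs_def]
  by (intro continuous_intros smooth_continuous smooth_partial assms)

lemma gradient_const [simp]: "gradient (\<lambda>x. c) x = 0"
  by (rule gradient_eqI) simp

lemma gradient_add:
  "smooth f \<Longrightarrow> smooth g \<Longrightarrow> gradient (\<lambda>x. f x + g x) x = gradient f x + gradient g x"
  by (rule gradient_eqI) (auto intro!: derivative_eq_intros smooth_has_gradient simp: inner_add_left)

lemma gradient_diff:
  "smooth f \<Longrightarrow> smooth g \<Longrightarrow> gradient (\<lambda>x. f x - g x) x = gradient f x - gradient g x"
  by (rule gradient_eqI) (auto intro!: derivative_eq_intros smooth_has_gradient simp: inner_diff_left)

lemma gradient_mult:
  "smooth f \<Longrightarrow> smooth g \<Longrightarrow> gradient (\<lambda>x. f x * g x) x = f x *\<^sub>R gradient g x + g x *\<^sub>R gradient f x"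
  by (rule gradient_eqI) (auto intro!: derivative_eq_intros smooth_has_gradient simp: inner_add_left algebra_simps)

lemma gradient_divide:
  "smooth f \<Longrightarrow> gradient (\<lambda>x. f x / c) x = (1 / c) *\<^sub>R gradient f x"
  using gradient_mult[of f "\<lambda>_. 1 / c" x] by (simp add: smooth_const)

lemma gradient_compose_snd:
  assumes "smooth f" shows "gradient (\<lambda>X. f (snd X)) X = (0, gradient f (snd X))"
  by (rule gradient_eqI, rule has_derivative_eq_rhs,
      rule has_derivative_compose[OF has_derivative_snd[OF has_derivative_ident] smooth_has_gradient[OF assms]])
     (auto simp: inner_prod_def)

lemma gradient_compose_fst:
  fixes f :: "real \<Rightarrow> real"
  assumes "smooth f" shows "gradient (\<lambda>X. f (fst X)) X = (gradient f (fst X), 0)"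
  by (rule gradient_eqI, rule has_derivative_eq_rhs,
      rule has_derivative_compose[OF has_derivative_fst[OF has_derivative_ident] smooth_has_gradient[OF assms]])
     (auto simp: inner_prod_def)

lemma gradient_slice:
  fixes f :: "real \<times> 'a::euclidean_space \<Rightarrow> real"
  assumes "smooth f" shows "gradient (\<lambda>y. f (x, y)) y = snd (gradient f (x, y))"
proof (rule gradient_eqI)
  have 1: "((\<lambda>y. (x, y)) has_derivative (\<lambda>h. (0, h))) (at y)"
    by (auto intro!: derivative_eq_intros)
  show "((\<lambda>y. f (x, y)) has_derivative (\<lambda>h. snd (gradient f (x, y)) \<bullet> h)) (at y)"
    by (rule has_derivative_eq_rhs[OF has_derivative_compose[OF 1 smooth_has_gradient[OF assms]]])
       (auto simp: inner_prod_def)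
qed

lemma has_real_derivative_fst_slice:
  fixes f :: "real \<times> 'a::euclidean_space \<Rightarrow> real"
  assumes "smooth f" shows "((\<lambda>x. f (x, y)) has_real_derivative fst (gradient f (x, y))) (at x)"
proof -
  have 1: "((\<lambda>x. (x, y)) has_derivative (\<lambda>h. (h, 0))) (at x)"
    by (auto intro!: derivative_eq_intros)
  show ?thesis
    unfolding has_field_derivative_def
    by (rule has_derivative_eq_rhs[OF has_derivative_compose[OF 1 smooth_has_gradient[OF assms]]])
       (auto simp: inner_prod_def)
qed

text \<open>Differentiation under the integral sign. Each partial derivative is again a parameter
  integral of a smooth function, so the induction on \<open>k\<close> runs over all smooth
  \<open>g\<close>. This makes the mean in X_1 of a smooth competitor a smooth function of
  X_2.\<close>

lemma smooth_integral_slice: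
  fixes f :: "real \<times> 'a::euclidean_space \<Rightarrow> real"
  assumes "smooth f"
  shows "smooth (\<lambda>y. integral {a..b} (\<lambda>x. f (x, y)))"
    and "gradient (\<lambda>y. integral {a..b} (\<lambda>x. f (x, y))) y = integral {a..b} (\<lambda>x. snd (gradient f (x, y)))"
proof -
  have cont: "continuous_on A (\<lambda>z. g (T z))" if "smooth g" "continuous_on A T"
    for g :: "real \<times> 'a \<Rightarrow> real" and T and A :: "'c::topological_space set"
    using continuous_on_compose2[OF smooth_continuous[OF that(1), of UNIV] that(2)] by simp
  have contg: "continuous_on A (\<lambda>z. snd (gradient g (T z)))" if "smooth g" "continuous_on A T"
    for g :: "real \<times> 'a \<Rightarrow> real" and T and A :: "'c::topological_space set"
    using continuous_on_compose2[OF smooth_continuous_gradient[OF that(1), of UNIV] that(2)]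
    by (auto intro: continuous_on_snd)
  have deriv: "((\<lambda>y. integral {a..b} (\<lambda>x. g (x, y))) has_derivative
       (\<lambda>h. integral {a..b} (\<lambda>x. snd (gradient g (x, y))) \<bullet> h)) (at y)"
    if g: "smooth g" for g :: "real \<times> 'a \<Rightarrow> real" and y
  proof -
    \<comment> \<open>\<open>leibniz_rule\<close> expects the derivative as a continuous map into
      bounded linear functions, so the gradient is wrapped by \<open>blinfun_inner_right\<close> and
      unwrapped afterwards.\<close>
    let ?fx = "\<lambda>y x. blinfun_inner_right (snd (gradient g (x, y)))"
    have "((\<lambda>y. integral (cbox a b) (\<lambda>x. g (x, y))) has_derivative
       integral (cbox a b) (?fx y)) (at y within UNIV)"
    proof (rule leibniz_rule)
      show "((\<lambda>y. g (x, y)) has_derivative blinfun_apply (?fx y x)) (at y within UNIV)" for x y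
        using smooth_has_gradient[OF smooth_slice[OF g, of x], of y] by (simp add: gradient_slice[OF g])
      show "(\<lambda>x. g (x, y)) integrable_on cbox a b" for y
        by (rule integrable_continuous, rule cont[OF g]) (intro continuous_intros)
      show "continuous_on (UNIV \<times> cbox a b) (\<lambda>(y, x). ?fx y x)"
        unfolding split_def
        by (intro bounded_linear.continuous_on[OF bounded_linear_blinfun_inner_right] contg[OF g] continuous_intros)
    qed auto
    moreover have "blinfun_apply (integral (cbox a b) (?fx y)) = (\<lambda>h. integral {a..b} (\<lambda>x. snd (gradient g (x, y))) \<bullet> h)"
    proof
      fix h
      have 1: "(\<lambda>x. snd (gradient g (x, y))) integrable_on cbox a b"
        by (rule integrable_continuous, rule contg[OF g]) (intro continuous_intros)
      have "blinfun_inner_right (integral (cbox a b) (\<lambda>x. snd (gradient g (x, y)))) = integral (cbox a b) (?fx y)"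
        using integral_linear[OF 1 bounded_linear_blinfun_inner_right] by (simp add: o_def)
      then show "blinfun_apply (integral (cbox a b) (?fx y)) h = integral {a..b} (\<lambda>x. snd (gradient g (x, y))) \<bullet> h"
        by (metis blinfun_inner_right.rep_eq box_real(2))
    qed
    ultimately show ?thesis by simp
  qed
  have "Ck k (\<lambda>y. integral {a..b} (\<lambda>x. g (x, y)))" if "smooth g" for k and g :: "real \<times> 'a \<Rightarrow> real"
    using that
  proof (induction k arbitrary: g)
    case 0
    have "continuous_on (UNIV \<times> cbox a b) (\<lambda>(y, x). g (x, y))"
      unfolding split_def by (intro cont[OF 0] continuous_intros)
    from integral_continuous_on_param[OF this] show ?case by simp
  next
    case (Suc k)
    show ?case
    proof (rule Ck_SucI[OF deriv[OF Suc.prems]])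
      fix c :: 'a assume c: "c \<in> Basis"
      have "integral {a..b} (\<lambda>x. snd (gradient g (x, y))) \<bullet> c = integral {a..b} (\<lambda>x. gradient g (x, y) \<bullet> (0, c))" for y
      proof -
        have 1: "(\<lambda>x. snd (gradient g (x, y))) integrable_on cbox a b"
          by (rule integrable_continuous, rule contg[OF Suc.prems]) (intro continuous_intros)
        show ?thesis
          using integral_linear[OF 1 bounded_linear_inner_left[of c]] by (simp add: o_def inner_prod_def)
      qed
      moreover have "Ck k (\<lambda>y. integral {a..b} (\<lambda>x. gradient g (x, y) \<bullet> (0, c)))"
        by (rule Suc.IH[OF smooth_inner_gradient[OF Suc.prems]]) (use c in \<open>simp add: Basis_prod_def\<close>)
      ultimately show "Ck k (\<lambda>y. integral {a..b} (\<lambda>x. snd (gradient g (x, y))) \<bullet> c)"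
        by simp
    qed
  qed
  with assms show "smooth (\<lambda>y. integral {a..b} (\<lambda>x. f (x, y)))"
    by (simp add: smooth_def[of "\<lambda>y. integral {a..b} (\<lambda>x. f (x, y))"])
  show "gradient (\<lambda>y. integral {a..b} (\<lambda>x. f (x, y))) y = integral {a..b} (\<lambda>x. snd (gradient f (x, y)))"
    by (rule gradient_eqI[OF deriv[OF assms]])
qed

section \<open>Test functions and integrals of compactly supported functions\<close>

lemma test_functionsI:
  assumes "smooth \<phi>" "compact K" "K \<subseteq> \<Omega>" "\<And>x. x \<notin> K \<Longrightarrow> \<phi> x = 0"
  shows "\<phi> \<in> test_functions \<Omega>"
proof -
  have "closure {x. \<phi> x \<noteq> 0} \<subseteq> K"
    using assms by (intro closure_minimal) (auto simp: compact_imp_closed)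
  moreover from this have "compact (closure {x. \<phi> x \<noteq> 0})"
    using assms(2) by (meson bounded_subset closed_closure compact_eq_bounded_closed)
  ultimately show ?thesis
    using assms unfolding test_functions_def smooth_def by blast
qed

lemma test_functionsE:
  assumes "\<phi> \<in> test_functions \<Omega>"
  obtains K where "smooth \<phi>" "compact K" "K \<subseteq> \<Omega>" "\<And>x. x \<notin> K \<Longrightarrow> \<phi> x = 0" "\<And>x. x \<notin> K \<Longrightarrow> gradient \<phi> x = 0"
proof -
  define K where "K = closure {x. \<phi> x \<noteq> 0}"
  have K_closed: "open (- K)"
    by (simp add: K_def open_Compl)
  have 0: "\<phi> x = 0" if "x \<notin> K" for x
    using that closure_subset[of "{x. \<phi> x \<noteq> 0}"] K_def by blast
  have "gradient \<phi> x = 0" if "x \<notin> K" for x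
  proof (rule gradient_eqI)
    have "((\<lambda>_. 0) has_derivative (\<lambda>h. 0 \<bullet> h)) (at x)" by simp
    then show "(\<phi> has_derivative (\<lambda>h. 0 \<bullet> h)) (at x)"
      by (rule has_derivative_transform_within_open[of _ _ _ _ "- K"]) (use that 0 in \<open>auto simp: K_closed\<close>)
  qed
  with 0 that[of K] assms show ?thesis
    unfolding K_def test_functions_def smooth_def by blast
qed

lemma test_functions_smooth: "\<phi> \<in> test_functions \<Omega> \<Longrightarrow> smooth \<phi>"
  using test_functionsE by blast

lemma test_functions_mono: "\<Omega> \<subseteq> \<Omega>' \<Longrightarrow> test_functions \<Omega> \<subseteq> test_functions \<Omega>'"
  unfolding test_functions_def by blast

lemma zero_test_function: "(\<lambda>x. 0) \<in> test_functions \<Omega>"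
  by (rule test_functionsI[of _ "{}"]) (auto intro: smooth_const)

lemma integrable_lborel_compact_support:
  fixes k :: "'a::euclidean_space \<Rightarrow> 'b::euclidean_space"
  assumes "continuous_on UNIV k" "compact K" "\<And>x. x \<notin> K \<Longrightarrow> k x = 0"
  shows "integrable lborel k"
proof -
  have "(\<lambda>x. indicator K x *\<^sub>R k x) = k"
    using assms(3) by (auto simp: indicator_def)
  with borel_integrable_compact[OF assms(2), of k] assms(1) show ?thesis
    by (metis continuous_on_subset subset_UNIV)
qed

lemma compact_support_bounded:
  fixes k :: "'a::euclidean_space \<Rightarrow> 'b::real_normed_vector"
  assumes "continuous_on UNIV k" "compact K" "\<And>x. x \<notin> K \<Longrightarrow> k x = 0"
  obtains M where "M \<ge> 0" "\<And>x. norm (k x) \<le> M"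
proof -
  have "bounded (k ` K)"
    using assms by (meson compact_continuous_image compact_imp_bounded continuous_on_subset subset_UNIV)
  then obtain M where "\<And>x. x \<in> K \<Longrightarrow> norm (k x) \<le> M"
    by (auto simp: bounded_iff)
  then have "norm (k x) \<le> max M 0" for x
    using assms(3)[of x] by (cases "x \<in> K") (auto simp: le_max_iff_disj)
  then show ?thesis using that[of "max M 0"] by auto
qed

lemma integral_lborel_translate:
  fixes h :: "'a::euclidean_space \<Rightarrow> real"
  assumes [measurable]: "h \<in> borel_measurable borel"
  shows "(LINT x|lborel. h (x + v)) = (LINT x|lborel. h x)"
proof -
  have "(LINT x|lborel. h x) = (LINT x|distr lborel borel ((+) v). h x)"
    by (simp add: lborel_distr_plus)
  also have "\<dots> = (LINT x|lborel. h (x + v))"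
    by (subst integral_distr) (auto simp: add.commute)
  finally show ?thesis by simp
qed

text \<open>The difference quotients of \<open>h\<close> have integral zero by translation invariance.\<close>

lemma integral_directional_derivative_eq_0:
  fixes h :: "'a::euclidean_space \<Rightarrow> real"
  assumes h: "\<And>x. (h has_derivative (\<lambda>v. g x \<bullet> v)) (at x)"
    and g: "continuous_on UNIV g"
    and K: "compact K" "\<And>x. x \<notin> K \<Longrightarrow> h x = 0"
  shows "(LINT x|lborel. g x \<bullet> v) = 0"
proof -
  have g0: "g x = 0" if "x \<notin> K" for x
  proof -
    have "((\<lambda>_. 0) has_derivative (\<lambda>v. 0)) (at x)" by simp
    then have "(h has_derivative (\<lambda>v. 0)) (at x)"
      by (rule has_derivative_transform_within_open[of _ _ _ _ "- K"])
        (use that K in \<open>auto simp: compact_imp_closed open_Compl\<close>)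
    from has_derivative_unique[OF this h[of x]] have "g x \<bullet> g x = 0" by metis
    then show ?thesis by simp
  qed
  have hc: "continuous_on UNIV h"
    using h has_derivative_continuous by (blast intro: continuous_at_imp_continuous_on)
  then have [measurable]: "h \<in> borel_measurable borel"
    by (rule borel_measurable_continuous_onI)
  have [measurable]: "g \<in> borel_measurable borel"
    using g by (rule borel_measurable_continuous_onI)
  have hi: "integrable lborel h"
    using integrable_lborel_compact_support[OF hc K(1,2)] by auto
  have hti: "integrable lborel (\<lambda>x. h (x + w))" for w
  proof -
    have "integrable (distr lborel borel ((+) w)) h" using hi by (simp add: lborel_distr_plus)
    then show ?thesis by (subst (asm) integrable_distr_eq) (auto simp: add.commute)
  qed
  obtain M where M: "M \<ge> 0" "\<And>x. norm (g x) \<le> M"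
    using compact_support_bounded[OF g K(1) g0] by metis
  define t where "t n = inverse (real (Suc n))" for n
  have t: "t n > 0" "t n \<le> 1" for n by (auto simp: t_def divide_simps)
  have t0: "t \<longlonglongrightarrow> 0" unfolding t_def by (rule LIMSEQ_inverse_real_of_nat)
  let ?s = "\<lambda>n x. (h (x + t n *\<^sub>R v) - h x) / t n"
  \<comment> \<open>Since \<open>t n \<le> 1\<close>, all difference quotients vanish outside this
    enlargement of \<open>K\<close>, which gives one integrable majorant for every
    \<open>n\<close>.\<close>
  let ?K = "{x + y |x y. x \<in> K \<and> y \<in> cball 0 (norm v)}"
  have cK: "compact ?K" by (intro compact_sums K(1) compact_cball)
  have KK: "K \<subseteq> ?K" by force
  have onorm: "onorm (\<lambda>v. g x \<bullet> v) \<le> M" for x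
    by (rule onorm_le)
      (metis Cauchy_Schwarz_ineq2 M(2) mult_right_mono norm_ge_zero order_trans real_norm_def)
  have lip: "norm (h (x + w) - h x) \<le> M * norm w" for x w
  proof -
    have "norm (h (x + w) - h x) \<le> M * norm ((x + w) - x)"
      by (rule differentiable_bound[of UNIV h "\<lambda>x v. g x \<bullet> v"])
        (use h onorm in \<open>auto simp: has_derivative_at_withinI\<close>)
    then show ?thesis by simp
  qed
  have "(\<lambda>n. LINT x|lborel. ?s n x) \<longlonglongrightarrow> (LINT x|lborel. g x \<bullet> v)"
  proof (rule integral_dominated_convergence[where w = "\<lambda>x. indicator ?K x *\<^sub>R (M * norm v)"])
    show "(\<lambda>x. g x \<bullet> v) \<in> borel_measurable lborel" by measurable
    show "?s n \<in> borel_measurable lborel" for n by measurable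
    show "integrable lborel (\<lambda>x. indicator ?K x *\<^sub>R (M * norm v))"
      by (rule borel_integrable_compact[OF cK]) auto
    show "AE x in lborel. (\<lambda>n. ?s n x) \<longlonglongrightarrow> g x \<bullet> v"
    proof (rule AE_I2)
      fix x
      have "((\<lambda>s. h (x + s *\<^sub>R v)) has_derivative (\<lambda>s. g (x + 0 *\<^sub>R v) \<bullet> (s *\<^sub>R v))) (at 0)"
        by (rule has_derivative_compose[OF _ h]) (auto intro!: derivative_eq_intros)
      then have "((\<lambda>s. h (x + s *\<^sub>R v)) has_real_derivative (g x \<bullet> v)) (at 0)"
        by (simp add: has_field_derivative_def mult_commute_abs)
      then have *: "((\<lambda>s. (h (x + s *\<^sub>R v) - h x) / s) \<longlongrightarrow> g x \<bullet> v) (at 0)"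
        by (simp add: DERIV_def)
      have "filterlim t (at 0) sequentially"
        using t0 t(1) by (intro filterlim_atI) (auto simp: less_imp_neq[symmetric])
      from filterlim_compose[OF * this] show "(\<lambda>n. ?s n x) \<longlonglongrightarrow> g x \<bullet> v" .
    qed
    show "AE x in lborel. norm (?s n x) \<le> indicator ?K x *\<^sub>R (M * norm v)" for n
    proof (rule AE_I2)
      fix x
      show "norm (?s n x) \<le> indicator ?K x *\<^sub>R (M * norm v)"
      proof (cases "x \<in> ?K")
        case True
        have "norm (h (x + t n *\<^sub>R v) - h x) \<le> M * norm v * t n"
          using lip[of x "t n *\<^sub>R v"] t[of n] by (simp add: ac_simps)
        with True t[of n] show ?thesis by (simp add: divide_simps)
      next
        case False
        then have "x \<notin> K" using KK by blast
        moreover have "x + t n *\<^sub>R v \<notin> K"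
        proof
          assume "x + t n *\<^sub>R v \<in> K"
          moreover have "norm (- (t n *\<^sub>R v)) \<le> norm v" using t[of n] by (simp add: mult_left_le_one_le)
          ultimately have "(x + t n *\<^sub>R v) + (- (t n *\<^sub>R v)) \<in> ?K" by (blast intro: mem_cball_0[THEN iffD2])
          moreover have "(x + t n *\<^sub>R v) + (- (t n *\<^sub>R v)) = x" by simp
          ultimately show False using False by (simp only:)
        qed
        ultimately show ?thesis using K(2) False by simp
      qed
    qed
  qed
  moreover have "(LINT x|lborel. ?s n x) = 0" for n
    using hi hti[of "t n *\<^sub>R v"] integral_lborel_translate[of h] by simp
  ultimately have "(\<lambda>n. 0) \<longlonglongrightarrow> (LINT x|lborel. g x \<bullet> v)"
    by (simp only:)
  then show ?thesis
    by (simp add: LIMSEQ_const_iff)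
qed

section \<open>Uniqueness of weak gradients\<close>

lemma integrable_lebesgue_on_compact_support:
  fixes k :: "'a::euclidean_space \<Rightarrow> 'b::euclidean_space"
  assumes "open \<Omega>" "continuous_on UNIV k" "compact K" "K \<subseteq> \<Omega>" "\<And>x. x \<notin> K \<Longrightarrow> k x = 0"
  shows "integrable (lebesgue_on \<Omega>) k"
    and "(LINT x|lebesgue_on \<Omega>. k x) = (LINT x|lborel. k x)"
proof -
  have meas: "k \<in> borel_measurable lborel"
    using borel_measurable_continuous_onI[OF assms(2)] by simp
  have ind: "indicator \<Omega> x *\<^sub>R k x = k x" for x
    using assms(4,5) by (auto simp: indicator_def)
  have \<Omega>: "\<Omega> \<inter> space lebesgue \<in> sets lebesgue"
    using assms(1) by simp
  show "integrable (lebesgue_on \<Omega>) k"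
    using integrable_lborel_compact_support[OF assms(2,3,5)] meas
    by (simp add: integrable_restrict_space[OF \<Omega>] ind integrable_completion)
  show "(LINT x|lebesgue_on \<Omega>. k x) = (LINT x|lborel. k x)"
    using meas by (simp add: integral_restrict_space[OF \<Omega>] ind integral_completion)
qed

lemma L1_loc_integrable_indicator:
  fixes u :: "'a::euclidean_space \<Rightarrow> 'b::euclidean_space"
  assumes "open \<Omega>" "u \<in> L1_loc \<Omega>" "compact K" "K \<subseteq> \<Omega>"
  shows "integrable (lebesgue_on \<Omega>) (\<lambda>x. indicator K x *\<^sub>R u x)"
proof -
  have "integrable (lebesgue_on K) u"
    using assms by (auto simp: L1_loc_def)
  then have "integrable lebesgue (\<lambda>x. indicator K x *\<^sub>R u x)"
    using assms(3) by (subst (asm) integrable_restrict_space) (auto simp: lmeasurable_compact fmeasurableD)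
  moreover have "(\<lambda>x. indicator \<Omega> x *\<^sub>R indicator K x *\<^sub>R u x) = (\<lambda>x. indicator K x *\<^sub>R u x)"
    using assms(4) by (auto simp: fun_eq_iff indicator_def)
  ultimately show ?thesis
    using assms(1) by (subst integrable_restrict_space) auto
qed

lemma L1_loc_integrable_scaleR_left:
  fixes u :: "'a::euclidean_space \<Rightarrow> 'b::euclidean_space" and c :: "'a \<Rightarrow> real"
  assumes "open \<Omega>" "u \<in> L1_loc \<Omega>" "compact K" "K \<subseteq> \<Omega>" "continuous_on UNIV c" "\<And>x. x \<notin> K \<Longrightarrow> c x = 0"
  shows "integrable (lebesgue_on \<Omega>) (\<lambda>x. c x *\<^sub>R u x)"
proof -
  obtain M where M: "M \<ge> 0" "\<And>x. norm (c x) \<le> M"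
    using compact_support_bounded[OF assms(5,3,6)] by metis
  have int: "integrable (lebesgue_on \<Omega>) (\<lambda>x. indicator K x *\<^sub>R u x)"
    by (rule L1_loc_integrable_indicator[OF assms(1-4)])
  have [measurable]: "c \<in> borel_measurable (lebesgue_on \<Omega>)"
    by (rule continuous_imp_measurable_on_sets_lebesgue)
       (use assms(1,5) continuous_on_subset in auto)
  have [measurable]: "(\<lambda>x. indicator K x *\<^sub>R u x) \<in> borel_measurable (lebesgue_on \<Omega>)"
    using int by (rule borel_measurable_integrable)
  have eq: "c x *\<^sub>R u x = c x *\<^sub>R (indicator K x *\<^sub>R u x)" for x
    using assms(6)[of x] by (auto simp: indicator_def)
  show ?thesis
    unfolding eq
  proof (rule Bochner_Integration.integrable_bound)
    show "integrable (lebesgue_on \<Omega>) (\<lambda>x. M *\<^sub>R (indicator K x *\<^sub>R u x))"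
      using int by (rule integrable_scaleR_right)
    show "AE x in lebesgue_on \<Omega>. norm (c x *\<^sub>R indicator K x *\<^sub>R u x) \<le> norm (M *\<^sub>R indicator K x *\<^sub>R u x)"
      using M by (intro AE_I2) (auto intro!: mult_right_mono split: split_indicator)
  qed measurable
qed

lemma L1_loc_integrable_scaleR_right:
  fixes c :: "'a::euclidean_space \<Rightarrow> 'b::euclidean_space" and u :: "'a \<Rightarrow> real"
  assumes "open \<Omega>" "u \<in> L1_loc \<Omega>" "compact K" "K \<subseteq> \<Omega>" "continuous_on UNIV c" "\<And>x. x \<notin> K \<Longrightarrow> c x = 0"
  shows "integrable (lebesgue_on \<Omega>) (\<lambda>x. u x *\<^sub>R c x)"
proof -
  have "integrable (lebesgue_on \<Omega>) (\<lambda>x. ((c x \<bullet> b) *\<^sub>R u x) *\<^sub>R b)" for b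
    by (rule integrable_scaleR_left, rule L1_loc_integrable_scaleR_left[OF assms(1-4)])
       (use assms(5,6) in \<open>auto intro: continuous_intros\<close>)
  then have "integrable (lebesgue_on \<Omega>) (\<lambda>x. \<Sum>b\<in>Basis. ((c x \<bullet> b) *\<^sub>R u x) *\<^sub>R b)"
    by (rule Bochner_Integration.integrable_sum)
  moreover have "(\<Sum>b\<in>Basis. ((c x \<bullet> b) *\<^sub>R u x) *\<^sub>R b) = u x *\<^sub>R c x" for x
    by (simp add: mult.commute flip: scaleR_scaleR scaleR_sum_right) (simp add: euclidean_representation)
  ultimately show ?thesis by simp
qed

text \<open>Smooth functions with values in [0, 1] that tend pointwise to the indicator of
  \<open>box a b\<close>, because \<open>bump (real (Suc n) * t)\<close> tends to 1 for every
  \<open>t > 0\<close>. They carry information from test functions to boxes.\<close>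

definition box_bump :: "'a::euclidean_space \<Rightarrow> 'a \<Rightarrow> nat \<Rightarrow> 'a \<Rightarrow> real" where
  "box_bump a b n x = (\<Prod>i\<in>Basis. bump (real (Suc n) * (x \<bullet> i - a \<bullet> i)) * bump (real (Suc n) * (b \<bullet> i - x \<bullet> i)))"

lemma smooth_box_bump: "smooth (box_bump a b n)"
  unfolding box_bump_def[abs_def]
proof (intro smooth_prod smooth_mult)
  fix i :: 'a
  show "smooth (\<lambda>x. bump (real (Suc n) * (x \<bullet> i - a \<bullet> i)))"
    by (rule smooth_compose_affine[OF smooth_bump, of _ "\<lambda>h. real (Suc n) * (h \<bullet> i)"])
       (auto intro!: derivative_eq_intros)
  show "smooth (\<lambda>x. bump (real (Suc n) * (b \<bullet> i - x \<bullet> i)))"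
    by (rule smooth_compose_affine[OF smooth_bump, of _ "\<lambda>h. - (real (Suc n) * (h \<bullet> i))"])
       (auto intro!: derivative_eq_intros)
qed

lemma box_bump_eq_0: "x \<notin> box a b \<Longrightarrow> box_bump a b n x = 0"
  by (auto simp: box_bump_def mem_box not_less bump_pos_iff mult_le_0_iff)

lemma box_bump_bounds: "0 \<le> box_bump a b n x" "box_bump a b n x \<le> 1"
  by (auto simp: box_bump_def bump_bounds intro!: prod_nonneg prod_le_1 mult_le_one)

lemma bump_tendsto_1:
  assumes "t > 0" shows "(\<lambda>n. bump (real (Suc n) * t)) \<longlonglongrightarrow> 1"
proof -
  have "(\<lambda>n. exp (- (inverse (real (Suc n)) * inverse t))) \<longlonglongrightarrow> exp (- (0 * inverse t))"
    by (intro tendsto_intros LIMSEQ_inverse_real_of_nat)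
  moreover have "bump (real (Suc n) * t) = exp (- (inverse (real (Suc n)) * inverse t))" for n
    using assms by (simp add: bump_eq mult_le_0_iff divide_inverse)
  ultimately show ?thesis by simp
qed

lemma box_bump_tendsto: "(\<lambda>n. box_bump a b n x) \<longlonglongrightarrow> indicator (box a b) x"
proof (cases "x \<in> box a b")
  case True
  then have "(\<lambda>n. box_bump a b n x) \<longlonglongrightarrow> (\<Prod>i\<in>(Basis::'a set). 1 * 1)"
    unfolding box_bump_def by (intro tendsto_intros bump_tendsto_1) (auto simp: mem_box)
  with True show ?thesis by simp
qed (simp add: box_bump_eq_0)

lemma box_bump_test_function:
  assumes "cbox a b \<subseteq> \<Omega>" shows "box_bump a b n \<in> test_functions \<Omega>"
  by (rule test_functionsI[OF smooth_box_bump compact_cbox assms])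
     (use box_bump_eq_0 box_subset_cbox in blast)

text \<open>Dominated convergence along \<open>box_bump\<close>. As \<open>g\<close> is only locally
  integrable, the majorant is \<open>g\<close> restricted to the compact box
  \<open>cbox a b\<close>, which has to lie in \<Omega>.\<close>

lemma integral_box_eq_0:
  fixes g :: "'a::euclidean_space \<Rightarrow> 'b::euclidean_space"
  assumes "open \<Omega>" "g \<in> L1_loc \<Omega>"
    and test: "\<And>\<phi>. \<phi> \<in> test_functions \<Omega> \<Longrightarrow> (LINT x|lebesgue_on \<Omega>. \<phi> x *\<^sub>R g x) = 0"
    and ab: "cbox a b \<subseteq> \<Omega>"
  shows "(LINT x|lebesgue. indicator (box a b) x *\<^sub>R g x) = 0"
proof -
  have int: "integrable (lebesgue_on \<Omega>) (\<lambda>x. indicator (cbox a b) x *\<^sub>R g x)"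
    by (rule L1_loc_integrable_indicator[OF assms(1,2) compact_cbox ab])
  have \<Omega>: "\<Omega> \<inter> space lebesgue \<in> sets lebesgue" using assms(1) by simp
  have [measurable]: "(\<lambda>x. indicator (cbox a b) x *\<^sub>R g x) \<in> borel_measurable (lebesgue_on \<Omega>)"
    using int by (rule borel_measurable_integrable)
  have [measurable]: "(indicator (box a b) :: 'a \<Rightarrow> real) \<in> borel_measurable (lebesgue_on \<Omega>)"
    by (rule borel_measurable_indicator') (auto simp: sets_restrict_space)
  have eq: "indicator (box a b) x *\<^sub>R g x = indicator (box a b) x *\<^sub>R (indicator (cbox a b) x *\<^sub>R g x)" for x
    using box_subset_cbox[of a b] by (auto simp: indicator_def)
  have "(\<lambda>n. LINT x|lebesgue_on \<Omega>. box_bump a b n x *\<^sub>R g x) \<longlonglongrightarrow> (LINT x|lebesgue_on \<Omega>. indicator (box a b) x *\<^sub>R g x)"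
  proof (rule integral_dominated_convergence[where w = "\<lambda>x. norm (indicator (cbox a b) x *\<^sub>R g x)"])
    show "(\<lambda>x. indicator (box a b) x *\<^sub>R g x) \<in> borel_measurable (lebesgue_on \<Omega>)"
      unfolding eq by measurable
    show "(\<lambda>x. box_bump a b n x *\<^sub>R g x) \<in> borel_measurable (lebesgue_on \<Omega>)" for n
      by (rule borel_measurable_integrable,
          rule L1_loc_integrable_scaleR_left[OF assms(1,2) compact_cbox ab smooth_continuous[OF smooth_box_bump]])
        (use box_bump_eq_0 box_subset_cbox in blast)
    show "integrable (lebesgue_on \<Omega>) (\<lambda>x. norm (indicator (cbox a b) x *\<^sub>R g x))"
      using int by (rule integrable_norm)
    show "AE x in lebesgue_on \<Omega>. (\<lambda>n. box_bump a b n x *\<^sub>R g x) \<longlonglongrightarrow> indicator (box a b) x *\<^sub>R g x"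
      by (intro AE_I2 tendsto_intros box_bump_tendsto)
    show "AE x in lebesgue_on \<Omega>. norm (box_bump a b n x *\<^sub>R g x) \<le> norm (indicator (cbox a b) x *\<^sub>R g x)" for n
    proof (rule AE_I2)
      fix x show "norm (box_bump a b n x *\<^sub>R g x) \<le> norm (indicator (cbox a b) x *\<^sub>R g x)"
        using box_bump_bounds[of a b n x] box_bump_eq_0[of x a b n] box_subset_cbox[of a b]
        by (cases "x \<in> box a b") (auto intro: mult_left_le_one_le split: split_indicator)
    qed
  qed
  then have "(LINT x|lebesgue_on \<Omega>. indicator (box a b) x *\<^sub>R g x) = 0"
    using test[OF box_bump_test_function[OF ab]] by (simp add: LIMSEQ_const_iff)
  moreover have "(\<lambda>x. indicator \<Omega> x *\<^sub>R (indicator (box a b) x *\<^sub>R g x)) = (\<lambda>x. indicator (box a b) x *\<^sub>R g x)"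
    using ab box_subset_cbox[of a b] by (auto simp: fun_eq_iff indicator_def)
  ultimately show ?thesis
    by (simp add: integral_restrict_space[OF \<Omega>])
qed

lemma sigma_finite_lebesgue: "sigma_finite_measure (lebesgue :: 'a::euclidean_space measure)"
proof
  obtain A :: "'a set set" where "countable A" "A \<subseteq> sets lborel" "\<Union>A = space lborel" "\<forall>a\<in>A. emeasure lborel a \<noteq> \<infinity>"
    using lborel.sigma_finite_countable by blast
  then show "\<exists>A. countable A \<and> A \<subseteq> sets lebesgue \<and> \<Union>A = space lebesgue \<and> (\<forall>a\<in>A. emeasure (lebesgue :: 'a measure) a \<noteq> \<infinity>)"
    by (intro exI[of _ A]) auto
qed

text \<open>Open boxes form an intersection-stable generator of the Borel sets, so vanishing
  integrals over boxes propagate to all Borel sets and, up to null sets, to all Lebesgue sets. An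
  integrable function whose integral over each measurable set is 0 vanishes almost
  everywhere.\<close>

lemma box_AE_eq_0:
  fixes g :: "'a::euclidean_space \<Rightarrow> 'b::euclidean_space"
  assumes int: "integrable lebesgue (\<lambda>x. indicator (box c d) x *\<^sub>R g x)"
    and zero: "\<And>a b. box a b \<subseteq> box c d \<Longrightarrow> (LINT x|lebesgue. indicator (box a b) x *\<^sub>R g x) = 0"
  shows "AE x in lebesgue. x \<in> box c d \<longrightarrow> g x = 0"
proof -
  let ?h = "\<lambda>x. indicator (box c d) x *\<^sub>R g x"
  have sint: "set_integrable lebesgue A ?h" if "A \<in> sets lebesgue" for A
    using integrable_mult_indicator[OF that int] by (simp add: set_integrable_def)
  have base: "(LINT x:box a b|lebesgue. ?h x) = 0" for a b
  proof -
    obtain a' b' where ab: "box a b \<inter> box c d = box a' b'"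
      using box_Int_box by blast
    have "(LINT x:box a b|lebesgue. ?h x) = (LINT x|lebesgue. indicator (box a' b') x *\<^sub>R g x)"
      unfolding set_lebesgue_integral_def ab[symmetric] by (simp add: indicator_inter_arith)
    also have "\<dots> = 0" by (rule zero) (use ab in blast)
    finally show ?thesis .
  qed
  have tot: "(LINT x|lebesgue. ?h x) = 0"
    using zero[of c d] by simp
  have borel: "(LINT x:A|lebesgue. ?h x) = 0" if "A \<in> sets borel" for A
  proof -
    have "Int_stable (range (\<lambda>(a, b). box a b :: 'a set))"
      by (auto simp: Int_stable_def box_Int_box)
    moreover have "range (\<lambda>(a, b). box a b :: 'a set) \<subseteq> Pow UNIV"
      by simp
    moreover have "A \<in> sigma_sets UNIV (range (\<lambda>(a, b). box a b :: 'a set))"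
      using that by (simp add: borel_eq_box)
    ultimately show ?thesis
    proof (induction rule: sigma_sets_induct_disjoint)
      case (basic A) then show ?case using base by auto
    next
      case empty then show ?case by (simp add: set_lebesgue_integral_def)
    next
      case (compl A)
      have A: "A \<in> sets lebesgue"
        using compl.hyps by (simp add: borel_eq_box)
      have "(LINT x:UNIV - A|lebesgue. ?h x) = (LINT x|lebesgue. ?h x - indicator A x *\<^sub>R ?h x)"
        unfolding set_lebesgue_integral_def
        by (intro Bochner_Integration.integral_cong) (auto simp: indicator_def)
      also have "\<dots> = (LINT x|lebesgue. ?h x) - (LINT x:A|lebesgue. ?h x)"
        using sint[OF A] int unfolding set_lebesgue_integral_def set_integrable_def by simp
      finally show ?case using tot compl.IH by simp
    next
      case (union A)
      have A: "A i \<in> sets lebesgue" for i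
      proof -
        have "A i \<in> sigma_sets UNIV (range (\<lambda>(a, b). box a b))"
          using union.hyps(2) by blast
        then have "A i \<in> sets borel"
          by (simp add: borel_eq_box)
        then show ?thesis by simp
      qed
      have "(LINT x:(\<Union>i. A i)|lebesgue. ?h x) = (\<Sum>i. LINT x:A i|lebesgue. ?h x)"
        by (rule lebesgue_integral_countable_add)
          (use union.hyps(1) A sint[of "\<Union>i. A i"] in \<open>auto simp: disjoint_family_on_def\<close>)
      then show ?case using union.IH by simp
    qed
  qed
  have "AE x in lebesgue. ?h x = 0"
  proof (rule sigma_finite_measure.density_zero[OF sigma_finite_lebesgue int])
    fix A :: "'a set" assume "A \<in> sets lebesgue"
    \<comment> \<open>A Lebesgue set differs from a Borel set by a subset of a null set, which
      leaves the integral unchanged.\<close>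
    then obtain S N N' where *: "A = S \<union> N" "N \<subseteq> N'" "N' \<in> null_sets lborel" "S \<in> sets lborel"
      by (rule sets_completionE)
    have "AE x in lebesgue. x \<notin> N'"
      using *(3) by (intro AE_completion) (rule AE_not_in)
    then have "AE x in lebesgue. indicator A x *\<^sub>R ?h x = indicator S x *\<^sub>R ?h x"
      by eventually_elim (use * in \<open>auto simp: indicator_def\<close>)
    then have "(LINT x:A|lebesgue. ?h x) = (LINT x:S|lebesgue. ?h x)"
      unfolding set_lebesgue_integral_def using sint[of A] sint[of S] \<open>A \<in> _\<close> *(4)
      by (intro integral_cong_AE) (auto simp: set_integrable_def)
    also have "\<dots> = 0" using borel *(4) by simp
    finally show "(LINT x:A|lebesgue. ?h x) = 0" .
  qed
  then show ?thesis by eventually_elim (auto simp: indicator_def)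
qed

text \<open>\<Omega> is a countable union of closed boxes. On the interior of each of them
  \<open>box_AE_eq_0\<close> applies, and the boundaries are null sets.\<close>

lemma fundamental_lemma_of_variations:
  fixes g :: "'a::euclidean_space \<Rightarrow> 'b::euclidean_space"
  assumes "open \<Omega>" "g \<in> L1_loc \<Omega>"
    and test: "\<And>\<phi>. \<phi> \<in> test_functions \<Omega> \<Longrightarrow> (LINT x|lebesgue_on \<Omega>. \<phi> x *\<^sub>R g x) = 0"
  shows "AE x in lebesgue_on \<Omega>. g x = 0"
proof -
  obtain \<D> where \<D>: "countable \<D>" "\<D> \<subseteq> Pow \<Omega>" "\<And>X. X \<in> \<D> \<Longrightarrow> \<exists>a b. X = cbox a b" "\<Union>\<D> = \<Omega>"
    using open_countable_Union_open_cbox[OF assms(1)] by metis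
  have "AE x in lebesgue. x \<in> X \<longrightarrow> g x = 0" if X\<D>: "X \<in> \<D>" for X
  proof -
    obtain a b where X: "X = cbox a b" "cbox a b \<subseteq> \<Omega>" using \<D>(2) \<D>(3)[OF X\<D>] X\<D> by blast
    have "integrable (lebesgue_on (cbox a b)) g"
      using assms(2) X by (auto simp: L1_loc_def)
    then have "integrable lebesgue (\<lambda>x. indicator (cbox a b) x *\<^sub>R g x)"
      by (subst (asm) integrable_restrict_space) auto
    from integrable_mult_indicator[OF _ this, of "box a b"]
    have "integrable lebesgue (\<lambda>x. indicator (box a b) x *\<^sub>R (indicator (cbox a b) x *\<^sub>R g x))"
      by simp
    moreover have "(\<lambda>x. indicator (box a b) x *\<^sub>R (indicator (cbox a b) x *\<^sub>R g x)) = (\<lambda>x. indicator (box a b) x *\<^sub>R g x)"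
      using box_subset_cbox[of a b] by (auto simp: fun_eq_iff indicator_def)
    ultimately have int: "integrable lebesgue (\<lambda>x. indicator (box a b) x *\<^sub>R g x)" by simp
    have "AE x in lebesgue. x \<in> box a b \<longrightarrow> g x = 0"
    proof (rule box_AE_eq_0[OF int])
      fix a' b' assume sub: "box a' b' \<subseteq> box a b"
      show "(LINT x|lebesgue. indicator (box a' b') x *\<^sub>R g x) = 0"
      proof (cases "box a' b' = {}")
        case False
        \<comment> \<open>Closures put \<open>cbox a' b'\<close> inside \<Omega>; the closure of an
          open box is the closed box only if the open one is nonempty, hence the case split.\<close>
        have "closure (box a' b') \<subseteq> closure (box a b)"
          using sub by (rule closure_mono)
        then have "cbox a' b' \<subseteq> \<Omega>"
          using False X(2) sub closure_box[of a' b'] closure_box[of a b] by (metis empty_iff subset_empty order_trans)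
        then show ?thesis
          using integral_box_eq_0[OF assms(1,2) test] by blast
      qed simp
    qed
    moreover have "AE x in lebesgue. x \<notin> cbox a b - box a b"
      by (rule AE_not_in) (use negligible_frontier_interval in \<open>simp add: negligible_iff_null_sets\<close>)
    ultimately show ?thesis
      unfolding X(1) by eventually_elim auto
  qed
  then have "AE x in lebesgue. \<forall>X\<in>\<D>. x \<in> X \<longrightarrow> g x = 0"
    by (intro AE_ball_countable[OF \<D>(1), THEN iffD2] ballI)
  then have "AE x in lebesgue. x \<in> \<Omega> \<longrightarrow> g x = 0"
    by eventually_elim (use \<D>(4) in blast)
  then show ?thesis
    using assms(1) by (subst AE_restrict_space_iff) auto
qed

section \<open>Weak gradients and Fubini on strips\<close>

text \<open>Lebesgue measure is complete, so measurability passes along almost everywhere equality.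
  In this way the representative picked by \<open>weak_gradient\<close> becomes measurable.\<close>

lemma borel_measurable_lebesgue_on_AE:
  fixes f :: "'a::euclidean_space \<Rightarrow> 'b::euclidean_space"
  assumes "\<Omega> \<in> sets lebesgue" "f \<in> borel_measurable (lebesgue_on \<Omega>)" "AE x in lebesgue_on \<Omega>. f x = g x"
  shows "g \<in> borel_measurable (lebesgue_on \<Omega>)"
proof -
  have "AE x in lebesgue. (if x \<in> \<Omega> then f x else 0) = (if x \<in> \<Omega> then g x else 0)"
    using assms(1,3) by (subst (asm) AE_restrict_space_iff) auto
  from borel_measurable_AE[OF _ this] show ?thesis
    using assms(2) unfolding borel_measurable_if[OF assms(1)] by simp
qed

lemma has_weak_gradient_diff:
  assumes "open \<Omega>" "has_weak_gradient \<Omega> u g" "has_weak_gradient \<Omega> v h"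
  shows "has_weak_gradient \<Omega> (\<lambda>x. u x - v x) (\<lambda>x. g x - h x)"
  unfolding has_weak_gradient_def
proof (intro conjI ballI)
  show "(\<lambda>x. u x - v x) \<in> L1_loc \<Omega>" "(\<lambda>x. g x - h x) \<in> L1_loc \<Omega>"
    using assms(2,3) by (auto simp: has_weak_gradient_def L1_loc_def)
next
  fix \<phi> assume \<phi>: "\<phi> \<in> test_functions \<Omega>"
  then obtain K where K: "smooth \<phi>" "compact K" "K \<subseteq> \<Omega>" "\<And>x. x \<notin> K \<Longrightarrow> \<phi> x = 0" "\<And>x. x \<notin> K \<Longrightarrow> gradient \<phi> x = 0"
    by (metis test_functionsE)
  have 1: "integrable (lebesgue_on \<Omega>) (\<lambda>x. w x *\<^sub>R gradient \<phi> x)" if "w \<in> L1_loc \<Omega>" for w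
    by (rule L1_loc_integrable_scaleR_right[OF assms(1) that K(2,3)])
      (use K smooth_continuous_gradient in auto)
  have 2: "integrable (lebesgue_on \<Omega>) (\<lambda>x. \<phi> x *\<^sub>R w x)" if "w \<in> L1_loc \<Omega>" for w :: "'a \<Rightarrow> 'a"
    by (rule L1_loc_integrable_scaleR_left[OF assms(1) that K(2,3)])
      (use K smooth_continuous in auto)
  show "(LINT x|lebesgue_on \<Omega>. (u x - v x) *\<^sub>R gradient \<phi> x) = - (LINT x|lebesgue_on \<Omega>. \<phi> x *\<^sub>R (g x - h x))"
    using assms(2,3) \<phi> 1 2
    by (simp add: has_weak_gradient_def scaleR_diff_left scaleR_diff_right)
qed

text \<open>The difference \<open>g - h\<close> is a weak gradient of the zero function, hence
  orthogonal to all test functions.\<close>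

lemma has_weak_gradient_unique:
  assumes "open \<Omega>" "has_weak_gradient \<Omega> u g" "has_weak_gradient \<Omega> u h"
  shows "AE x in lebesgue_on \<Omega>. g x = h x"
proof -
  have *: "has_weak_gradient \<Omega> (\<lambda>x. u x - u x) (\<lambda>x. g x - h x)"
    by (rule has_weak_gradient_diff[OF assms])
  have "AE x in lebesgue_on \<Omega>. g x - h x = 0"
    by (rule fundamental_lemma_of_variations[OF assms(1)])
      (use * in \<open>auto simp: has_weak_gradient_def\<close>)
  then show ?thesis by simp
qed

text \<open>A test function on the smaller set is already one on the larger set. This is used to
  pass from a cylinder to the cylinder of half the length.\<close>

lemma has_weak_gradient_subset:
  assumes "open \<Omega>" "open \<Omega>'" "\<Omega>' \<subseteq> \<Omega>" "has_weak_gradient \<Omega> u g"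
  shows "has_weak_gradient \<Omega>' u g"
  unfolding has_weak_gradient_def
proof (intro conjI ballI)
  show "u \<in> L1_loc \<Omega>'" "g \<in> L1_loc \<Omega>'"
    using assms(3,4) by (auto simp: has_weak_gradient_def L1_loc_def)
next
  fix \<phi> assume \<phi>: "\<phi> \<in> test_functions \<Omega>'"
  then obtain K where K: "K \<subseteq> \<Omega>'" "\<And>x. x \<notin> K \<Longrightarrow> \<phi> x = 0" "\<And>x. x \<notin> K \<Longrightarrow> gradient \<phi> x = 0"
    by (metis test_functionsE)
  have eq: "(LINT x|lebesgue_on \<Omega>'. k x) = (LINT x|lebesgue_on \<Omega>. k x)"
    if k: "\<And>x. x \<notin> K \<Longrightarrow> k x = 0" for k :: "'a \<Rightarrow> 'a"
  proof -
    have "(\<lambda>x. indicator \<Omega>' x *\<^sub>R k x) = (\<lambda>x. indicator \<Omega> x *\<^sub>R k x)"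
      using K(1) assms(3) k by (auto simp: fun_eq_iff indicator_def)
    then show ?thesis
      using assms(1,2) by (simp add: integral_restrict_space)
  qed
  have "\<phi> \<in> test_functions \<Omega>" using \<phi> test_functions_mono[OF assms(3)] by blast
  then show "(LINT x|lebesgue_on \<Omega>'. u x *\<^sub>R gradient \<phi> x) = - (LINT x|lebesgue_on \<Omega>'. \<phi> x *\<^sub>R g x)"
    using assms(4) K by (simp add: has_weak_gradient_def eq)
qed

lemma continuous_L1_loc:
  fixes u :: "'a::euclidean_space \<Rightarrow> 'b::euclidean_space"
  assumes "continuous_on UNIV u" shows "u \<in> L1_loc \<Omega>"
proof -
  have "integrable (lebesgue_on K) u" if "compact K" for K
  proof -
    have "integrable lborel (\<lambda>x. indicator K x *\<^sub>R u x)"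
      by (rule borel_integrable_compact[OF that continuous_on_subset[OF assms]]) simp
    then have "integrable lebesgue (\<lambda>x. indicator K x *\<^sub>R u x)"
      by (subst integrable_completion) (simp_all add: borel_measurable_integrable)
    then show ?thesis
      using that by (subst integrable_restrict_space) (auto simp: lmeasurable_compact fmeasurableD)
  qed
  then show ?thesis by (auto simp: L1_loc_def)
qed

text \<open>Integration by parts: the product \<open>u x * \<phi> x\<close> has compact support, so
  all its directional derivatives have integral zero.\<close>

lemma smooth_has_weak_gradient:
  assumes "open \<Omega>" "smooth u"
  shows "has_weak_gradient \<Omega> u (gradient u)"
  unfolding has_weak_gradient_def
proof (intro conjI ballI)
  show u: "u \<in> L1_loc \<Omega>" and g: "gradient u \<in> L1_loc \<Omega>"
    using assms(2) by (auto intro!: continuous_L1_loc smooth_continuous smooth_continuous_gradient)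
  fix \<phi> assume \<phi>: "\<phi> \<in> test_functions \<Omega>"
  then obtain K where K: "smooth \<phi>" "compact K" "K \<subseteq> \<Omega>" "\<And>x. x \<notin> K \<Longrightarrow> \<phi> x = 0" "\<And>x. x \<notin> K \<Longrightarrow> gradient \<phi> x = 0"
    by (metis test_functionsE)
  have 1: "integrable (lebesgue_on \<Omega>) (\<lambda>x. u x *\<^sub>R gradient \<phi> x)"
    by (rule L1_loc_integrable_scaleR_right[OF assms(1) u K(2,3)])
      (use K smooth_continuous_gradient in auto)
  have 2: "integrable (lebesgue_on \<Omega>) (\<lambda>x. \<phi> x *\<^sub>R gradient u x)"
    by (rule L1_loc_integrable_scaleR_left[OF assms(1) g K(2,3)])
      (use K smooth_continuous in auto)
  let ?k = "\<lambda>x. u x *\<^sub>R gradient \<phi> x + \<phi> x *\<^sub>R gradient u x"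
  have kc: "continuous_on UNIV ?k"
    by (intro continuous_intros smooth_continuous smooth_continuous_gradient assms K)
  have k0: "?k x = 0" if "x \<notin> K" for x using K that by simp
  have "(LINT x|lborel. ?k x) \<bullet> b = 0" for b
  proof -
    have "(LINT x|lborel. ?k x \<bullet> b) = 0"
    proof (rule integral_directional_derivative_eq_0[OF _ kc K(2)])
      show "((\<lambda>x. u x * \<phi> x) has_derivative (\<lambda>v. ?k x \<bullet> v)) (at x)" for x
        by (rule has_derivative_eq_rhs[OF has_derivative_mult[OF smooth_has_gradient[OF assms(2)] smooth_has_gradient[OF K(1)]]])
           (auto simp: inner_add_left algebra_simps)
    qed (use K k0 in auto)
    moreover have "integrable lborel ?k"
      by (rule integrable_lborel_compact_support[OF kc K(2) k0])
    from integral_inner_left[OF this, of b] calculation show ?thesis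
      by metis
  qed
  then have "(LINT x|lborel. ?k x) = 0"
    by (metis inner_eq_zero_iff)
  moreover have "(LINT x|lebesgue_on \<Omega>. ?k x) = (LINT x|lborel. ?k x)"
    by (rule integrable_lebesgue_on_compact_support(2)[OF assms(1) kc K(2,3) k0])
  ultimately have "(LINT x|lebesgue_on \<Omega>. ?k x) = 0"
    by (simp only:)
  then show "(LINT x|lebesgue_on \<Omega>. u x *\<^sub>R gradient \<phi> x) = - (LINT x|lebesgue_on \<Omega>. \<phi> x *\<^sub>R gradient u x)"
    using 1 2 by (simp add: eq_neg_iff_add_eq_0)
qed

lemma weak_gradient_AE:
  assumes "open \<Omega>" "has_weak_gradient \<Omega> u g"
  shows "AE x in lebesgue_on \<Omega>. weak_gradient \<Omega> u x = g x"
proof -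
  have "has_weak_gradient \<Omega> u (weak_gradient \<Omega> u)"
    unfolding weak_gradient_def by (rule someI[where P = "has_weak_gradient \<Omega> u", OF assms(2)])
  from has_weak_gradient_unique[OF assms(1) this assms(2)] show ?thesis .
qed

text \<open>\<open>f\<close> is only Lebesgue measurable, while Fubini is available for the product
  of Borel measures. So \<open>f\<close> is replaced by a Borel function equal to it off a null set
  \<open>N\<close>; on the strip the exceptional set is contained in the null set
  \<open>UNIV \<times> N\<close>.\<close>

lemma Fubini_strip:
  fixes f :: "'a::euclidean_space \<Rightarrow> real" and v :: "real \<times> 'a \<Rightarrow> real"
  assumes W: "open W" and f: "integrable (lebesgue_on W) f"
    and v: "continuous_on UNIV v" "\<And>X. X \<in> {a<..<b} \<times> W \<Longrightarrow> \<bar>v X\<bar> \<le> M"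
  shows "integrable (lebesgue_on ({a<..<b} \<times> W)) (\<lambda>X. f (snd X) * v X)"
    and "(LINT X|lebesgue_on ({a<..<b} \<times> W). f (snd X) * v X) =
         (LINT y|lebesgue_on W. f y * integral {a..b} (\<lambda>x. v (x, y)))"
proof -
  let ?I = "{a<..<b}"
  let ?V = "\<lambda>y. integral {a..b} (\<lambda>x. v (x, y))"
  define f0 where "f0 y = indicator W y * f y" for y
  have W': "W \<inter> space lebesgue \<in> sets lebesgue" using W by simp
  have f0: "integrable lebesgue f0"
    using f by (simp add: integrable_restrict_space[OF W'] f0_def[abs_def])
  obtain f1 where f1: "f1 \<in> borel_measurable lborel" "AE y in lborel. f0 y = f1 y"
    using completion_ex_borel_measurable_real[of f0 lborel] f0 by blast
  \<comment> \<open>Cutting off outside \<open>W\<close> makes the integrand vanish off the strip,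
    where nothing bounds \<open>v\<close>.\<close>
  define f2 where "f2 y = indicator W y * f1 y" for y
  have [measurable]: "W \<in> sets borel" using W by simp
  have [measurable]: "f1 \<in> borel_measurable borel" using f1(1) by simp
  have f2[measurable]: "f2 \<in> borel_measurable borel"
    unfolding f2_def[abs_def] by measurable
  have AE2: "AE y in lborel. f0 y = f2 y"
    using f1(2) by eventually_elim (auto simp: f0_def f2_def indicator_def)
  have f2_int: "integrable lborel f2"
  proof -
    have "integrable lebesgue f2"
      by (rule integrable_cong_AE_imp[OF f0]) (use AE_completion[OF AE2] measurable_completion[of f2 lborel borel] f2 in auto)
    then show ?thesis by (simp add: integrable_completion)
  qed
  obtain N where N: "N \<in> null_sets lborel" "\<And>y. y \<notin> N \<Longrightarrow> f0 y = f2 y"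
    using AE2 by (auto simp: eventually_ae_filter)
  have [measurable]: "v \<in> borel_measurable borel"
    by (rule borel_measurable_continuous_onI[OF v(1)])
  have v_meas[measurable]: "v \<in> borel_measurable (lborel \<Otimes>\<^sub>M lborel)"
    by (simp add: lborel_prod)
  \<comment> \<open>The majorant \<open>G0\<close> has the product form for which the iterated
    integrals are explicit; integrability of \<open>G\<close> follows by comparison.\<close>
  define G0 :: "real \<times> 'a \<Rightarrow> real" where "G0 X = indicator ?I (fst X) * \<bar>f2 (snd X)\<bar>" for X
  define G :: "real \<times> 'a \<Rightarrow> real" where "G X = indicator ?I (fst X) * (f2 (snd X) * v X)" for X
  have G0_int: "integrable (lborel \<Otimes>\<^sub>M lborel) G0"
  proof (rule lborel_pair.Fubini_integrable)
    show "G0 \<in> borel_measurable (lborel \<Otimes>\<^sub>M lborel)"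
      unfolding G0_def[abs_def] by measurable
    have "(LINT y|lborel. norm (G0 (x, y))) = indicator ?I x * (LINT y|lborel. \<bar>f2 y\<bar>)" for x
      by (simp add: G0_def abs_mult)
    moreover have "integrable lborel (\<lambda>x::real. indicator ?I x * (LINT y|lborel. \<bar>f2 y\<bar>))"
      by (intro integrable_mult_left integrable_real_indicator) (use emeasure_bounded_finite[of "{a<..<b}"] in auto)
    ultimately show "integrable lborel (\<lambda>x. LINT y|lborel. norm (G0 (x, y)))" by simp
    show "AE x in lborel. integrable lborel (\<lambda>y. G0 (x, y))"
      using f2_int by (intro AE_I2) (auto simp: G0_def)
  qed
  have G_meas: "G \<in> borel_measurable (lborel \<Otimes>\<^sub>M lborel)"
    unfolding G_def[abs_def] by measurable
  have G_int: "integrable (lborel \<Otimes>\<^sub>M lborel) G"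
  proof (rule Bochner_Integration.integrable_bound[OF _ G_meas])
    show "integrable (lborel \<Otimes>\<^sub>M lborel) (\<lambda>X. \<bar>M\<bar> * G0 X)"
      using G0_int by simp
    show "AE X in lborel \<Otimes>\<^sub>M lborel. norm (G X) \<le> norm (\<bar>M\<bar> * G0 X)"
    proof (rule AE_I2)
      fix X :: "real \<times> 'a"
      show "norm (G X) \<le> norm (\<bar>M\<bar> * G0 X)"
      proof (cases "fst X \<in> ?I \<and> snd X \<in> W")
        case True
        then have "\<bar>v X\<bar> \<le> \<bar>M\<bar>" using v(2)[of X] by (cases X) auto
        from mult_left_mono[OF this, of "\<bar>f2 (snd X)\<bar>"] show ?thesis
          using True by (simp add: G_def G0_def abs_mult mult.commute)
      qed (auto simp: G_def G0_def f2_def indicator_def)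
    qed
  qed
  have G_int': "integrable lebesgue G" and G_lebesgue: "(LINT X|lebesgue. G X) = (LINT X|(lborel \<Otimes>\<^sub>M lborel). G X)"
    using G_int G_meas by (simp_all add: lborel_prod integrable_completion integral_completion)
  have "UNIV \<times> N \<in> null_sets (lborel :: (real \<times> 'a) measure)"
    using lborel.times_in_null_sets2[of UNIV "lborel::real measure" N] N(1) by (simp add: lborel_prod)
  then have "AE X in lborel. (X :: real \<times> 'a) \<notin> UNIV \<times> N"
    by (rule AE_not_in)
  then have "AE X in lborel. G X = indicator (?I \<times> W) X *\<^sub>R (f (snd X) * v X)"
  proof eventually_elim
    case (elim X)
    then have "f0 (snd X) = f2 (snd X)"
      using N(2) by (cases X) auto
    then show ?case
      by (cases X) (auto simp: G_def f0_def f2_def indicator_def split: if_splits)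
  qed
  then have AE: "AE X in lebesgue. G X = indicator (?I \<times> W) X *\<^sub>R (f (snd X) * v X)"
    by (rule AE_completion)
  have meas: "(\<lambda>X. indicator (?I \<times> W) X *\<^sub>R (f (snd X) * v X)) \<in> borel_measurable lebesgue"
    using borel_measurable_AE[OF borel_measurable_integrable[OF G_int'] AE] .
  have S: "(?I \<times> W) \<inter> space lebesgue \<in> sets lebesgue"
    using W by (simp add: open_Times)
  show "integrable (lebesgue_on (?I \<times> W)) (\<lambda>X. f (snd X) * v X)"
    unfolding integrable_restrict_space[OF S] by (rule integrable_cong_AE_imp[OF G_int' meas AE])
  have "(LINT X|lebesgue_on (?I \<times> W). f (snd X) * v X) = (LINT X|lebesgue. G X)"
    unfolding integral_restrict_space[OF S]
    by (rule integral_cong_AE[OF meas borel_measurable_integrable[OF G_int']]) (use AE in auto)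
  also have "\<dots> = (LINT y|lborel. LINT x|lborel. G (x, y))"
    using lborel_pair.integral_snd[of "\<lambda>x y. G (x, y)"] G_int by (simp add: G_lebesgue)
  also have "\<dots> = (LINT y|lborel. f2 y * ?V y)"
  proof (rule Bochner_Integration.integral_cong[OF refl])
    fix y
    have c: "continuous_on {a..b} (\<lambda>x. v (x, y))"
      by (intro continuous_on_compose2[OF v(1)] continuous_intros) auto
    have si: "set_integrable lborel {a<..<b} (\<lambda>x. v (x, y))"
      using borel_integrable_atLeastAtMost'[OF c] by (rule set_integrable_subset) auto
    have "(LINT x|lborel. G (x, y)) = f2 y * (LINT x:{a<..<b}|lborel. v (x, y))"
      by (simp add: G_def set_lebesgue_integral_def mult.left_commute)
    also have "\<dots> = f2 y * integral {a<..<b} (\<lambda>x. v (x, y))"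
      using set_borel_integral_eq_integral(2)[OF si] by simp
    also have "\<dots> = f2 y * ?V y"
      using integral_open_interval_real by metis
    finally show "(LINT x|lborel. G (x, y)) = f2 y * ?V y" .
  qed
  also have "\<dots> = (LINT y|lebesgue_on W. f y * ?V y)"
  proof -
    have 1: "AE y in lebesgue. f2 y * ?V y = indicator W y *\<^sub>R (f y * ?V y)"
      using AE_completion[OF AE2] by eventually_elim (simp add: f0_def mult.assoc)
    have "continuous_on (UNIV \<times> cbox a b) (\<lambda>(y, x). v (x, y))"
      unfolding split_def by (intro continuous_on_compose2[OF v(1)] continuous_intros) auto
    from integral_continuous_on_param[OF this]
    have [measurable]: "?V \<in> borel_measurable borel"
      by (simp add: borel_measurable_continuous_onI)
    have "(\<lambda>y. f2 y * ?V y) \<in> borel_measurable lborel"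
      by measurable
    moreover from this have 2: "(\<lambda>y. f2 y * ?V y) \<in> borel_measurable lebesgue"
      by (rule measurable_completion)
    ultimately show ?thesis
      using integral_cong_AE[OF 2 borel_measurable_AE[OF 2 1] 1]
      by (simp add: integral_restrict_space[OF W'] integral_completion)
  qed
  finally show "(LINT X|lebesgue_on (?I \<times> W). f (snd X) * v X) = (LINT y|lebesgue_on W. f y * ?V y)" .
qed

lemma Fubini_strip_snd:
  fixes f :: "'a::euclidean_space \<Rightarrow> real" and a b :: real
  assumes "open W" "a \<le> b" "integrable (lebesgue_on W) f"
  shows "integrable (lebesgue_on ({a<..<b} \<times> W)) (\<lambda>X. f (snd X))"
    and "(LINT X|lebesgue_on ({a<..<b} \<times> W). f (snd X)) = (b - a) * (LINT y|lebesgue_on W. f y)"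
  using Fubini_strip[OF assms(1,3), where v = "\<lambda>_. 1" and M = 1 and a = a and b = b] assms(2)
  by (auto simp: mult.commute)

lemma integrable_lebesgue_on_subset:
  fixes f :: "'a::euclidean_space \<Rightarrow> 'b::euclidean_space"
  assumes "integrable (lebesgue_on S) f" "T \<subseteq> S" "S \<in> sets lebesgue" "T \<in> sets lebesgue"
  shows "integrable (lebesgue_on T) f"
proof -
  have "set_integrable lebesgue S f"
    using assms by (simp add: set_integrable_def integrable_restrict_space)
  then have "set_integrable lebesgue T f"
    by (rule set_integrable_subset) (use assms in auto)
  then show ?thesis
    using assms by (simp add: set_integrable_def integrable_restrict_space)
qed

lemma integral_slice_test_function:
  fixes \<phi> :: "real \<times> 'a::euclidean_space \<Rightarrow> real"
  assumes "smooth \<phi>" "compact K" "K \<subseteq> W" "\<And>x y. y \<notin> K \<Longrightarrow> \<phi> (x, y) = 0"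
  shows "(\<lambda>y. integral {a..b} (\<lambda>x. \<phi> (x, y))) \<in> test_functions W"
  by (rule test_functionsI[OF smooth_integral_slice(1)[OF assms(1)] assms(2,3)]) (use assms(4) in simp)

lemma integral_fst_gradient:
  fixes \<phi> :: "real \<times> 'a::euclidean_space \<Rightarrow> real"
  assumes "smooth \<phi>" "a \<le> b"
  shows "integral {a..b} (\<lambda>x. fst (gradient \<phi> (x, y))) = \<phi> (b, y) - \<phi> (a, y)"
  by (intro integral_unique fundamental_theorem_of_calculus assms)
    (use has_real_derivative_fst_slice[OF assms(1)] in
      \<open>simp add: has_real_derivative_iff_has_vector_derivative has_vector_derivative_at_within\<close>)

lemma integrable_strip_Pair:
  fixes g :: "'a::euclidean_space \<Rightarrow> 'a" and a b :: real
  assumes "open W" "a \<le> b" "integrable (lebesgue_on W) g"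
  shows "integrable (lebesgue_on ({a<..<b} \<times> W)) (\<lambda>X. (0::real, g (snd X)))"
proof -
  have gc: "integrable (lebesgue_on W) (\<lambda>y. g y \<bullet> c)" for c
    using assms(3) by (rule integrable_inner_left)
  have "integrable (lebesgue_on ({a<..<b} \<times> W)) (\<lambda>X. \<Sum>c\<in>Basis. (g (snd X) \<bullet> c) *\<^sub>R (0::real, c))"
    by (intro Bochner_Integration.integrable_sum integrable_scaleR_left Fubini_strip_snd(1)[OF assms(1,2) gc])
  moreover have "(\<Sum>c\<in>Basis. (g y \<bullet> c) *\<^sub>R (0::real, c)) = (0, g y)" for y
    by (rule prod_eqI) (simp_all add: fst_sum snd_sum euclidean_representation)
  ultimately show ?thesis by simp
qed

text \<open>Integrating a test function \<phi> over X_1 gives a test function \<open>m\<close> on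
  \<open>W\<close>. The X_2-components of the identity reduce to the weak gradient of
  \<open>u\<close> tested with \<open>m\<close>; the X_1-component vanishes because \<phi> is 0 at
  both ends of the interval.\<close>

lemma has_weak_gradient_compose_snd:
  fixes u :: "'a::euclidean_space \<Rightarrow> real" and a b :: real
  assumes W: "open W" and ab: "a < b" and wg: "has_weak_gradient W u g"
    and u: "integrable (lebesgue_on W) u" and g: "integrable (lebesgue_on W) g"
  shows "has_weak_gradient ({a<..<b} \<times> W) (\<lambda>X. u (snd X)) (\<lambda>X. (0, g (snd X)))"
proof -
  let ?S = "{a<..<b} \<times> W"
  have S: "open ?S" using W by (simp add: open_Times)
  have uS: "integrable (lebesgue_on ?S) (\<lambda>X. u (snd X))"
    by (rule Fubini_strip_snd(1)[OF W _ u]) (use ab in simp)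
  have gS: "integrable (lebesgue_on ?S) (\<lambda>X. (0::real, g (snd X)))"
    by (rule integrable_strip_Pair[OF W _ g]) (use ab in simp)
  have loc: "k \<in> L1_loc ?S" if "integrable (lebesgue_on ?S) k" for k :: "real \<times> 'a \<Rightarrow> 'c::euclidean_space"
    unfolding L1_loc_def mem_Collect_eq
    by (intro allI impI integrable_lebesgue_on_subset[OF that])
      (use S in \<open>auto simp: lmeasurable_compact fmeasurableD\<close>)
  have uL: "(\<lambda>X. u (snd X)) \<in> L1_loc ?S" and gL: "(\<lambda>X. (0::real, g (snd X))) \<in> L1_loc ?S"
    using loc uS gS by blast+
  show ?thesis
    unfolding has_weak_gradient_def
  proof (intro conjI ballI uL gL)
    fix \<phi> assume "\<phi> \<in> test_functions ?S"
    then obtain K where K: "smooth \<phi>" "compact K" "K \<subseteq> ?S" "\<And>x. x \<notin> K \<Longrightarrow> \<phi> x = 0" "\<And>x. x \<notin> K \<Longrightarrow> gradient \<phi> x = 0"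
      by (metis test_functionsE)
    have 1: "integrable (lebesgue_on ?S) (\<lambda>X. u (snd X) *\<^sub>R gradient \<phi> X)"
      by (rule L1_loc_integrable_scaleR_right[OF S uL K(2,3)])
        (use K smooth_continuous_gradient in auto)
    have 2: "integrable (lebesgue_on ?S) (\<lambda>X. \<phi> X *\<^sub>R (0::real, g (snd X)))"
      by (rule L1_loc_integrable_scaleR_left[OF S gL K(2,3)])
        (use K smooth_continuous in auto)
    obtain M where M: "\<And>X. norm (gradient \<phi> X) \<le> M"
      using compact_support_bounded[OF smooth_continuous_gradient[OF K(1)] K(2,5)] by metis
    obtain M' where M': "\<And>X. norm (\<phi> X) \<le> M'"
      using compact_support_bounded[OF smooth_continuous[OF K(1)] K(2,4)] by metis
    define m where "m y = integral {a..b} (\<lambda>x. \<phi> (x, y))" for y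
    have csnd: "compact (snd ` K)"
      by (intro compact_continuous_image continuous_intros K)
    have m_test: "m \<in> test_functions W"
      unfolding m_def[abs_def]
      by (rule integral_slice_test_function[OF K(1) csnd]) (use K(3,4) in \<open>force\<close>)+
    obtain L where L: "smooth m" "compact L" "L \<subseteq> W" "\<And>x. x \<notin> L \<Longrightarrow> m x = 0" "\<And>x. x \<notin> L \<Longrightarrow> gradient m x = 0"
      using m_test by (metis test_functionsE)
    have uW: "u \<in> L1_loc W" and gW: "g \<in> L1_loc W" using wg by (auto simp: has_weak_gradient_def)
    have 3: "integrable (lebesgue_on W) (\<lambda>y. u y *\<^sub>R gradient m y)"
      by (rule L1_loc_integrable_scaleR_right[OF W uW L(2,3)])
        (use L smooth_continuous_gradient in auto)
    have 4: "integrable (lebesgue_on W) (\<lambda>y. m y *\<^sub>R g y)"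
      by (rule L1_loc_integrable_scaleR_left[OF W gW L(2,3)])
        (use L smooth_continuous in auto)
    show "(LINT X|lebesgue_on ?S. u (snd X) *\<^sub>R gradient \<phi> X) = - (LINT X|lebesgue_on ?S. \<phi> X *\<^sub>R (0, g (snd X)))"
    proof (rule euclidean_eqI)
      fix B :: "real \<times> 'a" assume B: "B \<in> Basis"
      have "(LINT X|lebesgue_on ?S. u (snd X) * (gradient \<phi> X \<bullet> B)) = - (LINT X|lebesgue_on ?S. \<phi> X * ((0, g (snd X)) \<bullet> B))"
      proof (cases "fst B = 0")
        case False
        then have B1: "B = (1, 0)" using B by (auto simp: Basis_prod_def)
        have "(LINT X|lebesgue_on ?S. u (snd X) * fst (gradient \<phi> X)) =
            (LINT y|lebesgue_on W. u y * integral {a..b} (\<lambda>x. fst (gradient \<phi> (x, y))))"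
        proof (rule Fubini_strip(2)[OF W u])
          show "continuous_on UNIV (\<lambda>X. fst (gradient \<phi> X))"
            by (intro continuous_intros smooth_continuous_gradient K)
          show "\<bar>fst (gradient \<phi> X)\<bar> \<le> M" for X
            using M[of X] norm_fst_le[of "fst (gradient \<phi> X)" "snd (gradient \<phi> X)"] by simp
        qed
        also have "\<dots> = (LINT y|lebesgue_on W. u y * (\<phi> (b, y) - \<phi> (a, y)))"
          using ab by (simp add: integral_fst_gradient[OF K(1)])
        also have "\<dots> = 0"
        proof -
          have "(b, y) \<notin> K" "(a, y) \<notin> K" for y using K(3) by auto
          then show ?thesis by (simp add: K(4))
        qed
        finally show ?thesis by (simp add: B1 inner_prod_def)
      next
        case True
        then obtain c where B2: "B = (0, c)" "c \<in> Basis" using B by (auto simp: Basis_prod_def)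
        have "(LINT X|lebesgue_on ?S. u (snd X) * (snd (gradient \<phi> X) \<bullet> c)) =
            (LINT y|lebesgue_on W. u y * integral {a..b} (\<lambda>x. snd (gradient \<phi> (x, y)) \<bullet> c))"
        proof (rule Fubini_strip(2)[OF W u])
          show "continuous_on UNIV (\<lambda>X. snd (gradient \<phi> X) \<bullet> c)"
            by (intro continuous_intros smooth_continuous_gradient K)
          show "\<bar>snd (gradient \<phi> X) \<bullet> c\<bar> \<le> M" for X
            using M[of X] norm_snd_le[of "snd (gradient \<phi> X)" "fst (gradient \<phi> X)"]
              Basis_le_norm[OF B2(2), of "snd (gradient \<phi> X)"] by simp
        qed
        also have "\<dots> = (LINT y|lebesgue_on W. (u y *\<^sub>R gradient m y) \<bullet> c)"
        proof (rule Bochner_Integration.integral_cong[OF refl])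
          fix y
          have i: "(\<lambda>x. snd (gradient \<phi> (x, y))) integrable_on cbox a b"
            by (intro integrable_continuous continuous_intros
                continuous_on_compose2[OF smooth_continuous_gradient[OF K(1), of UNIV]]) auto
          show "u y * integral {a..b} (\<lambda>x. snd (gradient \<phi> (x, y)) \<bullet> c) = (u y *\<^sub>R gradient m y) \<bullet> c"
            using integral_linear[OF i bounded_linear_inner_left[of c]]
            by (simp add: m_def[abs_def] smooth_integral_slice(2)[OF K(1)] o_def)
        qed
        also have "\<dots> = (LINT y|lebesgue_on W. u y *\<^sub>R gradient m y) \<bullet> c"
          using 3 by (rule integral_inner_left)
        also have "\<dots> = - ((LINT y|lebesgue_on W. m y *\<^sub>R g y) \<bullet> c)"
          using wg m_test by (simp add: has_weak_gradient_def)
        also have "\<dots> = - (LINT y|lebesgue_on W. (g y \<bullet> c) * m y)"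
          using integral_inner_left[OF 4, of c] by (simp add: mult.commute)
        also have "(LINT y|lebesgue_on W. (g y \<bullet> c) * m y) = (LINT X|lebesgue_on ?S. (g (snd X) \<bullet> c) * \<phi> X)"
          unfolding m_def
          by (rule Fubini_strip(2)[OF W integrable_inner_left[OF g] smooth_continuous[OF K(1)], symmetric])
            (use M' in auto)
        finally show ?thesis by (simp add: B2 inner_prod_def mult.commute)
      qed
      then show "(LINT X|lebesgue_on ?S. u (snd X) *\<^sub>R gradient \<phi> X) \<bullet> B = (- (LINT X|lebesgue_on ?S. \<phi> X *\<^sub>R (0, g (snd X)))) \<bullet> B"
        using integral_inner_left[OF 1, of B] integral_inner_left[OF 2, of B]
        by (simp only: inner_minus_left inner_scaleR_left)
    qed
  qed
qed

section \<open>Uniformly convex integrands of power growth\<close>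

text \<open>Young's inequality with a weight \<open>s\<close> but without sharp constants: after the
  rescaling to \<open>A\<close> and \<open>B\<close> the left side is
  \<open>A * B powr (q - 1)\<close>, at most the \<open>q\<close>-th power of the larger of the
  two.\<close>

lemma mult_powr_le_Young:
  fixes a b s q :: real
  assumes "a \<ge> 0" "b \<ge> 0" "s > 0" "q > 1"
  shows "a * b powr (q - 1) \<le> s powr (- q) * a powr q + s powr (q / (q - 1)) * b powr q"
proof -
  define A where "A = a / s"
  define B where "B = s powr (1 / (q - 1)) * b"
  have AB: "A \<ge> 0" "B \<ge> 0" using assms by (auto simp: A_def B_def)
  have "a * b powr (q - 1) = A * B powr (q - 1)"
    using assms by (simp add: A_def B_def powr_mult powr_powr)
  also have "\<dots> \<le> max A B * max A B powr (q - 1)"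
    using AB assms by (intro mult_mono powr_mono2) auto
  also have "\<dots> = max A B powr q"
    using AB powr_add[of "max A B" 1 "q - 1"] by (simp add: max_def)
  also have "\<dots> \<le> A powr q + B powr q"
    by (auto simp: max_def)
  also have "A powr q = s powr (- q) * a powr q"
    using assms unfolding A_def by (subst powr_divide) (auto simp: powr_minus divide_inverse)
  also have "B powr q = s powr (q / (q - 1)) * b powr q"
    using assms by (simp add: B_def powr_mult powr_powr)
  finally show ?thesis .
qed

lemma add_powr_le:
  fixes a b q :: real
  assumes "a \<ge> 0" "b \<ge> 0" "q \<ge> 0"
  shows "(a + b) powr q \<le> 2 powr q * (a powr q + b powr q)"
proof -
  have "(a + b) powr q \<le> (2 * max a b) powr q"
    using assms by (intro powr_mono2) auto
  also have "\<dots> = 2 powr q * max a b powr q"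
    using assms by (simp add: powr_mult)
  also have "\<dots> \<le> 2 powr q * (a powr q + b powr q)"
    by (intro mult_left_mono) (auto simp: max_def)
  finally show ?thesis .
qed

lemma norm_add_powr_le:
  fixes x y :: "'a::real_normed_vector"
  assumes "q \<ge> 0"
  shows "norm (x + y) powr q \<le> 2 powr q * (norm x powr q + norm y powr q)"
  using powr_mono2[OF assms norm_ge_zero norm_triangle_ineq[of x y]]
    add_powr_le[of "norm x" "norm y" q] assms by simp

lemma norm_diff_powr_le:
  fixes x y :: "'a::real_normed_vector"
  shows "q \<ge> 0 \<Longrightarrow> norm (x - y) powr q \<le> 2 powr q * (norm x powr q + norm y powr q)"
  using norm_add_powr_le[of q x "- y"] by simp

text \<open>As \<open>p = q / (q - 1)\<close>, this is \<open>mult_powr_le_Young\<close> for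
  \<open>b\<close> and \<open>a powr (1 / (q - 1))\<close>, with the weight chosen so that its power
  in front of \<open>a powr p\<close> is \<tau>.\<close>

lemma Young_with_small_constant:
  fixes p q \<tau> :: real
  assumes "q > 1" "1 / q + 1 / p = 1" "\<tau> > 0"
  obtains D where "D \<ge> 0" "\<And>a b. a \<ge> 0 \<Longrightarrow> b \<ge> 0 \<Longrightarrow> a * b \<le> \<tau> * a powr p + D * b powr q"
proof -
  have "p \<noteq> 0" using assms by auto
  then have p: "p = q / (q - 1)" using assms by (auto simp: field_simps)
  then have p1: "p > 0" using assms by simp
  define s where "s = \<tau> powr (1 / p)"
  have s: "s > 0" "s powr (q / (q - 1)) = \<tau>"
    using assms p1 by (auto simp: s_def powr_powr p)
  have "a * b \<le> \<tau> * a powr p + s powr (- q) * b powr q" if "a \<ge> 0" "b \<ge> 0" for a b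
    using mult_powr_le_Young[of b "a powr (1 / (q - 1))" s q] that assms(1) s
    by (simp add: powr_powr p mult.commute)
  then show ?thesis using that[of "s powr (- q)"] by simp
qed

lemma powr_sub_split:
  fixes r q :: real assumes "r > 0" shows "r powr (q - 1) = r powr q / r"
  using assms by (simp add: powr_diff)

lemma dyadic_scale:
  fixes s :: real assumes "s \<ge> 1"
  obtains n :: nat where "2 ^ n \<le> s" "s < 2 ^ (n + 1)"
proof -
  obtain N :: nat where N: "s < 2 ^ N" using real_arch_pow[of 2 s] by auto
  define k where "k = (LEAST N. s < (2::real) ^ N)"
  have k: "s < 2 ^ k" unfolding k_def by (rule LeastI[where P = "\<lambda>N. s < (2::real) ^ N", OF N])
  then obtain n where n: "k = Suc n" using assms by (cases k) auto
  then have "\<not> s < 2 ^ n" using not_less_Least[of n "\<lambda>N. s < (2::real) ^ N"] by (simp add: k_def)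
  then show ?thesis using that[of n] k n by auto
qed

text \<open>The domain is an arbitrary Euclidean space because both the integrand on the cylinder
  and its restriction to vectors with first component 0 are instances.\<close>

locale uniformly_convex_growth =
  fixes F :: "'e::euclidean_space \<Rightarrow> real" and q \<alpha> lam Lam :: real
  assumes q: "q \<ge> 2" and \<alpha>: "\<alpha> > 0" and lam: "lam > 0" and Lam: "Lam > 0"
    and midpoint_convex: "2 * F ((1 / 2) *\<^sub>R (\<xi> + \<eta>)) + \<alpha> * norm (\<xi> - \<eta>) powr q \<le> F \<xi> + F \<eta>"
    and lower: "lam * norm \<xi> powr q \<le> F \<xi>"
    and upper: "F \<xi> \<le> Lam * norm \<xi> powr q"
begin

lemma nonneg: "0 \<le> F \<xi>"
  using lower[of \<xi>] lam by (smt (verit) mult_nonneg_nonneg powr_ge_zero)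

lemma F_zero [simp]: "F 0 = 0"
  using nonneg[of 0] upper[of 0] by simp

lemma halving: "F (x + v) - F x \<le> (F (x + 2 *\<^sub>R v) - F x) / 2"
proof -
  have "(1 / 2) *\<^sub>R (x + (x + 2 *\<^sub>R v)) = x + v"
    by (simp add: scaleR_add_right scaleR_2 flip: scaleR_add_left)
  moreover have "0 \<le> \<alpha> * (2 * norm v) powr q" using \<alpha> by simp
  ultimately show ?thesis
    using midpoint_convex[of x "x + 2 *\<^sub>R v"] by simp
qed

lemma difference_le_dyadic: "F (x + h) - F x \<le> (F (x + 2 ^ n *\<^sub>R h) - F x) / 2 ^ n"
proof (induction n)
  case (Suc n)
  have "F (x + 2 ^ n *\<^sub>R h) - F x \<le> (F (x + 2 ^ Suc n *\<^sub>R h) - F x) / 2"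
    using halving[of x "2 ^ n *\<^sub>R h"] by simp
  then have "(F (x + 2 ^ n *\<^sub>R h) - F x) / 2 ^ n \<le> ((F (x + 2 ^ Suc n *\<^sub>R h) - F x) / 2) / 2 ^ n"
    by (rule divide_right_mono) simp
  with Suc show ?case by simp
qed simp

text \<open>The factor \<open>2 powr q\<close> comes from evaluating the growth bound at norm at
  most twice \<open>norm x + norm h\<close>, the other factor 2 from replacing the real scale by a
  power of two.\<close>

definition Lip :: real where "Lip = 2 * Lam * 2 powr q"

lemma Lip_pos: "Lip > 0"
  using Lam by (simp add: Lip_def)

text \<open>Doubling the increment until it is comparable with \<open>norm x + norm h\<close> turns the growth bound into
  a Lipschitz bound.\<close>

lemma difference_le: "F (x + h) - F x \<le> Lip * norm h * (norm x + norm h) powr (q - 1)"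
proof (cases "h = 0")
  case False
  define r where "r = norm x + norm h"
  have h: "norm h > 0" and r: "r > 0" "norm h \<le> r" using False by (auto simp: r_def add_nonneg_pos)
  obtain n where n: "2 ^ n \<le> r / norm h" "r / norm h < 2 ^ (n + 1)"
    using dyadic_scale[of "r / norm h"] h r by auto
  have "norm (x + 2 ^ n *\<^sub>R h) \<le> norm x + 2 ^ n * norm h"
    using norm_triangle_ineq[of x "2 ^ n *\<^sub>R h"] by simp
  also have "\<dots> \<le> 2 * r"
  proof -
    have "2 ^ n * norm h \<le> r" using n(1) h by (simp add: field_simps)
    then have "norm x + 2 ^ n * norm h \<le> norm x + r" by simp
    also have "\<dots> \<le> 2 * r" by (simp add: r_def)
    finally show ?thesis .
  qed
  finally have "F (x + 2 ^ n *\<^sub>R h) \<le> Lam * (2 * r) powr q"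
    using upper[of "x + 2 ^ n *\<^sub>R h"] Lam q
    by (meson mult_left_mono norm_ge_zero order.trans powr_mono2 less_imp_le zero_le_numeral)
  then have "F (x + h) - F x \<le> (Lam * (2 * r) powr q) / 2 ^ n"
    using difference_le_dyadic[of x h n] nonneg[of x]
    by (smt (verit) divide_right_mono zero_le_power)
  also have "\<dots> \<le> (Lam * (2 * r) powr q) * (2 * norm h / r)"
  proof -
    have "1 / 2 ^ n \<le> 2 * norm h / r"
      using n(2) h r by (simp add: field_simps)
    from mult_left_mono[OF this, of "Lam * (2 * r) powr q"] Lam show ?thesis by simp
  qed
  also have "\<dots> = Lip * norm h * r powr (q - 1)"
    using r by (simp add: Lip_def powr_mult powr_sub_split)
  finally show ?thesis by (simp add: r_def)
qed simp

text \<open>\<open>x\<close> is the midpoint of \<open>x + h\<close> and \<open>x - h\<close>, so a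
  decrease of \<open>F\<close> along \<open>h\<close> is at most its increase along
  \<open>- h\<close>.\<close>

lemma abs_difference_le: "\<bar>F (x + h) - F x\<bar> \<le> Lip * norm h * (norm x + norm h) powr (q - 1)"
proof -
  have "0 \<le> \<alpha> * (2 * norm h) powr q" using \<alpha> by simp
  then have "2 * F x \<le> F (x + h) + F (x - h)"
    using midpoint_convex[of "x + h" "x - h"]
    by (simp add: scaleR_2[symmetric])
  then have "F x - F (x + h) \<le> F (x + - h) - F x" by simp
  also have "\<dots> \<le> Lip * norm h * (norm x + norm h) powr (q - 1)"
    using difference_le[of x "- h"] by simp
  finally show ?thesis using difference_le[of x h] by linarith
qed

lemma continuous: "continuous_on A F"
proof (rule continuous_at_imp_continuous_on, rule ballI)
  fix x :: 'e
  let ?C = "Lip * (norm x + 1) powr (q - 1)"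
  have "((\<lambda>y. F y - F x) \<longlongrightarrow> 0) (at x)"
  proof (rule Lim_null_comparison[where g = "\<lambda>y. ?C * norm (y - x)"])
    have "\<forall>\<^sub>F y in at x. norm (y - x) < 1"
      unfolding eventually_at by (intro exI[of _ 1]) (auto simp: dist_norm)
    then show "\<forall>\<^sub>F y in at x. norm (F y - F x) \<le> ?C * norm (y - x)"
    proof eventually_elim
      case (elim y)
      have "\<bar>F (x + (y - x)) - F x\<bar> \<le> Lip * norm (y - x) * (norm x + norm (y - x)) powr (q - 1)"
        by (rule abs_difference_le)
      also have "\<dots> \<le> Lip * norm (y - x) * (norm x + 1) powr (q - 1)"
        using elim q Lip_pos by (intro mult_left_mono powr_mono2) auto
      finally show ?case by (simp add: ac_simps)
    qed
    have "((\<lambda>y. ?C * norm (y - x)) \<longlongrightarrow> ?C * norm (x - x)) (at x)"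
      by (intro tendsto_intros)
    then show "((\<lambda>y. ?C * norm (y - x)) \<longlongrightarrow> 0) (at x)" by simp
  qed
  then show "isCont F x"
    by (simp add: isCont_def LIM_zero_iff)
qed

text \<open>Let \<open>g\<close> be \<open>F\<close> along the segment minus its chord, and
  \<open>m\<close> a maximum point of \<open>g\<close>. If \<open>m \<le> 1 / 2\<close>, then
  \<open>m\<close> is the midpoint of 0 and \<open>2 * m\<close>, so that
  \<open>2 * g m \<le> g 0 + g (2 * m) \<le> g m\<close> and \<open>g m \<le> 0\<close>; the other
  half is symmetric with the endpoint 1.\<close>

lemma convex: "convex_on UNIV F"
proof (rule convex_onI)
  fix t :: real and x y :: 'e
  assume t: "0 < t" "t < 1"
  let ?p = "\<lambda>t. (1 - t) *\<^sub>R x + t *\<^sub>R y"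
  define g where "g t = F (?p t) - ((1 - t) * F x + t * F y)" for t
  have mid: "2 * g ((a + b) / 2) \<le> g a + g b" for a b
  proof -
    have e: "(1 / 2) *\<^sub>R (?p a + ?p b) = ?p ((a + b) / 2)"
    proof -
      have "(1 / 2) *\<^sub>R (?p a + ?p b) = (1/2) *\<^sub>R (((1 - a) + (1 - b)) *\<^sub>R x + (a + b) *\<^sub>R y)"
        by (simp only: scaleR_add_left) (simp add: algebra_simps)
      also have "\<dots> = ((1 / 2) * ((1 - a) + (1 - b))) *\<^sub>R x + ((1 / 2) * (a + b)) *\<^sub>R y"
        by (simp only: scaleR_add_right scaleR_scaleR)
      also have "(1 / 2) * ((1 - a) + (1 - b)) = 1 - (a + b) / 2"
        by (simp add: field_simps)
      also have "(1 / 2) * (a + b) = (a + b) / 2" by simp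
      finally show ?thesis .
    qed
    have "0 \<le> \<alpha> * norm (?p a - ?p b) powr q" using \<alpha> by simp
    then have "2 * F (?p ((a + b) / 2)) \<le> F (?p a) + F (?p b)"
      using midpoint_convex[of "?p a" "?p b", unfolded e] by linarith
    then show ?thesis unfolding g_def by (simp add: field_simps)
  qed
  have "continuous_on {0..1} g"
    unfolding g_def by (intro continuous_intros continuous_on_compose2[OF continuous[of UNIV]]) auto
  then obtain m where m: "m \<in> {0..1}" "\<And>s. s \<in> {0..1} \<Longrightarrow> g s \<le> g m"
    using continuous_attains_sup[of "{0..1::real}" g] by auto
  have g01: "g 0 = 0" "g 1 = 0" by (auto simp: g_def)
  have "g m \<le> 0"
  proof (cases "m \<le> 1 / 2")
    case True
    then show ?thesis using mid[of 0 "2 * m"] m(2)[of "2 * m"] m(1) g01 by simp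
  next
    case False
    then show ?thesis using mid[of 1 "2 * m - 1"] m(2)[of "2 * m - 1"] m(1) g01 by simp
  qed
  then have "g t \<le> 0" using m(2)[of t] t by simp
  then show "F ((1 - t) *\<^sub>R x + t *\<^sub>R y) \<le> (1 - t) * F x + t * F y" by (simp add: g_def)
qed simp

text \<open>Moving \<open>x\<close> and \<open>y\<close> toward each other by the fraction
  \<open>t / 2\<close> puts weight \<open>t\<close> on their common midpoint. Convexity splits off
  this weight, and the midpoint inequality pays the gain for it.\<close>

lemma swap_convex:
  assumes "0 \<le> t" "t \<le> 1"
  shows "F (x + (t / 2) *\<^sub>R (y - x)) + F (y + (t / 2) *\<^sub>R (x - y)) \<le> F x + F y - t * (\<alpha> * norm (x - y) powr q)"
proof -
  let ?m = "(1 / 2) *\<^sub>R (x + y)"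
  have 1: "x + (t / 2) *\<^sub>R (y - x) = (1 - t) *\<^sub>R x + t *\<^sub>R ?m"
  proof -
    have "(1 - t) *\<^sub>R x + t *\<^sub>R ?m = ((1 - t) + t / 2) *\<^sub>R x + (t / 2) *\<^sub>R y"
      by (simp only: scaleR_add_left scaleR_add_right) simp
    also have "(1 - t) + t / 2 = 1 - t / 2" by simp
    also have "(1 - t / 2) *\<^sub>R x + (t / 2) *\<^sub>R y = x + (t / 2) *\<^sub>R (y - x)"
      by (simp add: algebra_simps)
    finally show ?thesis ..
  qed
  have 2: "y + (t / 2) *\<^sub>R (x - y) = (1 - t) *\<^sub>R y + t *\<^sub>R ?m"
  proof -
    have "(1 - t) *\<^sub>R y + t *\<^sub>R ?m = ((1 - t) + t / 2) *\<^sub>R y + (t / 2) *\<^sub>R x"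
      by (simp only: scaleR_add_left scaleR_add_right) simp
    also have "(1 - t) + t / 2 = 1 - t / 2" by simp
    also have "(1 - t / 2) *\<^sub>R y + (t / 2) *\<^sub>R x = y + (t / 2) *\<^sub>R (x - y)"
      by (simp add: algebra_simps)
    finally show ?thesis ..
  qed
  have "F ((1 - t) *\<^sub>R z + t *\<^sub>R ?m) \<le> F z - t * F z + t * F ?m" for z
    using convex_onD[OF convex, of t z ?m] assms by (simp add: left_diff_distrib)
  note this[of x] this[of y]
  moreover have "2 * (t * F ?m) + t * (\<alpha> * norm (x - y) powr q) \<le> t * F x + t * F y"
    using mult_left_mono[OF midpoint_convex[of x y], of t] assms by (simp add: algebra_simps)
  ultimately show ?thesis
    unfolding 1 2 by linarith
qed

text \<open>This gives continuity of the energy in the gradient: the first term is as small as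
  desired for a fixed function, and the second is controlled by the distance in
  \<open>Lp\<close>.\<close>

lemma difference_le_small:
  assumes "\<tau> > 0"
  obtains D where "D \<ge> 0" "\<And>x y. \<bar>F x - F y\<bar> \<le> \<tau> * norm x powr q + D * norm (x - y) powr q"
proof -
  define s where "s = (\<tau> / (Lip * 2 powr q)) powr ((q - 1) / q)"
  have s: "s > 0" "s powr (q / (q - 1)) = \<tau> / (Lip * 2 powr q)"
    using assms q Lip_pos by (auto simp: s_def powr_powr)
  \<comment> \<open>The summand \<tau> is the share of \<open>norm (x - y)\<close> in the power of
    the sum \<open>norm x + norm (x - y)\<close>, whose coefficient has been tuned to
    \<tau>.\<close>
  define D where "D = Lip * s powr (- q) + \<tau>"
  have D: "D \<ge> 0" using assms Lip_pos by (simp add: D_def)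
  have "\<bar>F x - F y\<bar> \<le> \<tau> * norm x powr q + D * norm (x - y) powr q" for x y
  proof -
    let ?h = "norm (x - y)"
    have "\<bar>F x - F y\<bar> \<le> Lip * (?h * (norm x + ?h) powr (q - 1))"
      using abs_difference_le[of x "y - x"] by (simp add: norm_minus_commute abs_minus_commute mult.assoc)
    also have "\<dots> \<le> Lip * (s powr (- q) * ?h powr q + s powr (q / (q - 1)) * (norm x + ?h) powr q)"
      using mult_powr_le_Young[of ?h "norm x + ?h" s q] s q Lip_pos by (intro mult_left_mono) auto
    also have "\<dots> \<le> Lip * (s powr (- q) * ?h powr q + s powr (q / (q - 1)) * (2 powr q * (norm x powr q + ?h powr q)))"
      using Lip_pos q by (intro mult_left_mono add_left_mono add_powr_le) auto
    also have "\<dots> = \<tau> * norm x powr q + D * ?h powr q"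
      using Lip_pos by (simp add: s(2) D_def algebra_simps)
    finally show ?thesis .
  qed
  with D that show ?thesis by blast
qed

text \<open>A tagged division turns the mean into a finite convex combination with the relative
  lengths as weights. Continuity of \<open>F\<close> at the true mean and convergence of both
  Riemann sums give the inequality up to \<open>e\<close>.\<close>

lemma Jensen:
  fixes g :: "real \<Rightarrow> 'e"
  assumes g: "continuous_on {a..b} g" and ab: "a < b"
  shows "(b - a) * F ((1 / (b - a)) *\<^sub>R integral {a..b} g) \<le> integral {a..b} (\<lambda>x. F (g x))"
proof (rule field_le_epsilon)
  fix e :: real assume e: "e > 0"
  define L where "L = b - a"
  let ?I = "integral {a..b} g" and ?J = "integral {a..b} (\<lambda>x. F (g x))"
  have L: "L > 0" using ab by (simp add: L_def)
  have gi: "(g has_integral ?I) (cbox a b)"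
    using integrable_continuous_real[OF g] by (simp add: integrable_integral)
  have "continuous_on {a..b} (\<lambda>x. F (g x))"
    by (intro continuous_on_compose2[OF continuous[of UNIV] g]) auto
  from integrable_continuous_real[OF this]
  have Fi: "((\<lambda>x. F (g x)) has_integral ?J) (cbox a b)"
    by (simp add: integrable_integral)
  have "isCont F ((1 / L) *\<^sub>R ?I)"
    using continuous[of UNIV] by (simp add: continuous_on_eq_continuous_at)
  \<comment> \<open>After multiplication by the length \<open>L\<close>, this tolerance becomes
    \<open>e / 2\<close>; the Riemann sum of \<open>F (g x)\<close> contributes the other
    half.\<close>
  then obtain d where d: "d > 0" "\<And>z. dist z ((1 / L) *\<^sub>R ?I) < d \<Longrightarrow> dist (F z) (F ((1 / L) *\<^sub>R ?I)) < e / (2 * L)"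
    using e L unfolding continuous_at_eps_delta by (metis divide_pos_pos mult_pos_pos zero_less_numeral)
  obtain \<gamma> where \<gamma>: "gauge \<gamma>"
    "\<And>\<D>. \<D> tagged_division_of (cbox a b) \<Longrightarrow> \<gamma> fine \<D> \<Longrightarrow> norm ((\<Sum>(x,k)\<in>\<D>. measure lborel k *\<^sub>R g x) - ?I) < d * L"
    using has_integralD[OF gi mult_pos_pos[OF d(1) L]] by blast
  obtain \<gamma>' where \<gamma>': "gauge \<gamma>'"
    "\<And>\<D>. \<D> tagged_division_of (cbox a b) \<Longrightarrow> \<gamma>' fine \<D> \<Longrightarrow> norm ((\<Sum>(x,k)\<in>\<D>. measure lborel k *\<^sub>R F (g x)) - ?J) < e / 2"
    using has_integralD[OF Fi half_gt_zero[OF e]] by blast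
  obtain \<D> where \<D>: "\<D> tagged_division_of (cbox a b)" "(\<lambda>x. \<gamma> x \<inter> \<gamma>' x) fine \<D>"
    using fine_division_exists[OF gauge_Int[OF \<gamma>(1) \<gamma>'(1)]] by metis
  have fine: "\<gamma> fine \<D>" "\<gamma>' fine \<D>" using \<D>(2) by (auto simp: fine_Int)
  define c where "c p = measure lborel (snd p :: real set) / L" for p :: "real \<times> real set"
  have sum_c: "(\<Sum>p\<in>\<D>. measure lborel (snd p)) = L"
    using additive_content_tagged_division[OF \<D>(1)] ab by (simp add: L_def case_prod_unfold)
  have fin: "finite \<D>" using \<D>(1) by auto
  have c1: "(\<Sum>p\<in>\<D>. c p) = 1"
    using sum_c L by (simp add: c_def flip: sum_divide_distrib)
  have conv: "F (\<Sum>p\<in>\<D>. c p *\<^sub>R g (fst p)) \<le> (\<Sum>p\<in>\<D>. c p * F (g (fst p)))"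
    by (rule convex_on_sum[OF fin _ convex]) (use c1 L in \<open>auto simp: c_def\<close>)
  have eq1: "(\<Sum>p\<in>\<D>. c p *\<^sub>R g (fst p)) = (1 / L) *\<^sub>R (\<Sum>(x,k)\<in>\<D>. measure lborel k *\<^sub>R g x)"
    by (simp add: c_def case_prod_unfold scaleR_sum_right)
  have eq2: "(\<Sum>p\<in>\<D>. c p * F (g (fst p))) = (1 / L) * (\<Sum>(x,k)\<in>\<D>. measure lborel k *\<^sub>R F (g x))"
    by (simp add: c_def case_prod_unfold sum_distrib_left)
  have "dist (\<Sum>p\<in>\<D>. c p *\<^sub>R g (fst p)) ((1 / L) *\<^sub>R ?I) < d"
    unfolding eq1 dist_norm scaleR_diff_right[symmetric] norm_scaleR
    using \<gamma>(2)[OF \<D>(1) fine(1)] L by (simp add: pos_divide_less_eq)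
  from d(2)[OF this] have "F ((1 / L) *\<^sub>R ?I) \<le> (\<Sum>p\<in>\<D>. c p * F (g (fst p))) + e / (2 * L)"
    using conv by (simp add: dist_real_def)
  from mult_left_mono[OF this, of L]
  have "L * F ((1 / L) *\<^sub>R ?I) \<le> (\<Sum>(x,k)\<in>\<D>. measure lborel k *\<^sub>R F (g x)) + e / 2"
    unfolding eq2 using L by (simp add: distrib_left)
  then show "(b - a) * F ((1 / (b - a)) *\<^sub>R ?I) \<le> ?J + e"
    unfolding L_def[symmetric]
    using \<gamma>'(2)[OF \<D>(1) fine(2)] unfolding real_norm_def abs_less_iff by linarith
qed

end

section \<open>A weighted Poincare inequality and approximation by test functions\<close>

text \<open>The derivative of the \<open>q\<close>-th power of the absolute value. Positive and
  negative parts replace the sign function so that continuity at 0 is immediate.\<close>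

definition dpowr :: "real \<Rightarrow> real \<Rightarrow> real" where
  "dpowr q t = q * (max t 0 powr (q - 1) - max (- t) 0 powr (q - 1))"

lemma continuous_dpowr:
  assumes "q > 1" shows "continuous_on A (dpowr q)"
  unfolding dpowr_def[abs_def]
  by (intro continuous_intros continuous_on_powr' continuous_on_max) (use assms in auto)

lemma abs_dpowr: "q > 1 \<Longrightarrow> \<bar>dpowr q t\<bar> = q * \<bar>t\<bar> powr (q - 1)"
  by (cases "t \<ge> 0") (auto simp: dpowr_def max_def abs_mult)

lemma abs_powr_has_derivative:
  assumes q: "q > 1"
  shows "((\<lambda>t. \<bar>t\<bar> powr q) has_real_derivative dpowr q t) (at t)"
proof -
  consider "t < 0" | "t = 0" | "t > 0" by linarith
  then show ?thesis
  proof cases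
    case 1
    have "((\<lambda>t. (- t) powr q) has_real_derivative dpowr q t) (at t)"
      using 1 q by (auto intro!: derivative_eq_intros simp: dpowr_def powr_diff field_simps)
    then show ?thesis
      by (rule has_field_derivative_transform_within_open[of _ _ _ "{..<0}"]) (use 1 in auto)
  next
    case 3
    have "((\<lambda>t. t powr q) has_real_derivative dpowr q t) (at t)"
      using 3 q by (auto intro!: derivative_eq_intros simp: dpowr_def powr_diff field_simps)
    then show ?thesis
      by (rule has_field_derivative_transform_within_open[of _ _ _ "{0<..}"]) (use 3 in auto)
  next
    case 2
    \<comment> \<open>The difference quotient at 0 is \<open>dpowr q h / q\<close>, so continuity of
      \<open>dpowr\<close> settles this case.\<close>
    have "(dpowr q \<longlongrightarrow> dpowr q 0) (at 0)"
      using continuous_dpowr[OF q, of UNIV] by (simp add: continuous_on_eq_continuous_at isCont_def)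
    then have "((\<lambda>h. dpowr q h / q) \<longlongrightarrow> dpowr q 0 / q) (at 0)"
      using q by (intro tendsto_intros) auto
    then have "((\<lambda>h. dpowr q h / q) \<longlongrightarrow> 0) (at 0)"
      using q by (simp add: dpowr_def)
    moreover have "\<forall>\<^sub>F h in at 0. dpowr q h / q = \<bar>h\<bar> powr q / h"
      unfolding eventually_at_filter
      by (intro always_eventually allI impI)
        (use q in \<open>auto simp: dpowr_def max_def powr_diff field_simps split: if_splits\<close>)
    ultimately have "((\<lambda>h. \<bar>h\<bar> powr q / h) \<longlongrightarrow> 0) (at 0)"
      by (rule Lim_transform_eventually)
    then show ?thesis
      using 2 q by (simp add: DERIV_def dpowr_def)
  qed
qed

text \<open>The inner power is the Young weight \<open>s\<close> with
  \<open>s powr (q / (q - 1)) = 1 / (2 * R * q)\<close>, which makes the term to be absorbed exactly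
  one half of the left side.\<close>

definition Poincare_const :: "real \<Rightarrow> real \<Rightarrow> real" where
  "Poincare_const q R = 2 * R * q * ((1 / (2 * R * q)) powr ((q - 1) / q)) powr (- q)"

lemma Poincare_const_pos: "q > 1 \<Longrightarrow> R > 0 \<Longrightarrow> Poincare_const q R > 0"
  by (simp add: Poincare_const_def)

text \<open>Integrate the derivative of \<open>r (x \<bullet> b) \<bar>z\<bar>\<^sup>q\<close> in the direction \<open>b\<close>.\<close>

lemma weighted_Poincare:
  fixes r z :: "'v::euclidean_space \<Rightarrow> real" and q R :: real
  assumes q: "q > 1" and R: "R > 0" and r: "smooth r" and z: "smooth z" and r0: "\<And>x. r x \<ge> 0"
    and rb: "\<And>x. gradient r x \<bullet> b = 0" and b: "norm b = 1" and K: "compact K" "\<And>x. x \<in> K \<Longrightarrow> \<bar>x \<bullet> b\<bar> \<le> R"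
      "\<And>x. x \<notin> K \<Longrightarrow> r x = 0 \<or> (z x = 0 \<and> gradient z x = 0)"
  shows "(LINT x|lborel. r x * \<bar>z x\<bar> powr q) \<le> Poincare_const q R * (LINT x|lborel. r x * norm (gradient z x) powr q)"
proof -
  define s where "s = (1 / (2 * R * q)) powr ((q - 1) / q)"
  have s: "s > 0" "s powr (q / (q - 1)) = 1 / (2 * R * q)"
    using q R by (auto simp: s_def powr_powr)
  define C where "C = 2 * R * q * s powr (- q)"
  have C_eq: "C = Poincare_const q R" by (simp add: C_def Poincare_const_def s_def)
  have bb: "b \<bullet> b = 1" using b by (simp add: norm_eq_1)
  have rc: "continuous_on UNIV r" and zc: "continuous_on UNIV z" and gc: "continuous_on UNIV (gradient z)"
    and grc: "continuous_on UNIV (gradient r)"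
    using r z by (auto intro: smooth_continuous smooth_continuous_gradient)
  have dc: "continuous_on UNIV (\<lambda>x. dpowr q (z x))"
    by (rule continuous_on_compose2[OF continuous_dpowr[OF q, of UNIV] zc]) simp
  have pc: "continuous_on UNIV (\<lambda>x. \<bar>z x\<bar> powr q)"
    using q by (intro continuous_on_powr' continuous_intros zc) auto
  have ngc: "continuous_on UNIV (\<lambda>x. norm (gradient z x) powr q)"
    using q by (intro continuous_on_powr' continuous_intros gc) auto
  define g where "g x = (\<bar>z x\<bar> powr q * (x \<bullet> b)) *\<^sub>R gradient r x + (r x * \<bar>z x\<bar> powr q) *\<^sub>R b
      + (r x * (x \<bullet> b) * dpowr q (z x)) *\<^sub>R gradient z x" for x
  have hd: "((\<lambda>x. r x * (x \<bullet> b) * \<bar>z x\<bar> powr q) has_derivative (\<lambda>v. g x \<bullet> v)) (at x)" for x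
  proof -
    have 1: "((\<lambda>x. \<bar>z x\<bar> powr q) has_derivative (\<lambda>v. (gradient z x \<bullet> v) * dpowr q (z x))) (at x)"
      using has_derivative_compose[OF smooth_has_gradient[OF z]
          abs_powr_has_derivative[OF q, unfolded has_field_derivative_def]]
      by (simp add: mult.commute)
    have 2: "((\<lambda>x. x \<bullet> b) has_derivative (\<lambda>v. v \<bullet> b)) (at x)"
      by (auto intro!: derivative_eq_intros)
    show ?thesis
      by (rule has_derivative_eq_rhs[OF has_derivative_mult[OF has_derivative_mult[OF smooth_has_gradient[OF r] 2] 1]])
         (simp add: g_def inner_add_left inner_commute[of b] algebra_simps)
  qed
  have "(LINT x|lborel. g x \<bullet> b) = 0"
  proof (rule integral_directional_derivative_eq_0[OF hd _ K(1)])
    show "continuous_on UNIV g"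
      unfolding g_def by (intro continuous_intros rc pc dc gc grc)
    show "r x * (x \<bullet> b) * \<bar>z x\<bar> powr q = 0" if "x \<notin> K" for x
      using K(3)[OF that] by auto
  qed
  \<comment> \<open>The term with the gradient of the weight drops out, being orthogonal to
    \<open>b\<close>; so the constant does not depend on the weight.\<close>
  moreover have gb: "g x \<bullet> b = r x * \<bar>z x\<bar> powr q + r x * (x \<bullet> b) * dpowr q (z x) * (gradient z x \<bullet> b)" for x
    using rb[of x] bb by (simp add: g_def inner_add_left)
  ultimately have zero: "(LINT x|lborel. r x * \<bar>z x\<bar> powr q + r x * (x \<bullet> b) * dpowr q (z x) * (gradient z x \<bullet> b)) = 0"
    by simp
  have i1: "integrable lborel (\<lambda>x. r x * \<bar>z x\<bar> powr q)"
    by (rule integrable_lborel_compact_support[OF _ K(1)])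
       (use K(3) q in \<open>auto intro!: continuous_intros rc pc\<close>)
  have i2: "integrable lborel (\<lambda>x. r x * norm (gradient z x) powr q)"
    by (rule integrable_lborel_compact_support[OF _ K(1)])
       (use K(3) q in \<open>auto intro!: continuous_intros rc ngc\<close>)
  have i3: "integrable lborel (\<lambda>x. r x * \<bar>z x\<bar> powr q + r x * (x \<bullet> b) * dpowr q (z x) * (gradient z x \<bullet> b))"
  proof (rule integrable_lborel_compact_support[OF _ K(1)])
    show "continuous_on UNIV (\<lambda>x. r x * \<bar>z x\<bar> powr q + r x * (x \<bullet> b) * dpowr q (z x) * (gradient z x \<bullet> b))"
      by (intro continuous_intros rc pc dc gc)
    show "r x * \<bar>z x\<bar> powr q + r x * (x \<bullet> b) * dpowr q (z x) * (gradient z x \<bullet> b) = 0" if "x \<notin> K" for x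
      using K(3)[OF that] q by auto
  qed
  \<comment> \<open>Young's inequality gives up half of \<open>r x * \<bar>z x\<bar> powr q\<close>;
    the factor 2 in front of the expression with integral zero restores it.\<close>
  have pt: "r x * \<bar>z x\<bar> powr q \<le>
      2 * (r x * \<bar>z x\<bar> powr q + r x * (x \<bullet> b) * dpowr q (z x) * (gradient z x \<bullet> b))
      + C * (r x * norm (gradient z x) powr q)" for x
  proof (cases "x \<in> K")
    case True
    have gn: "\<bar>gradient z x \<bullet> b\<bar> \<le> norm (gradient z x)"
      using Cauchy_Schwarz_ineq2[of "gradient z x" b] b by simp
    have "\<bar>(x \<bullet> b) * dpowr q (z x) * (gradient z x \<bullet> b)\<bar>
        \<le> R * (q * \<bar>z x\<bar> powr (q - 1)) * norm (gradient z x)"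
      unfolding abs_mult abs_dpowr[OF q]
      using K(2)[OF True] gn R q by (intro mult_mono) auto
    also have "\<dots> = R * q * (norm (gradient z x) * \<bar>z x\<bar> powr (q - 1))" by simp
    also have "\<dots> \<le> R * q * (s powr (- q) * norm (gradient z x) powr q + s powr (q / (q - 1)) * \<bar>z x\<bar> powr q)"
      using R q s by (intro mult_left_mono mult_powr_le_Young) auto
    also have "\<dots> = (C / 2) * norm (gradient z x) powr q + \<bar>z x\<bar> powr q / 2"
      using R q by (simp add: s(2) C_def distrib_left)
    finally have "- ((x \<bullet> b) * dpowr q (z x) * (gradient z x \<bullet> b)) \<le> (C / 2) * norm (gradient z x) powr q + \<bar>z x\<bar> powr q / 2"
      by linarith
    from mult_left_mono[OF this r0[of x]]
    show ?thesis by (simp add: algebra_simps)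
  next
    case False
    then show ?thesis using K(3)[OF False] by auto
  qed
  have "(LINT x|lborel. r x * \<bar>z x\<bar> powr q) \<le>
     (LINT x|lborel. 2 * (r x * \<bar>z x\<bar> powr q + r x * (x \<bullet> b) * dpowr q (z x) * (gradient z x \<bullet> b))
      + C * (r x * norm (gradient z x) powr q))"
  proof (rule integral_mono[OF i1 _ pt])
    show "integrable lborel (\<lambda>x. 2 * (r x * \<bar>z x\<bar> powr q + r x * (x \<bullet> b) * dpowr q (z x) * (gradient z x \<bullet> b))
      + C * (r x * norm (gradient z x) powr q))"
      by (intro Bochner_Integration.integrable_add integrable_mult_right i3 i2)
  qed
  also have "\<dots> = 2 * (LINT x|lborel. r x * \<bar>z x\<bar> powr q + r x * (x \<bullet> b) * dpowr q (z x) * (gradient z x \<bullet> b))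
      + C * (LINT x|lborel. r x * norm (gradient z x) powr q)"
    by (subst Bochner_Integration.integral_add[OF integrable_mult_right[OF i3] integrable_mult_right[OF i2]])
       (simp only: integral_mult_right_zero)
  finally show ?thesis unfolding zero by (simp add: C_eq)
qed

section \<open>Lp functions, energies and their approximation\<close>

lemma Lp_D:
  assumes "u \<in> Lp \<Omega> q"
  shows "u \<in> borel_measurable (lebesgue_on \<Omega>)" "integrable (lebesgue_on \<Omega>) (\<lambda>x. norm (u x) powr q)"
  using assms by (auto simp: Lp_def)

lemma Lp_diff_integrable:
  assumes "u \<in> Lp \<Omega> q" "v \<in> Lp \<Omega> q" "q \<ge> 0"
  shows "integrable (lebesgue_on \<Omega>) (\<lambda>x. norm (u x - v x) powr q)"
proof (rule Bochner_Integration.integrable_bound)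
  note [measurable] = Lp_D(1)[OF assms(1)] Lp_D(1)[OF assms(2)]
  show "(\<lambda>x. norm (u x - v x) powr q) \<in> borel_measurable (lebesgue_on \<Omega>)"
    by measurable
  show "integrable (lebesgue_on \<Omega>) (\<lambda>x. 2 powr q * (norm (u x) powr q + norm (v x) powr q))"
    using Lp_D(2)[OF assms(1)] Lp_D(2)[OF assms(2)]
    by (intro integrable_mult_right Bochner_Integration.integrable_add)
  show "AE x in lebesgue_on \<Omega>. norm (norm (u x - v x) powr q)
      \<le> norm (2 powr q * (norm (u x) powr q + norm (v x) powr q))"
  proof (rule AE_I2)
    fix x
    show "norm (norm (u x - v x) powr q) \<le> norm (2 powr q * (norm (u x) powr q + norm (v x) powr q))"
      using norm_diff_powr_le[OF assms(3), of "u x" "v x"] by simp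
  qed
qed

lemma continuous_compact_support_Lp:
  fixes k :: "'a::euclidean_space \<Rightarrow> 'b::euclidean_space"
  assumes "open \<Omega>" "continuous_on UNIV k" "compact K" "K \<subseteq> \<Omega>" "\<And>x. x \<notin> K \<Longrightarrow> k x = 0" "q > 0"
  shows "k \<in> Lp \<Omega> q"
proof -
  have "k \<in> borel_measurable (lebesgue_on \<Omega>)"
    using integrable_lebesgue_on_compact_support(1)[OF assms(1-5)] by (rule borel_measurable_integrable)
  moreover have "integrable (lebesgue_on \<Omega>) (\<lambda>x. norm (k x) powr q)"
  proof (rule integrable_lebesgue_on_compact_support(1)[OF assms(1) _ assms(3,4)])
    show "continuous_on UNIV (\<lambda>x. norm (k x) powr q)"
      by (intro continuous_on_powr' continuous_on_norm continuous_on_const assms(2)) (use assms(6) in auto)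
  qed (use assms(5) in simp)
  ultimately show ?thesis by (simp add: Lp_def)
qed

lemma test_functions_Lp:
  assumes "open \<Omega>" "\<phi> \<in> test_functions \<Omega>" "q > 0"
  shows "\<phi> \<in> Lp \<Omega> q" "gradient \<phi> \<in> Lp \<Omega> q"
proof -
  obtain K where K: "smooth \<phi>" "compact K" "K \<subseteq> \<Omega>" "\<And>x. x \<notin> K \<Longrightarrow> \<phi> x = 0" "\<And>x. x \<notin> K \<Longrightarrow> gradient \<phi> x = 0"
    using assms(2) by (metis test_functionsE)
  show "\<phi> \<in> Lp \<Omega> q"
    by (rule continuous_compact_support_Lp[OF assms(1) smooth_continuous[OF K(1)] K(2,3,4) assms(3)])
  show "gradient \<phi> \<in> Lp \<Omega> q"
    by (rule continuous_compact_support_Lp[OF assms(1) smooth_continuous_gradient[OF K(1)] K(2,3,5) assms(3)])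
qed

text \<open>It makes test functions admissible competitors for the minimizers. The norm of the zero
  function needs uniqueness of weak gradients, since \<open>weak_gradient\<close> is only some
  representative.\<close>

lemma test_functions_subset_W1_0:
  assumes "open \<Omega>" "\<phi> \<in> test_functions \<Omega>" "q > 0"
  shows "\<phi> \<in> W1_0 \<Omega> q"
proof -
  have wg: "has_weak_gradient \<Omega> \<phi> (gradient \<phi>)"
    using assms smooth_has_weak_gradient test_functions_smooth by blast
  have "W1_norm \<Omega> q (\<lambda>x. \<phi> x - \<phi> x) = 0"
  proof -
    have "has_weak_gradient \<Omega> (\<lambda>x. 0) (\<lambda>x. 0)"
      using has_weak_gradient_diff[OF assms(1) wg wg] by simp
    from weak_gradient_AE[OF assms(1) this]
    have "AE x in lebesgue_on \<Omega>. norm (weak_gradient \<Omega> (\<lambda>x. 0) x) powr q = 0"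
      by eventually_elim (use assms(3) in simp)
    then show ?thesis
      by (simp add: W1_norm_def integral_eq_zero_AE)
  qed
  then have "\<forall>\<epsilon>>0. \<exists>\<phi>'\<in>test_functions \<Omega>. W1_norm \<Omega> q (\<lambda>x. \<phi> x - \<phi>' x) < \<epsilon>"
    using assms(2) by metis
  then show ?thesis
    using wg test_functions_Lp[OF assms] by (auto simp: W1_0_def W1_def)
qed

lemma (in uniformly_convex_growth) F_measurable [measurable]: "F \<in> borel_measurable borel"
  by (rule borel_measurable_continuous_onI[OF continuous])

lemma (in uniformly_convex_growth) F_integrable:
  assumes "g \<in> Lp \<Omega> q"
  shows "integrable (lebesgue_on \<Omega>) (\<lambda>x. F (g x))"
proof (rule Bochner_Integration.integrable_bound)
  note [measurable] = Lp_D(1)[OF assms]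
  show "(\<lambda>x. F (g x)) \<in> borel_measurable (lebesgue_on \<Omega>)"
    by measurable
  show "integrable (lebesgue_on \<Omega>) (\<lambda>x. Lam * norm (g x) powr q)"
    using Lp_D(2)[OF assms] by (rule integrable_mult_right)
  show "AE x in lebesgue_on \<Omega>. norm (F (g x)) \<le> norm (Lam * norm (g x) powr q)"
    using upper nonneg Lam by (intro AE_I2) (simp add: abs_mult)
qed

lemma Lp_product_integrable:
  fixes f u :: "'a::euclidean_space \<Rightarrow> real"
  assumes "f \<in> Lp \<Omega> p" "u \<in> Lp \<Omega> q" "q > 1" "1 / q + 1 / p = 1"
  shows "integrable (lebesgue_on \<Omega>) (\<lambda>x. f x * u x)"
proof -
  obtain D where D: "D \<ge> 0" "\<And>a b. a \<ge> 0 \<Longrightarrow> b \<ge> 0 \<Longrightarrow> a * b \<le> 1 * a powr p + D * b powr q"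
    using Young_with_small_constant[OF assms(3,4), of 1] by auto
  note [measurable] = Lp_D(1)[OF assms(1)] Lp_D(1)[OF assms(2)]
  show ?thesis
  proof (rule Bochner_Integration.integrable_bound)
    show "integrable (lebesgue_on \<Omega>) (\<lambda>x. 1 * norm (f x) powr p + D * norm (u x) powr q)"
      by (intro Bochner_Integration.integrable_add integrable_mult_right Lp_D assms)
    show "AE x in lebesgue_on \<Omega>. norm (f x * u x) \<le> norm (1 * norm (f x) powr p + D * norm (u x) powr q)"
    proof (rule AE_I2)
      fix x
      show "norm (f x * u x) \<le> norm (1 * norm (f x) powr p + D * norm (u x) powr q)"
        using D(2)[of "norm (f x)" "norm (u x)"] D(1) by (simp add: abs_mult)
    qed
  qed measurable
qed

lemma (in uniformly_convex_growth) energy_eq: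
  assumes "open \<Omega>" "has_weak_gradient \<Omega> u g" "g \<in> Lp \<Omega> q"
    and "f \<in> borel_measurable (lebesgue_on \<Omega>)" "u \<in> borel_measurable (lebesgue_on \<Omega>)"
  shows "energy \<Omega> F f u = (LINT x|lebesgue_on \<Omega>. F (g x) - f x * u x)"
proof -
  note AE = weak_gradient_AE[OF assms(1,2)]
  note [measurable] = Lp_D(1)[OF assms(3)] assms(4,5)
  have [measurable]: "weak_gradient \<Omega> u \<in> borel_measurable (lebesgue_on \<Omega>)"
    by (rule borel_measurable_lebesgue_on_AE[OF _ Lp_D(1)[OF assms(3)]])
      (use assms(1) AE in \<open>auto elim: eventually_mono\<close>)
  show ?thesis
    unfolding energy_def
    by (rule integral_cong_AE) (measurable, use AE in \<open>auto elim: eventually_mono\<close>)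
qed

lemma (in uniformly_convex_growth) energy_test_function:
  assumes "open \<Omega>" "\<phi> \<in> test_functions \<Omega>" "f \<in> borel_measurable (lebesgue_on \<Omega>)"
  shows "energy \<Omega> F f \<phi> = (LINT x|lebesgue_on \<Omega>. F (gradient \<phi> x) - f x * \<phi> x)"
  using assms q test_functions_Lp[OF assms(1,2), of q]
  by (intro energy_eq smooth_has_weak_gradient test_functions_smooth) (auto dest: Lp_D)

text \<open>Both parts of the energy are continuous along the approximation: the part with
  \<open>F\<close> by \<open>difference_le_small\<close>, the part with \<open>f\<close> by Young's
  inequality. The distance \<eta> can be fixed only after the large constants \<open>D1\<close> and
  \<open>D2\<close> belonging to \<tau> are known.\<close>

lemma (in uniformly_convex_growth) energy_approximation:
  fixes \<epsilon> p :: real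
  assumes \<Omega>: "open \<Omega>" and u: "u \<in> W1_0 \<Omega> q" and g: "g \<in> Lp \<Omega> q" "has_weak_gradient \<Omega> u g"
    and f: "f \<in> Lp \<Omega> p" "1 / q + 1 / p = 1" and \<epsilon>: "\<epsilon> > 0"
  obtains \<phi> where "\<phi> \<in> test_functions \<Omega>"
    "(LINT x|lebesgue_on \<Omega>. norm (g x - gradient \<phi> x) powr q) < \<epsilon>"
    "energy \<Omega> F f \<phi> < energy \<Omega> F f u + \<epsilon>"
proof -
  have q1: "q > 1" and q0: "q > 0" using q by auto
  have uLp: "u \<in> Lp \<Omega> q" using u by (simp add: W1_0_def W1_def)
  define N1 where "N1 = (LINT x|lebesgue_on \<Omega>. norm (g x) powr q)"
  define N2 where "N2 = (LINT x|lebesgue_on \<Omega>. norm (f x) powr p)"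
  have N: "N1 \<ge> 0" "N2 \<ge> 0" by (auto simp: N1_def N2_def)
  \<comment> \<open>\<tau> multiplies the fixed quantities \<open>N1\<close> and \<open>N2\<close>,
    which do not shrink as \<phi> approaches \<open>u\<close>; the 1 avoids division by zero and
    leaves room for a strict inequality.\<close>
  define \<tau> where "\<tau> = \<epsilon> / (2 * (N1 + N2 + 1))"
  have \<tau>: "\<tau> > 0" "\<tau> * (N1 + N2) \<le> \<epsilon> / 2" using \<epsilon> N by (auto simp: \<tau>_def field_simps)
  obtain D1 where D1: "D1 \<ge> 0" "\<And>x y. \<bar>F x - F y\<bar> \<le> \<tau> * norm x powr q + D1 * norm (x - y) powr q"
    using difference_le_small[OF \<tau>(1)] by metis
  obtain D2 where D2: "D2 \<ge> 0" "\<And>a b. a \<ge> 0 \<Longrightarrow> b \<ge> 0 \<Longrightarrow> a * b \<le> \<tau> * a powr p + D2 * b powr q"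
    using Young_with_small_constant[OF q1 f(2) \<tau>(1)] by metis
  define \<eta> where "\<eta> = \<epsilon> / (2 * (D1 + D2 + 1))"
  have "\<eta> \<le> \<epsilon> / 2"
    unfolding \<eta>_def using \<epsilon> D1(1) D2(1) by (intro divide_left_mono) auto
  then have "\<eta> < \<epsilon>" using \<epsilon> by linarith
  moreover have "\<eta> > 0" "\<eta> * (D1 + D2) \<le> \<epsilon> / 2"
    using \<epsilon> D1(1) D2(1) by (auto simp: \<eta>_def field_simps)
  ultimately have \<eta>: "\<eta> > 0" "\<eta> * (D1 + D2) \<le> \<epsilon> / 2" "\<eta> < \<epsilon>"
    by auto
  \<comment> \<open>\<open>W1_norm\<close> carries an outer power \<open>1 / q\<close>, so a bound
    \<eta> for the integrals corresponds to this bound for the norm.\<close>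
  have "\<eta> powr (1 / q) > 0" using \<eta>(1) by simp
  then obtain \<phi> where \<phi>: "\<phi> \<in> test_functions \<Omega>" "W1_norm \<Omega> q (\<lambda>x. u x - \<phi> x) < \<eta> powr (1 / q)"
    using u unfolding W1_0_def by blast
  note \<phi>Lp = test_functions_Lp[OF \<Omega> \<phi>(1) q0]
  define A where "A = (LINT x|lebesgue_on \<Omega>. norm (u x - \<phi> x) powr q)"
  define B where "B = (LINT x|lebesgue_on \<Omega>. norm (g x - gradient \<phi> x) powr q)"
  have AB: "A \<ge> 0" "B \<ge> 0" by (auto simp: A_def B_def)
  have wg: "has_weak_gradient \<Omega> (\<lambda>x. u x - \<phi> x) (\<lambda>x. g x - gradient \<phi> x)"
    by (rule has_weak_gradient_diff[OF \<Omega> g(2) smooth_has_weak_gradient[OF \<Omega> test_functions_smooth[OF \<phi>(1)]]])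
  note AE = weak_gradient_AE[OF \<Omega> wg]
  note [measurable] = Lp_D(1)[OF g(1)] Lp_D(1)[OF \<phi>Lp(1)] Lp_D(1)[OF \<phi>Lp(2)] Lp_D(1)[OF uLp] Lp_D(1)[OF f(1)]
  have [measurable]: "weak_gradient \<Omega> (\<lambda>x. u x - \<phi> x) \<in> borel_measurable (lebesgue_on \<Omega>)"
    by (rule borel_measurable_lebesgue_on_AE[of _ "\<lambda>x. g x - gradient \<phi> x"])
      (use \<Omega> AE in \<open>auto elim: eventually_mono\<close>)
  have "(LINT x|lebesgue_on \<Omega>. norm (weak_gradient \<Omega> (\<lambda>x. u x - \<phi> x) x) powr q) = B"
    unfolding B_def by (rule integral_cong_AE) (measurable, use AE in \<open>auto elim: eventually_mono\<close>)
  then have "(A + B) powr (1 / q) < \<eta> powr (1 / q)"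
    using \<phi>(2) by (simp add: W1_norm_def A_def)
  then have AB\<eta>: "A + B < \<eta>"
    using powr_mono2[of "1 / q" \<eta> "A + B"] q0 \<eta>(1) by (meson divide_nonneg_pos less_imp_le not_less zero_le_one)
  have iA: "integrable (lebesgue_on \<Omega>) (\<lambda>x. norm (u x - \<phi> x) powr q)"
    by (rule Lp_diff_integrable[OF uLp \<phi>Lp(1)]) (use q in simp)
  have iB: "integrable (lebesgue_on \<Omega>) (\<lambda>x. norm (g x - gradient \<phi> x) powr q)"
    by (rule Lp_diff_integrable[OF g(1) \<phi>Lp(2)]) (use q in simp)
  note iF = F_integrable[OF g(1)] F_integrable[OF \<phi>Lp(2)]
  note ifu = Lp_product_integrable[OF f(1) uLp q1 f(2)] Lp_product_integrable[OF f(1) \<phi>Lp(1) q1 f(2)]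
  note iN = Lp_D(2)[OF g(1)] Lp_D(2)[OF f(1)]
  have "energy \<Omega> F f \<phi> - energy \<Omega> F f u =
      (LINT x|lebesgue_on \<Omega>. (F (gradient \<phi> x) - f x * \<phi> x) - (F (g x) - f x * u x))"
    using energy_eq[OF \<Omega> g(2,1) Lp_D(1)[OF f(1)] Lp_D(1)[OF uLp]]
      energy_test_function[OF \<Omega> \<phi>(1) Lp_D(1)[OF f(1)]] iF ifu by simp
  also have "\<dots> \<le> (LINT x|lebesgue_on \<Omega>. \<tau> * norm (g x) powr q + D1 * norm (g x - gradient \<phi> x) powr q
        + (\<tau> * norm (f x) powr p + D2 * norm (u x - \<phi> x) powr q))"
  proof (rule integral_mono)
    show "integrable (lebesgue_on \<Omega>) (\<lambda>x. (F (gradient \<phi> x) - f x * \<phi> x) - (F (g x) - f x * u x))"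
      using iF ifu by simp
    show "integrable (lebesgue_on \<Omega>) (\<lambda>x. \<tau> * norm (g x) powr q + D1 * norm (g x - gradient \<phi> x) powr q
        + (\<tau> * norm (f x) powr p + D2 * norm (u x - \<phi> x) powr q))"
      by (intro Bochner_Integration.integrable_add integrable_mult_right iN iA iB)
    fix x
    have "f x * (u x - \<phi> x) \<le> norm (f x) * norm (u x - \<phi> x)"
      by (metis abs_ge_self abs_mult real_norm_def)
    also have "\<dots> \<le> \<tau> * norm (f x) powr p + D2 * norm (u x - \<phi> x) powr q"
      by (rule D2(2)) auto
    finally show "(F (gradient \<phi> x) - f x * \<phi> x) - (F (g x) - f x * u x) \<le>
      \<tau> * norm (g x) powr q + D1 * norm (g x - gradient \<phi> x) powr q + (\<tau> * norm (f x) powr p + D2 * norm (u x - \<phi> x) powr q)"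
      using D1(2)[of "g x" "gradient \<phi> x"] by (simp add: right_diff_distrib abs_le_iff)
  qed
  also have "\<dots> = \<tau> * N1 + D1 * B + (\<tau> * N2 + D2 * A)"
    using iN iA iB by (simp add: N1_def N2_def A_def B_def)
  also have "\<dots> < \<epsilon>"
  proof -
    have "D1 * B \<le> D1 * \<eta>" "D2 * A \<le> D2 * \<eta>"
      using AB AB\<eta> D1(1) D2(1) by (auto intro!: mult_left_mono)
    moreover have "D1 * B + D2 * A \<le> \<epsilon> / 2" "\<tau> * N1 + \<tau> * N2 \<le> \<epsilon> / 2"
      using calculation \<eta>(2) \<tau>(2) by (auto simp: algebra_simps)
    \<comment> \<open>Strictness comes from the 1 in the denominator of \<tau>.\<close>
    moreover have "\<tau> * N1 + \<tau> * N2 < \<epsilon> / 2"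
    proof -
      have "N1 + N2 + 1 > 0" using N by linarith
      then have "\<tau> * (N1 + N2 + 1) = \<epsilon> / 2"
        unfolding \<tau>_def divide_divide_eq_left[symmetric] by (intro nonzero_eq_divide_eq[THEN iffD1]) auto
      then show ?thesis using \<tau>(1) by (simp add: distrib_left)
    qed
    ultimately show ?thesis by linarith
  qed
  finally have "energy \<Omega> F f \<phi> < energy \<Omega> F f u + \<epsilon>" by simp
  moreover have "B < \<epsilon>" using AB AB\<eta> \<eta>(3) by linarith
  ultimately show ?thesis using that[OF \<phi>(1)] by (simp add: B_def)
qed

section \<open>Comparison on the strip\<close>

lemma gradient_eq_0_open:
  assumes "open U" "x \<in> U" "\<And>y. y \<in> U \<Longrightarrow> v y = 0"
  shows "gradient v x = 0"
proof (rule gradient_eqI)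
  have "((\<lambda>_. 0) has_derivative (\<lambda>h. 0 \<bullet> h)) (at x)" by simp
  then show "(v has_derivative (\<lambda>h. 0 \<bullet> h)) (at x)"
    by (rule has_derivative_transform_within_open[OF _ assms(1,2)]) (use assms(3) in auto)
qed

text \<open>The pointwise core of the comparison. The vector \<open>k\<close> is the contribution of
  the derivative of the cutoff and enters the two competitors with opposite signs.
  \<open>swap_convex\<close> handles the pair without \<open>k\<close>, and each perturbation costs
  a Lipschitz term split by Young's inequality.\<close>

lemma (in uniformly_convex_growth) interpolated_pair_estimate:
  assumes t: "0 \<le> t" "t \<le> 1" and s: "s > 0" and N: "norm k powr q \<le> N"
  shows "t * (\<alpha> * norm (x - y) powr q) \<le>
    F x + F y - F (x + (t / 2) *\<^sub>R (y - x) + k) - F (y + (t / 2) *\<^sub>R (x - y) - k)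
    + 2 * Lip * (s powr (- q) * N + s powr (q / (q - 1)) * (4 powr q * (norm x powr q + norm y powr q + N)))"
proof -
  let ?x = "x + (t / 2) *\<^sub>R (y - x)" and ?y = "y + (t / 2) *\<^sub>R (x - y)"
  let ?D = "norm x + norm y"
  let ?E = "s powr (- q) * N + s powr (q / (q - 1)) * (4 powr q * (norm x powr q + norm y powr q + N))"
  have segment: "norm (a + (t / 2) *\<^sub>R (b - a)) \<le> norm a + norm b" for a b :: 'e
  proof -
    have "a + (t / 2) *\<^sub>R (b - a) = (1 - t / 2) *\<^sub>R a + (t / 2) *\<^sub>R b"
      by (simp add: algebra_simps)
    also have "norm \<dots> \<le> (1 - t / 2) * norm a + (t / 2) * norm b"
      using t norm_triangle_ineq[of "(1 - t / 2) *\<^sub>R a" "(t / 2) *\<^sub>R b"] by simp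
    also have "\<dots> \<le> norm a + norm b"
      using t by (intro add_mono mult_left_le_one_le) auto
    finally show ?thesis .
  qed
  have bound: "\<bar>F (z + h) - F z\<bar> \<le> Lip * ?E" if z: "norm z \<le> ?D" and h: "norm h = norm k" for z h
  proof -
    have "\<bar>F (z + h) - F z\<bar> \<le> Lip * (norm k * (norm z + norm k) powr (q - 1))"
      using abs_difference_le[of z h] h by (simp add: mult.assoc)
    also have "\<dots> \<le> Lip * (norm k * (?D + norm k) powr (q - 1))"
      using z q Lip_pos by (intro mult_left_mono powr_mono2) auto
    also have "\<dots> \<le> Lip * (s powr (- q) * norm k powr q + s powr (q / (q - 1)) * (?D + norm k) powr q)"
      using q s Lip_pos by (intro mult_left_mono mult_powr_le_Young) auto
    also have "\<dots> \<le> Lip * ?E"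
    proof -
      have "(?D + norm k) powr q \<le> 2 powr q * (?D powr q + norm k powr q)"
        using q by (intro add_powr_le) auto
      \<comment> \<open>The last term receives an extra factor \<open>2 powr q \<ge> 1\<close> so
        that all three share the constant \<open>4 powr q\<close>.\<close>
      also have "\<dots> \<le> 2 powr q * (2 powr q * (norm x powr q + norm y powr q) + 2 powr q * norm k powr q)"
        using q ge_one_powr_ge_zero[of 2 q] by (intro mult_left_mono add_mono add_powr_le mult_le_cancel_right1[THEN iffD2]) auto
      also have "\<dots> = 4 powr q * (norm x powr q + norm y powr q + norm k powr q)"
        using powr_mult[of 2 2 q] by (simp add: algebra_simps)
      also have "\<dots> \<le> 4 powr q * (norm x powr q + norm y powr q + N)"
        using N by simp
      finally show ?thesis
        using N s Lip_pos by (intro mult_left_mono add_mono) auto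
    qed
    finally show ?thesis .
  qed
  have "\<bar>F (?x + k) - F ?x\<bar> \<le> Lip * ?E"
    by (rule bound) (use segment[of x y] in auto)
  moreover have "\<bar>F (?y + - k) - F ?y\<bar> \<le> Lip * ?E"
    by (rule bound) (use segment[of y x] in auto)
  moreover have "F ?x + F ?y \<le> F x + F y - t * (\<alpha> * norm (x - y) powr q)"
    by (rule swap_convex[OF t])
  ultimately show ?thesis
    by (simp add: abs_le_iff)
qed

section \<open>Energies on strips and on the cross-section\<close>

locale cylinder_problem = uniformly_convex_growth F q \<alpha> lam Lam
  for F :: "real \<times> 'a::euclidean_space \<Rightarrow> real" and q \<alpha> lam Lam :: real +
  fixes W :: "'a set" and f :: "'a \<Rightarrow> real" and p R :: real
  assumes W: "open W" and R: "R > 0" "\<And>y. y \<in> W \<Longrightarrow> norm y \<le> R"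
    and conjugate: "1 / q + 1 / p = 1" and f: "f \<in> Lp W p"
begin

sublocale slice: uniformly_convex_growth "\<lambda>\<xi>. F (0, \<xi>)" q \<alpha> lam Lam
proof
  fix \<xi> \<eta> :: 'a
  show "2 * F (0, (1 / 2) *\<^sub>R (\<xi> + \<eta>)) + \<alpha> * norm (\<xi> - \<eta>) powr q \<le> F (0, \<xi>) + F (0, \<eta>)"
    using midpoint_convex[of "(0, \<xi>)" "(0, \<eta>)"] by (simp add: norm_Pair)
  show "lam * norm \<xi> powr q \<le> F (0, \<xi>)" "F (0, \<xi>) \<le> Lam * norm \<xi> powr q"
    using lower[of "(0, \<xi>)"] upper[of "(0, \<xi>)"] by (simp_all add: norm_Pair)
qed (use q \<alpha> lam Lam in auto)

lemma q1: "q > 1" and q0: "q > 0"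
  using q by auto

lemma p_eq: "p = q / (q - 1)"
proof -
  have "p \<noteq> 0" using conjugate q by auto
  then show ?thesis using conjugate q by (auto simp: field_simps)
qed

lemma p1: "p > 1"
  using q by (simp add: p_eq)

lemma W_finite: "finite_measure (lebesgue_on W)"
proof (rule finite_measure_lebesgue_on)
  have "bounded W" using R(2) by (auto simp: bounded_iff)
  then show "W \<in> lmeasurable" using W by (auto intro: bounded_set_imp_lmeasurable)
qed

text \<open>On a set of finite measure \<open>norm (k x) \<le> 1 + norm (k x) powr r\<close>
  suffices. The Fubini lemmas for strips ask for first-power integrability.\<close>

lemma W_Lp_integrable:
  fixes k :: "'a \<Rightarrow> 'b::euclidean_space"
  assumes k: "k \<in> Lp W r" and r: "r \<ge> 1"
  shows "integrable (lebesgue_on W) k"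
proof (rule Bochner_Integration.integrable_bound[OF _ Lp_D(1)[OF k]])
  show "integrable (lebesgue_on W) (\<lambda>x. 1 + norm (k x) powr r)"
    using Lp_D(2)[OF k] finite_measure.integrable_const[OF W_finite] by (intro Bochner_Integration.integrable_add)
  show "AE x in lebesgue_on W. norm (k x) \<le> norm (1 + norm (k x) powr r)"
  proof (rule AE_I2)
    fix x
    show "norm (k x) \<le> norm (1 + norm (k x) powr r)"
    proof (cases "norm (k x) \<le> 1")
      case False
      then have "norm (k x) powr 1 \<le> norm (k x) powr r" using r by (intro powr_mono) auto
      then show ?thesis using False by (simp add: powr_one)
    qed (simp add: add_increasing2)
  qed
qed

lemma f_integrable: "integrable (lebesgue_on W) f"
  using W_Lp_integrable[OF f] p1 by simp

abbreviation strip :: "real \<Rightarrow> real \<Rightarrow> (real \<times> 'a) set" where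
  "strip a b \<equiv> {a<..<b} \<times> W"

abbreviation E_strip :: "real \<Rightarrow> real \<Rightarrow> (real \<times> 'a \<Rightarrow> real) \<Rightarrow> real" where
  "E_strip a b \<equiv> energy (strip a b) F (\<lambda>X. f (snd X))"

abbreviation E_slice :: "('a \<Rightarrow> real) \<Rightarrow> real" where
  "E_slice \<equiv> energy W (\<lambda>\<xi>. F (0, \<xi>)) f"

lemma open_strip: "open (strip a b)"
  using W by (intro open_Times) auto

lemma f_snd_Lp:
  assumes "a \<le> b"
  shows "(\<lambda>X. f (snd X)) \<in> Lp (strip a b) p"
    and "(LINT X|lebesgue_on (strip a b). \<bar>f (snd X)\<bar> powr p) = (b - a) * (LINT y|lebesgue_on W. \<bar>f y\<bar> powr p)"
  using Fubini_strip_snd(1)[OF W assms f_integrable] Fubini_strip_snd[OF W assms Lp_D(2)[OF f]]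
  by (auto simp: Lp_def)

lemma E_strip_test_function:
  assumes "a \<le> b" "\<phi> \<in> test_functions (strip a b)"
  shows "integrable (lebesgue_on (strip a b)) (\<lambda>X. F (gradient \<phi> X) - f (snd X) * \<phi> X)"
    and "E_strip a b \<phi> = (LINT X|lebesgue_on (strip a b). F (gradient \<phi> X) - f (snd X) * \<phi> X)"
proof -
  note Lp = test_functions_Lp[OF open_strip assms(2) q0]
  show "integrable (lebesgue_on (strip a b)) (\<lambda>X. F (gradient \<phi> X) - f (snd X) * \<phi> X)"
    by (intro Bochner_Integration.integrable_diff F_integrable Lp
        Lp_product_integrable[OF f_snd_Lp(1)[OF assms(1)] Lp(1) q1 conjugate])
  show "E_strip a b \<phi> = (LINT X|lebesgue_on (strip a b). F (gradient \<phi> X) - f (snd X) * \<phi> X)"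
    by (rule energy_test_function[OF open_strip assms(2) Lp_D(1)[OF f_snd_Lp(1)[OF assms(1)]]])
qed

lemma E_slice_test_function:
  assumes "\<psi> \<in> test_functions W"
  shows "integrable (lebesgue_on W) (\<lambda>y. F (0, gradient \<psi> y) - f y * \<psi> y)"
    and "E_slice \<psi> = (LINT y|lebesgue_on W. F (0, gradient \<psi> y) - f y * \<psi> y)"
proof -
  note Lp = test_functions_Lp[OF W assms q0]
  show "integrable (lebesgue_on W) (\<lambda>y. F (0, gradient \<psi> y) - f y * \<psi> y)"
    by (intro Bochner_Integration.integrable_diff slice.F_integrable Lp
        Lp_product_integrable[OF f Lp(1) q1 conjugate])
  show "E_slice \<psi> = (LINT y|lebesgue_on W. F (0, gradient \<psi> y) - f y * \<psi> y)"
    by (rule slice.energy_test_function[OF W assms Lp_D(1)[OF f]])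
qed

text \<open>\<open>k\<close> may be nonzero up to the ends of the strip, so compactness is taken
  from the closed interval times \<open>L\<close>.\<close>

lemma bounded_on_strip:
  fixes k :: "real \<times> 'a \<Rightarrow> real"
  assumes "continuous_on UNIV k" "compact L" "\<And>x y. y \<notin> L \<Longrightarrow> k (x, y) = 0"
  obtains M where "\<And>X. X \<in> strip a b \<Longrightarrow> \<bar>k X\<bar> \<le> M"
proof -
  have "compact (k ` ({a..b} \<times> L))"
    using assms by (intro compact_continuous_image compact_Times) (auto intro: continuous_on_subset)
  then obtain M where "\<forall>z\<in>k ` ({a..b} \<times> L). norm z \<le> M"
    using compact_imp_bounded bounded_iff by metis
  then have M: "norm (k X) \<le> M" if "X \<in> {a..b} \<times> L" for X
    using that by blast
  have "\<bar>k X\<bar> \<le> max M 0" if "X \<in> strip a b" for X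
    using M[of X] assms(3)[of "snd X" "fst X"] that by (cases "snd X \<in> L"; cases X) (auto simp: le_max_iff_disj)
  then show ?thesis using that by blast
qed

text \<open>The mean over \<open>x \<in> (a, b)\<close> of a competitor on the strip is a competitor on \<open>W\<close>, and its derivative
  in \<open>x\<close> has mean zero when the boundary values at \<open>a\<close> and \<open>b\<close> agree.\<close>

lemma energy_strip_ge_slice:
  assumes ab: "a < b" and v: "smooth v" and L: "compact L" "L \<subseteq> W" "\<And>x y. y \<notin> L \<Longrightarrow> v (x, y) = 0"
    and periodic: "\<And>y. v (a, y) = v (b, y)"
    and c: "\<And>\<zeta>. \<zeta> \<in> test_functions W \<Longrightarrow> c \<le> E_slice \<zeta>"
  shows "integrable (lebesgue_on (strip a b)) (\<lambda>X. F (gradient v X) - f (snd X) * v X)"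
    and "(b - a) * c \<le> (LINT X|lebesgue_on (strip a b). F (gradient v X) - f (snd X) * v X)"
proof -
  let ?S = "strip a b"
  have g0: "gradient v (x, y) = 0" if "y \<notin> L" for x y
    by (rule gradient_eq_0_open[of "UNIV \<times> - L"])
      (use that L in \<open>auto intro!: open_Times simp: compact_imp_closed open_Compl\<close>)
  have Fc: "continuous_on UNIV (\<lambda>X. F (gradient v X))"
    by (rule continuous_on_compose2[OF continuous[of UNIV] smooth_continuous_gradient[OF v]]) simp
  have vc: "continuous_on UNIV v" by (rule smooth_continuous[OF v])
  obtain M where M: "\<And>X. X \<in> ?S \<Longrightarrow> \<bar>F (gradient v X)\<bar> \<le> M"
    by (rule bounded_on_strip[OF Fc L(1), of a b]) (use g0 in auto)
  obtain M' where M': "\<And>X. X \<in> ?S \<Longrightarrow> \<bar>v X\<bar> \<le> M'"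
    by (rule bounded_on_strip[OF vc L(1), of a b]) (use L in auto)
  \<comment> \<open>With the constant function 1 in the role of \<open>f\<close>,
    \<open>Fubini_strip\<close> also covers the integrand \<open>F (gradient v X)\<close>.\<close>
  have one: "integrable (lebesgue_on W) (\<lambda>_. 1 :: real)"
    by (rule finite_measure.integrable_const[OF W_finite])
  note Fub1 = Fubini_strip[OF W one Fc M]
  note Fub2 = Fubini_strip[OF W f_integrable vc M']
  define VF where "VF y = integral {a..b} (\<lambda>x. F (gradient v (x, y)))" for y
  define V where "V y = integral {a..b} (\<lambda>x. v (x, y))" for y
  show int: "integrable (lebesgue_on ?S) (\<lambda>X. F (gradient v X) - f (snd X) * v X)"
    using Fub1(1) Fub2(1) by simp
  have eq: "(LINT X|lebesgue_on ?S. F (gradient v X) - f (snd X) * v X) =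
      (LINT y|lebesgue_on W. VF y) - (LINT y|lebesgue_on W. f y * V y)"
    using Fub1 Fub2 by (simp add: VF_def V_def)
  have VF_int: "integrable (lebesgue_on W) VF"
  proof (rule integrable_lebesgue_on_compact_support(1)[OF W _ L(1,2)])
    have "continuous_on (UNIV \<times> cbox a b) (\<lambda>(y, x). F (gradient v (x, y)))"
      unfolding split_def by (intro continuous_on_compose2[OF Fc] continuous_intros) auto
    from integral_continuous_on_param[OF this] show "continuous_on UNIV VF"
      by (simp add: VF_def[abs_def])
    show "VF y = 0" if "y \<notin> L" for y
      using g0[OF that] by (simp add: VF_def)
  qed
  have V_test: "V \<in> test_functions W"
    unfolding V_def[abs_def] by (rule integral_slice_test_function[OF v L])
  have gV: "gradient V y = integral {a..b} (\<lambda>x. snd (gradient v (x, y)))" for y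
    unfolding V_def[abs_def] by (rule smooth_integral_slice(2)[OF v])
  define m where "m y = V y / (b - a)" for y
  have Vs: "smooth V" using V_test by (rule test_functions_smooth)
  have m_test: "m \<in> test_functions W"
  proof -
    obtain K where "smooth V" "compact K" "K \<subseteq> W" "\<And>x. x \<notin> K \<Longrightarrow> V x = 0"
      using V_test by (metis test_functionsE)
    then show ?thesis
      unfolding m_def[abs_def] by (intro test_functionsI[of _ K] smooth_divide) auto
  qed
  have gm: "gradient m y = (1 / (b - a)) *\<^sub>R gradient V y" for y
    unfolding m_def[abs_def] by (rule gradient_divide[OF Vs])
  have fV_int: "integrable (lebesgue_on W) (\<lambda>y. f y * V y)"
    by (rule Lp_product_integrable[OF f test_functions_Lp(1)[OF W V_test q0] q1 conjugate])
  have J: "(b - a) * F (0, gradient m y) \<le> VF y" for y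
  proof -
    have gc: "continuous_on {a..b} (\<lambda>x. gradient v (x, y))"
      by (intro continuous_on_compose2[OF smooth_continuous_gradient[OF v, of UNIV]] continuous_intros) auto
    have gi: "(\<lambda>x. gradient v (x, y)) integrable_on {a..b}"
      by (rule integrable_continuous_real[OF gc])
    \<comment> \<open>The first component is \<open>v (b, y) - v (a, y)\<close>, zero by
      periodicity. Jensen's inequality thus evaluates \<open>F\<close> at a vector with first
      component 0, which is the integrand of the slice energy.\<close>
    have "integral {a..b} (\<lambda>x. gradient v (x, y)) = (0, gradient V y)"
    proof (rule prod_eqI)
      have "fst (integral {a..b} (\<lambda>x. gradient v (x, y))) = integral {a..b} (\<lambda>x. fst (gradient v (x, y)))"
        using integral_linear[OF gi bounded_linear_fst] by (simp add: o_def)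
      also have "\<dots> = 0"
        using periodic[of y] ab by (simp add: integral_fst_gradient[OF v])
      finally show "fst (integral {a..b} (\<lambda>x. gradient v (x, y))) = fst (0, gradient V y)" by simp
      show "snd (integral {a..b} (\<lambda>x. gradient v (x, y))) = snd (0, gradient V y)"
        using integral_linear[OF gi bounded_linear_snd] by (simp add: o_def gV)
    qed
    then show ?thesis
      using Jensen[OF gc ab] by (simp add: gm VF_def)
  qed
  have "(b - a) * c \<le> (b - a) * E_slice m"
    using c[OF m_test] ab by simp
  also have "\<dots> = (LINT y|lebesgue_on W. (b - a) * (F (0, gradient m y) - f y * m y))"
    using E_slice_test_function[OF m_test] by simp
  also have "\<dots> \<le> (LINT y|lebesgue_on W. VF y - f y * V y)"
  proof (rule integral_mono)
    show "integrable (lebesgue_on W) (\<lambda>y. (b - a) * (F (0, gradient m y) - f y * m y))"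
      using E_slice_test_function(1)[OF m_test] by simp
    show "integrable (lebesgue_on W) (\<lambda>y. VF y - f y * V y)"
      using VF_int fV_int by simp
    show "(b - a) * (F (0, gradient m y) - f y * m y) \<le> VF y - f y * V y" for y
      using J[of y] ab by (simp add: m_def right_diff_distrib)
  qed
  also have "\<dots> = (LINT X|lebesgue_on ?S. F (gradient v X) - f (snd X) * v X)"
    unfolding eq using VF_int fV_int by simp
  finally show "(b - a) * c \<le> (LINT X|lebesgue_on ?S. F (gradient v X) - f (snd X) * v X)" .
qed

text \<open>The direction lies in the bounded cross-section and not along the strip, so the Poincare
  constant is independent of the length of the strip.\<close>

lemma transversal_direction:
  obtains e :: "real \<times> 'a" where "norm e = 1" "fst e = 0" "\<And>X. snd X \<in> W \<Longrightarrow> \<bar>X \<bullet> e\<bar> \<le> R"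
proof -
  obtain i :: 'a where i: "i \<in> Basis" using nonempty_Basis by blast
  have "\<bar>X \<bullet> (0, i)\<bar> \<le> R" if "snd X \<in> W" for X :: "real \<times> 'a"
    using Basis_le_norm[OF i, of "snd X"] R(2)[OF that] by (simp add: inner_prod_def)
  then show ?thesis using that[of "(0, i)"] i by (simp add: norm_Pair)
qed

text \<open>The function \<open>z\<close> need not vanish near the two ends of the strip, where the
  weight takes over; the condition on \<open>K\<close> allows either. As the weight depends on X_1
  alone, its gradient is orthogonal to the transversal direction.\<close>

lemma strip_Poincare:
  fixes r z :: "real \<times> 'a \<Rightarrow> real"
  assumes r: "smooth r" "\<And>X. r X \<ge> 0" "\<And>X. snd (gradient r X) = 0" and z: "smooth z"
    and K: "compact K" "K \<subseteq> strip a b" "\<And>X. X \<notin> K \<Longrightarrow> r X = 0 \<or> (z X = 0 \<and> gradient z X = 0)"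
  shows "integrable (lebesgue_on (strip a b)) (\<lambda>X. r X * \<bar>z X\<bar> powr q)"
    and "integrable (lebesgue_on (strip a b)) (\<lambda>X. r X * norm (gradient z X) powr q)"
    and "(LINT X|lebesgue_on (strip a b). r X * \<bar>z X\<bar> powr q)
      \<le> Poincare_const q R * (LINT X|lebesgue_on (strip a b). r X * norm (gradient z X) powr q)"
proof -
  obtain e :: "real \<times> 'a" where e: "norm e = 1" "fst e = 0" "\<And>X. snd X \<in> W \<Longrightarrow> \<bar>X \<bullet> e\<bar> \<le> R"
    using transversal_direction by metis
  have c1: "continuous_on UNIV (\<lambda>X. r X * \<bar>z X\<bar> powr q)"
    by (intro continuous_on_mult continuous_on_powr' continuous_on_rabs continuous_on_const smooth_continuous r z)
      (use q in auto)
  have c2: "continuous_on UNIV (\<lambda>X. r X * norm (gradient z X) powr q)"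
    by (intro continuous_on_mult continuous_on_powr' continuous_on_norm continuous_on_const smooth_continuous
        smooth_continuous_gradient r z) (use q in auto)
  have 0: "r X * \<bar>z X\<bar> powr q = 0" "r X * norm (gradient z X) powr q = 0" if "X \<notin> K" for X
    using K(3)[OF that] by auto
  note 1 = integrable_lebesgue_on_compact_support[OF open_strip c1 K(1,2) 0(1)]
  note 2 = integrable_lebesgue_on_compact_support[OF open_strip c2 K(1,2) 0(2)]
  show "integrable (lebesgue_on (strip a b)) (\<lambda>X. r X * \<bar>z X\<bar> powr q)"
    "integrable (lebesgue_on (strip a b)) (\<lambda>X. r X * norm (gradient z X) powr q)"
    by (rule 1 2, assumption)+
  have "(LINT X|lborel. r X * \<bar>z X\<bar> powr q) \<le> Poincare_const q R * (LINT X|lborel. r X * norm (gradient z X) powr q)"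
  proof (rule weighted_Poincare[OF q1 R(1) r(1) z r(2) _ e(1) K(1) _ K(3)])
    show "gradient r X \<bullet> e = 0" for X using e(2) r(3) by (simp add: inner_prod_def)
    show "\<bar>X \<bullet> e\<bar> \<le> R" if "X \<in> K" for X using e(3)[of X] that K(2) by auto
  qed
  then show "(LINT X|lebesgue_on (strip a b). r X * \<bar>z X\<bar> powr q)
      \<le> Poincare_const q R * (LINT X|lebesgue_on (strip a b). r X * norm (gradient z X) powr q)"
    using 1(2) 2(2) by simp
qed

text \<open>Coercivity bounds the gradient by the energy plus the term with \<open>f\<close>, and
  Young's and Poincare's inequalities absorb the latter. The bound is linear in the length because
  \<open>f\<close> does not depend on X_1.\<close>

lemma strip_gradient_bound:
  obtains C where "C > 0"
    "\<And>a b \<epsilon> \<phi>. \<lbrakk>a \<le> b; \<phi> \<in> test_functions (strip a b); E_strip a b \<phi> \<le> \<epsilon>; \<epsilon> \<ge> 0\<rbrakk> \<Longrightarrow>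
      (LINT X|lebesgue_on (strip a b). norm (gradient \<phi> X) powr q) \<le> C * (b - a + \<epsilon>)"
proof -
  define CP where "CP = Poincare_const q R"
  have CP: "CP > 0" using Poincare_const_pos[OF q1 R(1)] by (simp add: CP_def)
  \<comment> \<open>With this \<tau> the Poincare bound for the \<open>\<phi>\<close>-term is
    exactly half of \<open>lam * P\<close>.\<close>
  define \<tau> where "\<tau> = lam / (2 * CP)"
  have \<tau>: "\<tau> > 0" using lam CP by (simp add: \<tau>_def)
  \<comment> \<open>The exponents trade places so that the small constant falls on \<phi> and the
    large one on \<open>f\<close>.\<close>
  have conj': "1 / p + 1 / q = 1" using conjugate by simp
  obtain D where D: "D \<ge> 0" "\<And>a b. a \<ge> 0 \<Longrightarrow> b \<ge> 0 \<Longrightarrow> a * b \<le> \<tau> * a powr q + D * b powr p"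
    using Young_with_small_constant[OF p1 conj' \<tau>] by blast
  define Nf where "Nf = (LINT y|lebesgue_on W. \<bar>f y\<bar> powr p)"
  have Nf: "Nf \<ge> 0" by (simp add: Nf_def)
  define C where "C = 2 / lam * (1 + D * Nf)"
  have "1 + D * Nf > 0" using D(1) Nf by (simp add: add_pos_nonneg)
  then have C: "C > 0" unfolding C_def using lam by (intro mult_pos_pos) auto
  have main: "(LINT X|lebesgue_on (strip a b). norm (gradient \<phi> X) powr q) \<le> C * (b - a + \<epsilon>)"
    if ab: "a \<le> b" and \<phi>: "\<phi> \<in> test_functions (strip a b)" and E: "E_strip a b \<phi> \<le> \<epsilon>" and \<epsilon>0: "\<epsilon> \<ge> 0" for a b \<epsilon> \<phi>
  proof -
    let ?S = "strip a b"
    obtain K where K: "smooth \<phi>" "compact K" "K \<subseteq> ?S" "\<And>x. x \<notin> K \<Longrightarrow> \<phi> x = 0" "\<And>x. x \<notin> K \<Longrightarrow> gradient \<phi> x = 0"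
      using \<phi> by (metis test_functionsE)
    note Lp = test_functions_Lp[OF open_strip \<phi> q0]
    define P where "P = (LINT X|lebesgue_on ?S. norm (gradient \<phi> X) powr q)"
    have P: "(LINT X|lebesgue_on ?S. \<bar>\<phi> X\<bar> powr q) \<le> CP * P"
      using strip_Poincare(3)[OF smooth_const[of 1] _ _ K(1-3)] K(4,5) by (simp add: P_def CP_def)
    note iP = Lp_D(2)[OF Lp(2)] and i\<phi> = Lp_D(2)[OF Lp(1)] and iF = Lp_D(2)[OF f_snd_Lp(1)[OF ab]]
    have "lam * P = (LINT X|lebesgue_on ?S. lam * norm (gradient \<phi> X) powr q)"
      by (simp add: P_def)
    also have "\<dots> \<le> (LINT X|lebesgue_on ?S. (F (gradient \<phi> X) - f (snd X) * \<phi> X)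
        + (\<tau> * norm (\<phi> X) powr q + D * norm (f (snd X)) powr p))"
    proof (rule integral_mono)
      show "integrable (lebesgue_on ?S) (\<lambda>X. lam * norm (gradient \<phi> X) powr q)"
        using iP by (rule integrable_mult_right)
      show "integrable (lebesgue_on ?S) (\<lambda>X. (F (gradient \<phi> X) - f (snd X) * \<phi> X)
        + (\<tau> * norm (\<phi> X) powr q + D * norm (f (snd X)) powr p))"
        by (intro Bochner_Integration.integrable_add integrable_mult_right i\<phi> iF E_strip_test_function(1)[OF ab \<phi>])
      fix X
      have "f (snd X) * \<phi> X \<le> norm (\<phi> X) * norm (f (snd X))"
        by (metis abs_ge_self abs_mult mult.commute real_norm_def)
      also have "\<dots> \<le> \<tau> * norm (\<phi> X) powr q + D * norm (f (snd X)) powr p"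
        by (rule D(2)) auto
      finally show "lam * norm (gradient \<phi> X) powr q \<le> (F (gradient \<phi> X) - f (snd X) * \<phi> X)
        + (\<tau> * norm (\<phi> X) powr q + D * norm (f (snd X)) powr p)"
        using lower[of "gradient \<phi> X"] by simp
    qed
    also have "\<dots> = E_strip a b \<phi> + (\<tau> * (LINT X|lebesgue_on ?S. \<bar>\<phi> X\<bar> powr q) + D * ((b - a) * Nf))"
    proof -
      have "(LINT X|lebesgue_on ?S. (F (gradient \<phi> X) - f (snd X) * \<phi> X)
        + (\<tau> * norm (\<phi> X) powr q + D * norm (f (snd X)) powr p)) =
        (LINT X|lebesgue_on ?S. F (gradient \<phi> X) - f (snd X) * \<phi> X) +
        ((LINT X|lebesgue_on ?S. \<tau> * norm (\<phi> X) powr q) + (LINT X|lebesgue_on ?S. D * norm (f (snd X)) powr p))"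
        by (subst Bochner_Integration.integral_add, rule E_strip_test_function(1)[OF ab \<phi>],
            intro Bochner_Integration.integrable_add integrable_mult_right i\<phi> iF,
            subst Bochner_Integration.integral_add, rule integrable_mult_right[OF i\<phi>], rule integrable_mult_right[OF iF], rule refl)
      then show ?thesis
        using f_snd_Lp(2)[OF ab] E_strip_test_function(2)[OF ab \<phi>] by (simp add: Nf_def)
    qed
    also have "\<dots> \<le> \<epsilon> + (\<tau> * (CP * P) + D * ((b - a) * Nf))"
      using E P \<tau> D(1) ab by (intro add_mono mult_left_mono) auto
    also have "\<dots> = \<epsilon> + lam / 2 * P + D * Nf * (b - a)"
      using CP by (simp add: \<tau>_def)
    finally have "lam / 2 * P \<le> \<epsilon> + D * Nf * (b - a)" by simp
    then have "P \<le> 2 / lam * (\<epsilon> + D * Nf * (b - a))"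
      using lam by (simp add: field_simps)
    also have "\<dots> \<le> 2 / lam * ((1 + D * Nf) * (b - a + \<epsilon>))"
    proof -
      have "0 \<le> D * Nf * \<epsilon>" using D(1) Nf \<epsilon>0 by simp
      then have "\<epsilon> + D * Nf * (b - a) \<le> (1 + D * Nf) * (b - a + \<epsilon>)"
        using ab by (simp add: algebra_simps)
      then show ?thesis using lam by (intro mult_left_mono) auto
    qed
    also have "\<dots> = C * (b - a + \<epsilon>)" by (simp add: C_def)
    finally show ?thesis by (simp add: P_def)
  qed
  show ?thesis by (rule that[OF C main])
qed

text \<open>\<open>2 * Lip\<close> and \<open>4 powr q\<close> stem from
  \<open>interpolated_pair_estimate\<close>; the Poincare constant appears wherever the power of
  \<open>w\<close> is replaced by that of its gradient. The three summands dominate every product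
  that arises.\<close>

definition cutoff_const :: real where
  "cutoff_const = 2 * Lip * (Poincare_const q R + 4 powr q + 4 powr q * Poincare_const q R)"

lemma cutoff_const_pos: "cutoff_const > 0"
  unfolding cutoff_const_def using Poincare_const_pos[OF q1 R(1)] Lip_pos
  by (intro mult_pos_pos add_pos_pos) auto

text \<open>Compare \<open>\<phi>\<close> with \<open>\<phi> - \<eta>\<^sup>2 w / 2\<close> and \<open>\<psi>\<close> with \<open>\<psi> + \<eta>\<^sup>2 w / 2\<close>, where \<open>w = \<phi> - \<psi>\<close>: the linear
  terms cancel, and squaring the cutoff \<open>\<eta>\<close> bounds its derivative by itself.\<close>

lemma cutoff_estimate:
  fixes \<eta> :: "real \<Rightarrow> real"
  assumes ab: "a < c" "c \<le> d" "d < b" and \<eta>: "smooth \<eta>" "\<And>x. 0 \<le> \<eta> x" "\<And>x. \<eta> x \<le> 1" "\<And>x. \<bar>gradient \<eta> x\<bar> \<le> m"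
       "\<And>x. x \<notin> {c..d} \<Longrightarrow> \<eta> x = 0" and \<phi>: "\<phi> \<in> test_functions (strip a b)" and \<psi>: "\<psi> \<in> test_functions W"
      and E\<phi>: "\<And>\<zeta>. \<zeta> \<in> test_functions (strip a b) \<Longrightarrow> E_strip a b \<phi> \<le> E_strip a b \<zeta> + \<epsilon>"
      and E\<psi>: "\<And>\<zeta>. \<zeta> \<in> test_functions W \<Longrightarrow> E_slice \<psi> \<le> E_slice \<zeta> + \<epsilon>'" and s: "s > 0"
      and Y_eq: "Y = (LINT X|lebesgue_on (strip a b). (\<eta> (fst X))\<^sup>2 * norm (gradient \<phi> X - (0, gradient \<psi> (snd X))) powr q)"
      and P_eq: "P = (LINT X|lebesgue_on (strip a b). norm (gradient \<phi> X) powr q)"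
      and Q_eq: "Q = (LINT y|lebesgue_on W. norm (gradient \<psi> y) powr q)"
  shows "\<alpha> * Y \<le> \<epsilon> + (b - a) * \<epsilon>' + cutoff_const * (s powr (- q) * (m powr q * Y)
         + s powr (q / (q - 1)) * (P + (b - a) * Q + m powr q * Y))"
proof -
  define CP where "CP = Poincare_const q R"
  have CP: "CP > 0" using Poincare_const_pos[OF q1 R(1)] by (simp add: CP_def)
  define C where "C = 2 * Lip * (CP + 4 powr q + 4 powr q * CP)"
  have C_eq: "C = cutoff_const" by (simp add: C_def cutoff_const_def CP_def)
  let ?S = "strip a b"
  have ab': "a \<le> b" "a < b" using ab by auto
  have m: "m \<ge> 0" using \<eta>(4)[of 0] by linarith
  obtain K where K: "smooth \<phi>" "compact K" "K \<subseteq> ?S" "\<And>x. x \<notin> K \<Longrightarrow> \<phi> x = 0" "\<And>x. x \<notin> K \<Longrightarrow> gradient \<phi> x = 0"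
    using \<phi> by (metis test_functionsE)
  obtain L where L: "smooth \<psi>" "compact L" "L \<subseteq> W" "\<And>x. x \<notin> L \<Longrightarrow> \<psi> x = 0" "\<And>x. x \<notin> L \<Longrightarrow> gradient \<psi> x = 0"
    using \<psi> by (metis test_functionsE)
  \<comment> \<open>A common compact set in \<open>W\<close> outside which \<phi> and \<psi> vanish
    for all X_1.\<close>
  define N where "N = snd ` K \<union> L"
  have N: "compact N" "N \<subseteq> W"
  proof -
    have "compact (snd ` K)" by (intro compact_continuous_image continuous_intros K)
    then show "compact N" using L(2) by (simp add: N_def compact_Un)
    show "N \<subseteq> W" using K(3) L(3) by (auto simp: N_def)
  qed
  have N0: "\<phi> (x, y) = 0" "gradient \<phi> (x, y) = 0" "\<psi> y = 0" "gradient \<psi> y = 0" if "y \<notin> N" for x y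
  proof -
    have "(x, y) \<notin> K" "y \<notin> L" using that imageI[of "(x, y)" K snd] by (auto simp: N_def)
    then show "\<phi> (x, y) = 0" "gradient \<phi> (x, y) = 0" "\<psi> y = 0" "gradient \<psi> y = 0"
      using K L by auto
  qed
  define \<rho> where "\<rho> X = (\<eta> (fst X))\<^sup>2" for X :: "real \<times> 'a"
  define w where "w X = \<phi> X - \<psi> (snd X)" for X
  define gw where "gw X = gradient \<phi> X - (0, gradient \<psi> (snd X))" for X
  \<comment> \<open>The gradient of the cutoff \<rho> is \<open>2 * \<eta> * \<eta>'\<close> in the
    first component, so the factor 2 cancels the one half in the competitors; the sign is the one
    with which it enters \<open>v1\<close>.\<close>
  define k where "k X = (- (w X * \<eta> (fst X) * gradient \<eta> (fst X)), 0 :: 'a)" for X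
  define v1 where "v1 X = \<phi> X - \<rho> X * w X / 2" for X
  define v2 where "v2 X = \<psi> (snd X) + \<rho> X * w X / 2" for X
  have \<rho>s: "smooth \<rho>" unfolding \<rho>_def[abs_def] by (intro smooth_power2 smooth_compose_fst \<eta>)
  have ws: "smooth w" unfolding w_def[abs_def] by (intro smooth_diff smooth_compose_snd K L)
  have \<psi>s: "smooth (\<lambda>X. \<psi> (snd X))" by (intro smooth_compose_snd L)
  have hs: "smooth (\<lambda>X. \<rho> X * w X / 2)" by (intro smooth_divide smooth_mult \<rho>s ws)
  have v1s: "smooth v1" unfolding v1_def[abs_def] by (intro smooth_diff hs K)
  have v2s: "smooth v2" unfolding v2_def[abs_def] by (intro smooth_add hs \<psi>s)
  have g\<psi>: "gradient (\<lambda>X. \<psi> (snd X)) X = (0, gradient \<psi> (snd X))" for X :: "real \<times> 'a"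
    by (rule gradient_compose_snd[OF L(1)])
  have gw: "gradient w X = gw X" for X
    unfolding w_def[abs_def] gw_def by (simp add: gradient_diff[OF K(1) \<psi>s] g\<psi>)
  have g\<rho>: "gradient \<rho> X = (2 * \<eta> (fst X) * gradient \<eta> (fst X), 0)" for X
  proof -
    have "smooth (\<lambda>X :: real \<times> 'a. \<eta> (fst X))" by (intro smooth_compose_fst \<eta>)
    from gradient_mult[OF this this] show ?thesis
      by (simp add: \<rho>_def[abs_def] power2_eq_square gradient_compose_fst[OF \<eta>(1)])
  qed
  have gh: "gradient (\<lambda>X. \<rho> X * w X / 2) X = (\<rho> X / 2) *\<^sub>R gw X - k X" for X
    by (simp add: gradient_divide[OF smooth_mult[OF \<rho>s ws]] gradient_mult[OF \<rho>s ws] gw g\<rho> k_def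
        scaleR_add_right prod_eq_iff)
  have gv1: "gradient v1 X = gradient \<phi> X + (\<rho> X / 2) *\<^sub>R ((0, gradient \<psi> (snd X)) - gradient \<phi> X) + k X" for X
    unfolding v1_def[abs_def] gradient_diff[OF K(1) hs] gh gw_def by (simp add: scaleR_diff_right)
  have gv2: "gradient v2 X = (0, gradient \<psi> (snd X)) + (\<rho> X / 2) *\<^sub>R (gradient \<phi> X - (0, gradient \<psi> (snd X))) - k X" for X
    unfolding v2_def[abs_def] gradient_add[OF \<psi>s hs] gh gw_def g\<psi> by simp
  have \<rho>0: "\<rho> (x, y) = 0" if "x \<notin> {c..d}" for x y
    using \<eta>(5)[OF that] by (simp add: \<rho>_def)
  have cK: "compact ({c..d} \<times> N)" "{c..d} \<times> N \<subseteq> ?S"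
    using N ab by (auto intro: compact_Times)
  \<comment> \<open>\<open>w\<close> itself does not vanish near the ends of the strip, because
    \<psi> is constant in X_1.\<close>
  have off: "\<rho> X = 0 \<or> (w X = 0 \<and> gw X = 0)" if "X \<notin> {c..d} \<times> N" for X
    using that \<rho>0[of "fst X" "snd X"] N0[of "snd X"] by (cases X) (auto simp: w_def gw_def zero_prod_def)
  have v1_test: "v1 \<in> test_functions ?S"
  proof (rule test_functionsI[OF v1s, of "K \<union> {c..d} \<times> N"])
    show "v1 X = 0" if "X \<notin> K \<union> {c..d} \<times> N" for X
      using that off[of X] K(4)[of X] by (auto simp: v1_def)
  qed (use K cK in auto)
  have v2_energy: "integrable (lebesgue_on ?S) (\<lambda>X. F (gradient v2 X) - f (snd X) * v2 X)"
      "(b - a) * (E_slice \<psi> - \<epsilon>') \<le> (LINT X|lebesgue_on ?S. F (gradient v2 X) - f (snd X) * v2 X)"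
  proof -
    have 0: "v2 (x, y) = 0" if "y \<notin> N" for x y
      using N0[OF that] by (simp add: v2_def w_def)
    \<comment> \<open>The cutoff vanishes outside \<open>{c..d}\<close>, so \<open>v2\<close>
      coincides with \<psi> at both ends.\<close>
    have 1: "v2 (a, y) = v2 (b, y)" for y
      using \<rho>0[of a y] \<rho>0[of b y] ab by (simp add: v2_def)
    have 2: "E_slice \<psi> - \<epsilon>' \<le> E_slice \<zeta>" if "\<zeta> \<in> test_functions W" for \<zeta>
      using E\<psi>[OF that] by simp
    show "integrable (lebesgue_on ?S) (\<lambda>X. F (gradient v2 X) - f (snd X) * v2 X)"
      "(b - a) * (E_slice \<psi> - \<epsilon>') \<le> (LINT X|lebesgue_on ?S. F (gradient v2 X) - f (snd X) * v2 X)"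
      using energy_strip_ge_slice[OF ab'(2) v2s N 0 1 2] by auto
  qed
  note \<phi>_energy = E_strip_test_function[OF ab'(1) \<phi>]
  note v1_energy = E_strip_test_function[OF ab'(1) v1_test]
  have \<psi>_energy: "integrable (lebesgue_on ?S) (\<lambda>X. F (0, gradient \<psi> (snd X)) - f (snd X) * \<psi> (snd X))"
      "(LINT X|lebesgue_on ?S. F (0, gradient \<psi> (snd X)) - f (snd X) * \<psi> (snd X)) = (b - a) * E_slice \<psi>"
    using Fubini_strip_snd[OF W ab'(1) E_slice_test_function(1)[OF \<psi>]] E_slice_test_function(2)[OF \<psi>] by auto
  have Poincare: "integrable (lebesgue_on ?S) (\<lambda>X. \<rho> X * \<bar>w X\<bar> powr q)"
      "integrable (lebesgue_on ?S) (\<lambda>X. \<rho> X * norm (gw X) powr q)"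
      "(LINT X|lebesgue_on ?S. \<rho> X * \<bar>w X\<bar> powr q) \<le> CP * (LINT X|lebesgue_on ?S. \<rho> X * norm (gw X) powr q)"
    using strip_Poincare[OF \<rho>s _ _ ws cK] off by (simp_all add: gw g\<rho> CP_def, simp_all add: \<rho>_def)
  note iw = Poincare(1) and igw = Poincare(2)
  have Y: "Y = (LINT X|lebesgue_on ?S. \<rho> X * norm (gw X) powr q)"
    by (simp add: Y_eq \<rho>_def gw_def)
  have Y0: "Y \<ge> 0" unfolding Y by (rule integral_nonneg_AE) (auto simp: \<rho>_def)
  have i\<phi>: "integrable (lebesgue_on ?S) (\<lambda>X. norm (gradient \<phi> X) powr q)"
    by (rule Lp_D(2)[OF test_functions_Lp(2)[OF open_strip \<phi> q0]])
  have i\<psi>: "integrable (lebesgue_on ?S) (\<lambda>X. norm (gradient \<psi> (snd X)) powr q)"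
      "(LINT X|lebesgue_on ?S. norm (gradient \<psi> (snd X)) powr q) = (b - a) * Q"
    using Fubini_strip_snd[OF W ab'(1) Lp_D(2)[OF test_functions_Lp(2)[OF W \<psi> q0]]] by (auto simp: Q_eq)
  let ?A = "\<lambda>X. (F (gradient \<phi> X) - f (snd X) * \<phi> X) + (F (0, gradient \<psi> (snd X)) - f (snd X) * \<psi> (snd X))
      - (F (gradient v1 X) - f (snd X) * v1 X) - (F (gradient v2 X) - f (snd X) * v2 X)"
  let ?N = "\<lambda>X. m powr q * (\<rho> X * \<bar>w X\<bar> powr q)"
  let ?B = "\<lambda>X. 2 * Lip * (s powr (- q) * ?N X + s powr (q / (q - 1)) *
      (4 powr q * (norm (gradient \<phi> X) powr q + norm (gradient \<psi> (snd X)) powr q + ?N X)))"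
  have pt: "\<alpha> * (\<rho> X * norm (gw X) powr q) \<le> ?A X + ?B X" for X
  proof -
    \<comment> \<open>Here \<open>q \<ge> 2\<close> and \<open>0 \<le> \<eta> \<le> 1\<close> enter:
      the factor \<eta> from differentiating the square, raised to the power \<open>q\<close>, is
      still dominated by the weight itself.\<close>
    have \<eta>1: "\<eta> (fst X) powr q \<le> \<rho> X"
    proof (cases "\<eta> (fst X) = 0")
      case False
      then have "\<eta> (fst X) > 0" using \<eta>(2)[of "fst X"] by simp
      then have "\<eta> (fst X) powr q \<le> \<eta> (fst X) powr 2"
        using \<eta>(3) q by (intro powr_mono') auto
      then show ?thesis using \<open>\<eta> (fst X) > 0\<close> by (simp add: \<rho>_def)
    qed (use q in \<open>simp add: \<rho>_def\<close>)
    have "norm (k X) \<le> m * (\<eta> (fst X) * \<bar>w X\<bar>)"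
    proof -
      have "norm (k X) = \<bar>gradient \<eta> (fst X)\<bar> * (\<eta> (fst X) * \<bar>w X\<bar>)"
        using \<eta>(2)[of "fst X"] by (simp add: k_def norm_Pair abs_mult)
      also have "\<dots> \<le> m * (\<eta> (fst X) * \<bar>w X\<bar>)"
        using \<eta>(2)[of "fst X"] \<eta>(4) by (intro mult_right_mono) auto
      finally show ?thesis .
    qed
    then have "norm (k X) powr q \<le> (m * (\<eta> (fst X) * \<bar>w X\<bar>)) powr q"
      using q by (intro powr_mono2) auto
    also have "\<dots> = m powr q * (\<eta> (fst X) powr q * \<bar>w X\<bar> powr q)"
      using m \<eta>(2)[of "fst X"] by (simp add: powr_mult)
    also have "\<dots> \<le> ?N X"
      using \<eta>1 by (intro mult_left_mono mult_right_mono) auto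
    finally have kN: "norm (k X) powr q \<le> ?N X" .
    have \<rho>1: "0 \<le> \<rho> X" "\<rho> X \<le> 1" using \<eta>(2,3)[of "fst X"] by (auto simp: \<rho>_def power_le_one)
    have "\<rho> X * (\<alpha> * norm (gradient \<phi> X - (0, gradient \<psi> (snd X))) powr q) \<le>
        F (gradient \<phi> X) + F (0, gradient \<psi> (snd X)) - F (gradient v1 X) - F (gradient v2 X) + ?B X"
      using interpolated_pair_estimate[OF \<rho>1 s kN, of "gradient \<phi> X" "(0, gradient \<psi> (snd X))"]
      unfolding gv1 gv2 by (simp add: norm_Pair)
    moreover have "f (snd X) * \<phi> X + f (snd X) * \<psi> (snd X) = f (snd X) * v1 X + f (snd X) * v2 X"
      by (simp add: v1_def v2_def algebra_simps)
    ultimately show ?thesis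
      by (simp add: gw_def mult.left_commute)
  qed
  have iA: "integrable (lebesgue_on ?S) ?A"
    by (intro Bochner_Integration.integrable_add Bochner_Integration.integrable_diff \<phi>_energy v1_energy(1) v2_energy(1) \<psi>_energy(1))
  have iN: "integrable (lebesgue_on ?S) ?N" by (intro integrable_mult_right iw)
  have iB: "integrable (lebesgue_on ?S) ?B"
    by (intro integrable_mult_right Bochner_Integration.integrable_add iN i\<phi> i\<psi>(1))
  have "\<alpha> * Y = (LINT X|lebesgue_on ?S. \<alpha> * (\<rho> X * norm (gw X) powr q))"
    by (simp add: Y)
  also have "\<dots> \<le> (LINT X|lebesgue_on ?S. ?A X + ?B X)"
    by (rule integral_mono[OF _ _ pt]) (intro integrable_mult_right igw Bochner_Integration.integrable_add iA iB)+
  also have "\<dots> = (LINT X|lebesgue_on ?S. ?A X) + (LINT X|lebesgue_on ?S. ?B X)"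
    by (rule Bochner_Integration.integral_add[OF iA iB])
  also have "(LINT X|lebesgue_on ?S. ?A X) =
      E_strip a b \<phi> + (b - a) * E_slice \<psi> - E_strip a b v1 - (LINT X|lebesgue_on ?S. F (gradient v2 X) - f (snd X) * v2 X)"
    unfolding \<phi>_energy(2) v1_energy(2) \<psi>_energy(2)[symmetric]
    by (subst Bochner_Integration.integral_diff,
        intro Bochner_Integration.integrable_add Bochner_Integration.integrable_diff \<phi>_energy v1_energy(1) \<psi>_energy(1),
        rule v2_energy(1), subst Bochner_Integration.integral_diff,
        intro Bochner_Integration.integrable_add \<phi>_energy \<psi>_energy(1), rule v1_energy(1),
        subst Bochner_Integration.integral_add, rule \<phi>_energy(1), rule \<psi>_energy(1), rule refl)
  also have "\<dots> \<le> \<epsilon> + (b - a) * \<epsilon>'"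
    using v2_energy(2) E\<phi>[OF v1_test] by (simp add: right_diff_distrib)
  also have "(LINT X|lebesgue_on ?S. ?B X) =
      2 * Lip * (s powr (- q) * (LINT X|lebesgue_on ?S. ?N X) + s powr (q / (q - 1)) *
      (4 powr q * (P + (b - a) * Q + (LINT X|lebesgue_on ?S. ?N X))))"
  proof -
    have 1: "(LINT X|lebesgue_on ?S. norm (gradient \<phi> X) powr q + norm (gradient \<psi> (snd X)) powr q + ?N X) =
        P + (b - a) * Q + (LINT X|lebesgue_on ?S. ?N X)"
      by (subst Bochner_Integration.integral_add, intro Bochner_Integration.integrable_add i\<phi> i\<psi>(1), rule iN,
          subst Bochner_Integration.integral_add, rule i\<phi>, rule i\<psi>(1), simp only: P_eq i\<psi>(2))
    show ?thesis
      by (subst integral_mult_right_zero, subst Bochner_Integration.integral_add,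
          intro integrable_mult_right iN, intro integrable_mult_right Bochner_Integration.integrable_add iN i\<phi> i\<psi>(1),
          simp only: integral_mult_right_zero 1)
  qed
  also have "\<dots> \<le> 2 * Lip * (s powr (- q) * (m powr q * (CP * Y)) + s powr (q / (q - 1)) *
      (4 powr q * (P + (b - a) * Q + m powr q * (CP * Y))))"
  proof -
    have "(LINT X|lebesgue_on ?S. ?N X) \<le> m powr q * (CP * Y)"
      using Poincare(3) by (simp only: integral_mult_right_zero Y) (intro mult_left_mono, auto)
    then show ?thesis using Lip_pos ab' by (intro mult_left_mono add_mono) auto
  qed
  also have "\<dots> \<le> C * (s powr (- q) * (m powr q * Y) + s powr (q / (q - 1)) * (P + (b - a) * Q + m powr q * Y))"
  proof -
    define T where "T = m powr q * Y"
    define U where "U = P + (b - a) * Q"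
    define x where "x = s powr (- q)"
    define y where "y = s powr (q / (q - 1))"
    define z where "z = (4 :: real) powr q"
    have T: "T \<ge> 0" using Y0 by (simp add: T_def)
    have U: "U \<ge> 0" using ab' by (simp add: U_def P_eq Q_eq)
    have xyz: "x \<ge> 0" "y \<ge> 0" "z \<ge> 0" by (auto simp: x_def y_def z_def)
    have "x * (CP * T) + y * (z * (U + CP * T)) \<le> (CP + z + z * CP) * (x * T + y * (U + T))"
    proof -
      \<comment> \<open>This is the difference of the two sides, written as a sum of nonnegative
        products.\<close>
      have "0 \<le> (z + z * CP) * (x * T) + CP * (y * (U + T)) + z * (y * T) + z * CP * (y * U)"
        using T U xyz CP by (intro add_nonneg_nonneg mult_nonneg_nonneg) auto
      then show ?thesis by (simp add: algebra_simps)
    qed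
    from mult_left_mono[OF this, of "2 * Lip"] Lip_pos show ?thesis
      unfolding C_def T_def[symmetric] U_def[symmetric] x_def[symmetric] y_def[symmetric] z_def[symmetric]
      by (simp add: T_def mult.left_commute mult.assoc)
  qed
  finally show ?thesis by (simp add: C_eq)
qed

end

section \<open>Rate of convergence\<close>

text \<open>Each segment from 0 stays in the set, so it fills everything between its infimum and
  supremum; openness keeps these two from being attained.\<close>

lemma starshaped_open_interval:
  fixes \<omega> :: "real set"
  assumes "open \<omega>" "bounded \<omega>" "0 \<in> \<omega>" "\<And>x. x \<in> \<omega> \<Longrightarrow> closed_segment 0 x \<subseteq> \<omega>"
  obtains A B where "A > 0" "B > 0" "\<omega> = {- A<..<B}"
proof -
  have bdd: "bdd_above \<omega>" "bdd_below \<omega>"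
    using assms(2) by (auto simp: bounded_imp_bdd_above bounded_imp_bdd_below)
  have ne: "\<omega> \<noteq> {}" using assms(3) by blast
  have lt: "Inf \<omega> < x \<and> x < Sup \<omega>" if x: "x \<in> \<omega>" for x
  proof -
    obtain e where e: "e > 0" "\<And>y. \<bar>y - x\<bar> < e \<Longrightarrow> y \<in> \<omega>"
      using assms(1) x unfolding open_real by blast
    have "x + e / 2 \<in> \<omega>" "x - e / 2 \<in> \<omega>" using e(1) by (auto intro!: e(2))
    then have "x + e / 2 \<le> Sup \<omega>" "Inf \<omega> \<le> x - e / 2"
      using bdd by (auto intro: cSup_upper cInf_lower)
    then show ?thesis using e(1) by linarith
  qed
  have conv: "x \<in> \<omega>" if x: "Inf \<omega> < x" "x < Sup \<omega>" for x
  proof (cases "x \<ge> 0")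
    case True
    obtain y where "y \<in> \<omega>" "x < y" using less_cSup_iff[OF ne bdd(1)] x(2) by blast
    then show ?thesis
      using assms(4)[of y] True by (auto simp: closed_segment_eq_real_ivl split: if_splits)
  next
    case False
    obtain y where "y \<in> \<omega>" "y < x" using cInf_less_iff[OF ne bdd(2)] x(1) by blast
    then show ?thesis
      using assms(4)[of y] False by (auto simp: closed_segment_eq_real_ivl split: if_splits)
  qed
  have "\<omega> = {- (- Inf \<omega>)<..<Sup \<omega>}" using lt conv by auto
  moreover have "- Inf \<omega> > 0" "Sup \<omega> > 0" using lt[OF assms(3)] by auto
  ultimately show ?thesis using that by blast
qed

lemma cutoff_function:
  fixes A B :: real
  assumes "A > 0" "B > 0"
  obtains \<eta> :: "real \<Rightarrow> real" and M :: real where "M > 0" "smooth \<eta>" "\<And>x. 0 \<le> \<eta> x" "\<And>x. \<eta> x \<le> 1"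
    "\<And>x. \<bar>gradient \<eta> x\<bar> \<le> M" "\<And>x. - A / 2 \<le> x \<Longrightarrow> x \<le> B / 2 \<Longrightarrow> \<eta> x = 1"
    "\<And>x. x \<notin> {- (3 * A / 4)..3 * B / 4} \<Longrightarrow> \<eta> x = 0"
proof -
  \<comment> \<open>The first factor rises between \<open>- 3 * A / 4\<close> and
    \<open>- A / 2\<close>, the second falls between \<open>B / 2\<close> and
    \<open>3 * B / 4\<close>. The remaining quarters keep the support away from the ends.\<close>
  define \<eta> where "\<eta> x = smooth_step (4 * x / A + 3) * smooth_step (3 - 4 * x / B)" for x
  have 1: "smooth (\<lambda>x. smooth_step (4 * x / A + 3))"
    by (rule smooth_compose_affine[OF smooth_smooth_step, of _ "\<lambda>h. 4 * h / A"])
       (use assms in \<open>auto intro!: derivative_eq_intros\<close>)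
  have 2: "smooth (\<lambda>x. smooth_step (3 - 4 * x / B))"
    by (rule smooth_compose_affine[OF smooth_smooth_step, of _ "\<lambda>h. - (4 * h / B)"])
       (use assms in \<open>auto intro!: derivative_eq_intros\<close>)
  have s: "smooth \<eta>" unfolding \<eta>_def[abs_def] by (intro smooth_mult 1 2)
  have 01: "0 \<le> \<eta> x" "\<eta> x \<le> 1" for x
    using smooth_step(1,2) by (auto simp: \<eta>_def intro!: mult_le_one)
  have one: "\<eta> x = 1" if "- A / 2 \<le> x" "x \<le> B / 2" for x
  proof -
    have "4 * x / A + 3 \<ge> 1" "3 - 4 * x / B \<ge> 1" using that assms by (auto simp: field_simps)
    then show ?thesis by (simp add: \<eta>_def smooth_step)
  qed
  have zero: "\<eta> x = 0" if "x \<notin> {- (3 * A / 4)..3 * B / 4}" for x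
  proof -
    have "4 * x / A + 3 \<le> 0 \<or> 3 - 4 * x / B \<le> 0" using that assms by (auto simp: field_simps)
    then show ?thesis by (auto simp: \<eta>_def smooth_step)
  qed
  have g0: "gradient \<eta> x = 0" if "x \<notin> {- (3 * A / 4)..3 * B / 4}" for x
    by (rule gradient_eq_0_open[of "- {- (3 * A / 4)..3 * B / 4}"]) (use that zero in \<open>auto simp: open_Compl\<close>)
  obtain M where "M \<ge> 0" "\<And>x. norm (gradient \<eta> x) \<le> M"
    using compact_support_bounded[OF smooth_continuous_gradient[OF s] compact_Icc g0] by blast
  then have "max M 1 > 0" "\<And>x. \<bar>gradient \<eta> x\<bar> \<le> max M 1" by (auto simp: le_max_iff_disj)
  then show ?thesis using that s 01 one zero by blast
qed

lemma integral_lebesgue_on_mono_set: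
  fixes h :: "'a::euclidean_space \<Rightarrow> real"
  assumes "integrable (lebesgue_on S) h" "T \<subseteq> S" "S \<in> sets lebesgue" "T \<in> sets lebesgue" "\<And>x. h x \<ge> 0"
  shows "(LINT x|lebesgue_on T. h x) \<le> (LINT x|lebesgue_on S. h x)"
proof -
  have "integrable (lebesgue_on T) h" by (rule integrable_lebesgue_on_subset[OF assms(1-4)])
  then have "integrable lebesgue (\<lambda>x. indicator T x *\<^sub>R h x)" "integrable lebesgue (\<lambda>x. indicator S x *\<^sub>R h x)"
    using assms by (auto simp: integrable_restrict_space)
  then have "(LINT x|lebesgue. indicator T x *\<^sub>R h x) \<le> (LINT x|lebesgue. indicator S x *\<^sub>R h x)"
    by (rule integral_mono) (use assms(2,5) in \<open>auto simp: indicator_def\<close>)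
  then show ?thesis using assms by (simp add: integral_restrict_space)
qed

lemma Lp_subset:
  assumes "u \<in> Lp S q" "T \<subseteq> S" "S \<in> sets lebesgue" "T \<in> sets lebesgue"
  shows "u \<in> Lp T q"
  unfolding Lp_def mem_Collect_eq
  using measurable_restrict_mono[OF Lp_D(1)[OF assms(1)] assms(2)]
    integrable_lebesgue_on_subset[OF Lp_D(2)[OF assms(1)] assms(2-4)] by blast

context cylinder_problem
begin

lemma slice_gradient_Lp:
  fixes g :: "'a \<Rightarrow> 'a"
  assumes "a \<le> b" "g \<in> Lp W q"
  shows "(\<lambda>X. (0 :: real, g (snd X))) \<in> Lp (strip a b) q"
    and "(LINT X|lebesgue_on (strip a b). norm (g (snd X)) powr q) = (b - a) * (LINT y|lebesgue_on W. norm (g y) powr q)"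
proof -
  have "integrable (lebesgue_on W) g" using W_Lp_integrable[OF assms(2)] q by simp
  from borel_measurable_integrable[OF integrable_strip_Pair[OF W assms(1) this]]
  show "(\<lambda>X. (0 :: real, g (snd X))) \<in> Lp (strip a b) q"
    using Fubini_strip_snd(1)[OF W assms(1) Lp_D(2)[OF assms(2)]] by (auto simp: Lp_def norm_Pair)
  show "(LINT X|lebesgue_on (strip a b). norm (g (snd X)) powr q) = (b - a) * (LINT y|lebesgue_on W. norm (g y) powr q)"
    by (rule Fubini_strip_snd(2)[OF W assms(1) Lp_D(2)[OF assms(2)]])
qed

text \<open>The error budget for fixed \<open>l\<close>: \<epsilon> at most \<open>l\<close> serves
  the linear gradient bound, while the other two conditions keep both comparison errors within the
  target rate. The slice error is weighted by the length \<open>l * (A + B)\<close> because it is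
  integrated along the strip. \<open>Q0\<close> is the only bound required to be uniform in
  \<open>l\<close>.\<close>

definition near_minimizers :: "real \<Rightarrow> real \<Rightarrow> real \<Rightarrow> real \<Rightarrow> (real \<times> 'a \<Rightarrow> real) \<Rightarrow> ('a \<Rightarrow> real) \<Rightarrow> bool" where
  "near_minimizers A B Q0 l \<phi> \<psi> \<longleftrightarrow>
     \<phi> \<in> test_functions (strip (- (l * A)) (l * B)) \<and> \<psi> \<in> test_functions W \<and>
     (LINT y|lebesgue_on W. norm (gradient \<psi> y) powr q) \<le> Q0 \<and>
     (\<exists>\<epsilon> \<epsilon>'. 0 \<le> \<epsilon> \<and> \<epsilon> \<le> l \<and> \<epsilon> \<le> l powr (- 1 / (q - 1)) \<and> l * (A + B) * \<epsilon>' \<le> l powr (- 1 / (q - 1)) \<and>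
       (\<forall>\<zeta>\<in>test_functions (strip (- (l * A)) (l * B)).
          E_strip (- (l * A)) (l * B) \<phi> \<le> E_strip (- (l * A)) (l * B) \<zeta> + \<epsilon>) \<and>
       (\<forall>\<zeta>\<in>test_functions W. E_slice \<psi> \<le> E_slice \<zeta> + \<epsilon>'))"

text \<open>With Young weight \<open>\<kappa> / l\<close> and cutoff slope \<open>M / l\<close> the
  powers of \<open>l\<close> cancel in the coefficient of \<open>Y\<close>, so a fixed \<kappa>
  absorbs it. The other term is \<open>l powr (- (q / (q - 1)))\<close> times a quantity of order
  \<open>l\<close>.\<close>

lemma near_minimizers_rate:
  fixes A B Q0 :: real
  assumes A: "A > 0" and B: "B > 0" and Q0: "Q0 \<ge> 0"
  obtains K where "K > 0"
    "\<And>l \<phi> \<psi>. l > 0 \<Longrightarrow> near_minimizers A B Q0 l \<phi> \<psi> \<Longrightarrow>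
      (LINT X|lebesgue_on (strip (- (l / 2 * A)) (l / 2 * B)). norm (gradient \<phi> X - (0, gradient \<psi> (snd X))) powr q)
      \<le> K * l powr (- 1 / (q - 1))"
proof -
  obtain \<eta> M where \<eta>: "M > 0" "smooth \<eta>" "\<And>x. 0 \<le> \<eta> x" "\<And>x. \<eta> x \<le> 1"
    "\<And>x. \<bar>gradient \<eta> x\<bar> \<le> M" "\<And>x. - A / 2 \<le> x \<Longrightarrow> x \<le> B / 2 \<Longrightarrow> \<eta> x = 1"
    "\<And>x. x \<notin> {- (3 * A / 4)..3 * B / 4} \<Longrightarrow> \<eta> x = 0"
    using cutoff_function[OF A B] by metis
  obtain C1 where C1: "C1 > 0"
    "\<And>a b \<epsilon> \<phi>. \<lbrakk>a \<le> b; \<phi> \<in> test_functions (strip a b); E_strip a b \<phi> \<le> \<epsilon>; \<epsilon> \<ge> 0\<rbrakk> \<Longrightarrow>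
      (LINT X|lebesgue_on (strip a b). norm (gradient \<phi> X) powr q) \<le> C1 * (b - a + \<epsilon>)"
    using strip_gradient_bound by metis
  define C2 where "C2 = cutoff_const"
  have C2: "C2 > 0" by (simp add: C2_def cutoff_const_pos)
  \<comment> \<open>\<kappa> is chosen to make the coefficient of \<open>Y\<close> on the right
    equal to half of \<alpha>.\<close>
  define \<kappa> where "\<kappa> = (2 * C2 * M powr q / \<alpha>) powr (1 / q)"
  have \<kappa>: "\<kappa> > 0" using C2 \<eta>(1) \<alpha> by (simp add: \<kappa>_def)
  have \<kappa>q: "C2 * (\<kappa> powr (- q) * M powr q) = \<alpha> / 2"
    using C2 \<eta>(1) \<alpha> q0 by (simp add: \<kappa>_def powr_powr powr_minus field_simps)
  define H where "H = A + B"
  have H: "H > 0" using A B by (simp add: H_def)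
  \<comment> \<open>The gradients contribute at most \<open>U * l\<close>: the first summand stems
    from \<phi>, where \<open>H + 1\<close> uses \<open>\<epsilon> \<le> l\<close>, and the second
    from \<psi>.\<close>
  define U where "U = C1 * (H + 1) + H * Q0"
  have U: "U > 0" using C1(1) H Q0 by (simp add: U_def add_pos_nonneg)
  define K1 where "K1 = 2 / \<alpha> * (2 + C2 * \<kappa> powr (q / (q - 1)) * ((1 + M powr q * 2 powr q) * U))"
  have K1: "K1 > 0"
    using \<alpha> C2 U unfolding K1_def by (intro mult_pos_pos divide_pos_pos add_pos_nonneg mult_nonneg_nonneg) auto
  have main: "(LINT X|lebesgue_on (strip (- (l / 2 * A)) (l / 2 * B)). norm (gradient \<phi> X - (0, gradient \<psi> (snd X))) powr q)
      \<le> (K1 + 2 powr q * U) * l powr (- 1 / (q - 1))"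
    if l: "l > 0" and near: "near_minimizers A B Q0 l \<phi> \<psi>" for l \<phi> \<psi>
  proof -
    have \<phi>: "\<phi> \<in> test_functions (strip (- (l * A)) (l * B))" and \<psi>: "\<psi> \<in> test_functions W"
      and Q: "(LINT y|lebesgue_on W. norm (gradient \<psi> y) powr q) \<le> Q0"
      using near by (auto simp: near_minimizers_def)
    obtain \<epsilon> \<epsilon>' where \<epsilon>: "0 \<le> \<epsilon>" "\<epsilon> \<le> l" "\<epsilon> \<le> l powr (- 1 / (q - 1))" and \<epsilon>': "l * (A + B) * \<epsilon>' \<le> l powr (- 1 / (q - 1))"
      and E\<phi>: "\<And>\<zeta>. \<zeta> \<in> test_functions (strip (- (l * A)) (l * B)) \<Longrightarrow>
         E_strip (- (l * A)) (l * B) \<phi> \<le> E_strip (- (l * A)) (l * B) \<zeta> + \<epsilon>"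
      and E\<psi>: "\<And>\<zeta>. \<zeta> \<in> test_functions W \<Longrightarrow> E_slice \<psi> \<le> E_slice \<zeta> + \<epsilon>'"
      using near unfolding near_minimizers_def by blast
    define a b where "a = - (l * A)" and "b = l * B"
    let ?S = "strip a b" and ?T = "strip (- (l / 2 * A)) (l / 2 * B)"
    define \<theta> where "\<theta> = l powr (- 1 / (q - 1))"
    have \<theta>: "\<theta> > 0" using l by (simp add: \<theta>_def)
    have lAB: "0 < l * A" "0 < l * B" using l A B by auto
    then have ab: "a < b" "a \<le> b" unfolding a_def b_def by linarith+
    have ba: "b - a = l * H" by (simp add: a_def b_def H_def algebra_simps)
    have TS: "?T \<subseteq> ?S" using lAB by (auto simp: a_def b_def)
    define P where "P = (LINT X|lebesgue_on ?S. norm (gradient \<phi> X) powr q)"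
    define G where "G X = norm (gradient \<phi> X - (0, gradient \<psi> (snd X))) powr q" for X
    define \<eta>l where "\<eta>l x = \<eta> (x / l)" for x
    define Y where "Y = (LINT X|lebesgue_on ?S. (\<eta>l (fst X))\<^sup>2 * G X)"
    define QQ where "QQ = (LINT y|lebesgue_on W. norm (gradient \<psi> y) powr q)"
    have \<phi>': "\<phi> \<in> test_functions ?S" using \<phi> by (simp add: a_def b_def)
    have E\<phi>': "E_strip a b \<phi> \<le> E_strip a b \<zeta> + \<epsilon>" if "\<zeta> \<in> test_functions ?S" for \<zeta>
      using E\<phi> that by (simp add: a_def b_def)
    have "E_strip a b (\<lambda>X. 0) = 0"
      using E_strip_test_function(2)[OF ab(2) zero_test_function] by simp
    then have "E_strip a b \<phi> \<le> \<epsilon>" using E\<phi>'[OF zero_test_function] by simp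
    from C1(2)[OF ab(2) \<phi>' this \<epsilon>(1)] have "P \<le> C1 * (l * H + \<epsilon>)" by (simp add: P_def ba)
    also have "\<dots> \<le> C1 * ((H + 1) * l)" using C1(1) \<epsilon>(2) by (intro mult_left_mono) (auto simp: algebra_simps)
    finally have PC: "P \<le> C1 * ((H + 1) * l)" .
    have "l * H * QQ \<le> l * H * Q0"
      using Q l H by (intro mult_left_mono) (auto simp: QQ_def)
    with PC have PU: "P + (b - a) * QQ \<le> U * l"
      by (simp add: U_def ba algebra_simps)
    note Lp\<phi> = test_functions_Lp(2)[OF open_strip \<phi>' q0]
    note Lp\<psi> = slice_gradient_Lp[OF ab(2) test_functions_Lp(2)[OF W \<psi> q0]]
    have iG: "integrable (lebesgue_on ?S) G"
      unfolding G_def[abs_def] by (rule Lp_diff_integrable[OF Lp\<phi> Lp\<psi>(1)]) (use q in simp)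
    have G0: "G X \<ge> 0" for X by (simp add: G_def)
    have GZ: "(LINT X|lebesgue_on ?S. G X) \<le> 2 powr q * (U * l)"
    proof -
      have i1: "integrable (lebesgue_on ?S) (\<lambda>X. norm (gradient \<phi> X) powr q)" by (rule Lp_D(2)[OF Lp\<phi>])
      have i2: "integrable (lebesgue_on ?S) (\<lambda>X. norm (gradient \<psi> (snd X)) powr q)"
        using Lp_D(2)[OF Lp\<psi>(1)] by (simp add: norm_Pair)
      have "(LINT X|lebesgue_on ?S. G X) \<le>
          (LINT X|lebesgue_on ?S. 2 powr q * (norm (gradient \<phi> X) powr q + norm (gradient \<psi> (snd X)) powr q))"
      proof (rule integral_mono[OF iG])
        show "integrable (lebesgue_on ?S) (\<lambda>X. 2 powr q * (norm (gradient \<phi> X) powr q + norm (gradient \<psi> (snd X)) powr q))"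
          by (intro integrable_mult_right Bochner_Integration.integrable_add i1 i2)
        show "G X \<le> 2 powr q * (norm (gradient \<phi> X) powr q + norm (gradient \<psi> (snd X)) powr q)" for X
          using norm_diff_powr_le[of q "gradient \<phi> X" "(0, gradient \<psi> (snd X))"] q
          by (simp add: G_def norm_Pair)
      qed
      also have "\<dots> = 2 powr q * (P + (b - a) * QQ)"
        using i1 i2 Lp\<psi>(2) by (simp add: P_def QQ_def)
      also have "\<dots> \<le> 2 powr q * (U * l)" using PU by (intro mult_left_mono) auto
      finally show ?thesis .
    qed
    have S_sets: "?S \<in> sets lebesgue" "?T \<in> sets lebesgue" using open_strip by auto
    have goal_le_S: "(LINT X|lebesgue_on ?T. G X) \<le> (LINT X|lebesgue_on ?S. G X)"
      by (rule integral_lebesgue_on_mono_set[OF iG TS S_sets G0])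
    have "(LINT X|lebesgue_on ?T. G X) \<le> (K1 + 2 powr q * U) * \<theta>"
    proof (cases "l < 1")
      case True
      \<comment> \<open>For \<open>l < 1\<close> a smaller exponent gives a larger power, and
        \<open>- 1 / (q - 1)\<close> is at most 1.\<close>
      have "l \<le> \<theta>"
      proof -
        have "l powr 1 \<le> l powr (- 1 / (q - 1))"
          using True l q by (intro powr_mono') (auto simp: divide_le_0_iff intro: order.trans[of _ 0])
        then show ?thesis using l by (simp add: \<theta>_def)
      qed
      then have "2 powr q * (U * l) \<le> 2 powr q * (U * \<theta>)" using U by (intro mult_left_mono) auto
      also have "\<dots> \<le> (K1 + 2 powr q * U) * \<theta>"
        using K1 \<theta> by (simp add: algebra_simps)
      finally show ?thesis using goal_le_S GZ by linarith
    next
      case False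
      then have l1: "l \<ge> 1" by simp
      have \<eta>ls: "smooth \<eta>l" unfolding \<eta>l_def[abs_def]
        by (rule smooth_compose_affine[OF \<eta>(2), of _ "\<lambda>h. h / l"]) (use l in \<open>auto intro!: derivative_eq_intros\<close>)
      have \<eta>l_grad: "\<bar>gradient \<eta>l x\<bar> \<le> M / l" for x
      proof -
        have 1: "((\<lambda>x. x / l) has_derivative (\<lambda>h. h / l)) (at x)"
          using l by (auto intro!: derivative_eq_intros)
        have "gradient \<eta>l x = gradient \<eta> (x / l) / l"
          unfolding \<eta>l_def[abs_def]
          by (rule gradient_eqI, rule has_derivative_eq_rhs[OF has_derivative_compose[OF 1 smooth_has_gradient[OF \<eta>(2)]]]) auto
        then show ?thesis using \<eta>(5)[of "x / l"] l by (simp add: divide_right_mono)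
      qed
      have \<eta>l0: "\<eta>l x = 0" if "x \<notin> {- (3 * A / 4) * l..3 * B / 4 * l}" for x
        unfolding \<eta>l_def by (rule \<eta>(7)) (use that l in \<open>auto simp: field_simps\<close>)
      have \<eta>l1: "\<eta>l x = 1" if "x \<in> {- (l / 2 * A)<..<l / 2 * B}" for x
        unfolding \<eta>l_def by (rule \<eta>(6)) (use that l in \<open>auto simp: field_simps\<close>)
      have cd: "a < - (3 * A / 4) * l" "- (3 * A / 4) * l \<le> 3 * B / 4 * l" "3 * B / 4 * l < b"
        using l A B by (auto simp: a_def b_def intro: order.trans[of _ 0])
      have s: "\<kappa> / l > 0" using \<kappa> l by simp
      have iY: "integrable (lebesgue_on ?S) (\<lambda>X. (\<eta>l (fst X))\<^sup>2 * G X)"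
      proof (rule Bochner_Integration.integrable_bound[OF iG])
        have [measurable]: "G \<in> borel_measurable (lebesgue_on ?S)" using iG by (rule borel_measurable_integrable)
        have "continuous_on ?S (\<lambda>X. \<eta>l (fst X))" by (intro smooth_continuous smooth_compose_fst \<eta>ls)
        from continuous_imp_measurable_on_sets_lebesgue[OF this S_sets(1)]
        have [measurable]: "(\<lambda>X. \<eta>l (fst X)) \<in> borel_measurable (lebesgue_on ?S)" .
        show "(\<lambda>X. (\<eta>l (fst X))\<^sup>2 * G X) \<in> borel_measurable (lebesgue_on ?S)" by measurable
        show "AE X in lebesgue_on ?S. norm ((\<eta>l (fst X))\<^sup>2 * G X) \<le> norm (G X)"
          using G0 \<eta>(3,4) by (intro AE_I2) (auto simp: abs_mult \<eta>l_def power_le_one intro!: mult_left_le_one_le)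
      qed
      have YG: "Y \<le> 2 powr q * (U * l)"
      proof -
        have "Y \<le> (LINT X|lebesgue_on ?S. G X)"
          unfolding Y_def using G0 \<eta>(3,4)
          by (intro integral_mono[OF iY iG]) (auto simp: \<eta>l_def power_le_one intro!: mult_left_le_one_le)
        then show ?thesis using GZ by linarith
      qed
      have Y0: "Y \<ge> 0" unfolding Y_def by (rule integral_nonneg_AE) (use G0 in auto)
      have goal_le_Y: "(LINT X|lebesgue_on ?T. G X) \<le> Y"
      proof -
        have "(LINT X|lebesgue_on ?T. G X) = (LINT X|lebesgue_on ?T. (\<eta>l (fst X))\<^sup>2 * G X)"
          using \<eta>l1 S_sets(2)
          by (intro Bochner_Integration.integral_cong) (auto simp: space_restrict_space)
        also have "\<dots> \<le> Y"
          unfolding Y_def by (rule integral_lebesgue_on_mono_set[OF iY TS S_sets]) (use G0 in auto)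
        finally show ?thesis .
      qed
      have "\<alpha> * Y \<le> \<epsilon> + (b - a) * \<epsilon>' + C2 * ((\<kappa> / l) powr (- q) * ((M / l) powr q * Y)
         + (\<kappa> / l) powr (q / (q - 1)) * (P + (b - a) * QQ + (M / l) powr q * Y))"
        unfolding C2_def
        by (rule cutoff_estimate[OF cd \<eta>ls _ _ \<eta>l_grad \<eta>l0 \<phi>' \<psi> E\<phi>' E\<psi> s])
           (auto simp: \<eta>l_def \<eta>(3,4) Y_def P_def QQ_def G_def)
      also have "C2 * ((\<kappa> / l) powr (- q) * ((M / l) powr q * Y)
         + (\<kappa> / l) powr (q / (q - 1)) * (P + (b - a) * QQ + (M / l) powr q * Y))
         \<le> \<alpha> / 2 * Y + C2 * \<kappa> powr (q / (q - 1)) * ((1 + M powr q * 2 powr q) * U) * \<theta>"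
      proof -
        have e1: "(\<kappa> / l) powr (- q) * ((M / l) powr q * Y) = \<kappa> powr (- q) * M powr q * Y"
          using \<kappa> l \<eta>(1) by (simp add: powr_divide powr_minus field_simps)
        \<comment> \<open>Here \<open>l \<ge> 1\<close> is used in the form
          \<open>M / l \<le> M\<close>, together with the linear bound already known for
          \<open>Y\<close>.\<close>
        have e2: "P + (b - a) * QQ + (M / l) powr q * Y \<le> (1 + M powr q * 2 powr q) * U * l"
        proof -
          have "(M / l) powr q * Y \<le> M powr q * (2 powr q * (U * l))"
            using YG Y0 l1 \<eta>(1) q0 by (intro mult_mono powr_mono2) (auto simp: divide_le_eq)
          then show ?thesis using PU by (simp add: algebra_simps)
        qed
        have e3: "(\<kappa> / l) powr (q / (q - 1)) * l = \<kappa> powr (q / (q - 1)) * \<theta>"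
        proof -
          have "- (q / (q - 1)) + 1 = - 1 / (q - 1)" using q by (simp add: field_simps)
          then have "l powr (- (q / (q - 1))) * l = \<theta>"
            using powr_add[of l "- (q / (q - 1))" 1] l by (simp add: \<theta>_def)
          moreover have "(\<kappa> / l) powr (q / (q - 1)) = \<kappa> powr (q / (q - 1)) * l powr (- (q / (q - 1)))"
            using \<kappa> l by (simp add: powr_divide powr_minus field_simps)
          ultimately show ?thesis by (simp only: mult.assoc)
        qed
        have "(\<kappa> / l) powr (q / (q - 1)) * (P + (b - a) * QQ + (M / l) powr q * Y)
            \<le> (\<kappa> / l) powr (q / (q - 1)) * ((1 + M powr q * 2 powr q) * U * l)"
          using e2 by (intro mult_left_mono) auto
        also have "\<dots> = ((1 + M powr q * 2 powr q) * U) * ((\<kappa> / l) powr (q / (q - 1)) * l)" by simp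
        also have "\<dots> = \<kappa> powr (q / (q - 1)) * ((1 + M powr q * 2 powr q) * U) * \<theta>" unfolding e3 by simp
        finally have e4: "(\<kappa> / l) powr (q / (q - 1)) * (P + (b - a) * QQ + (M / l) powr q * Y)
            \<le> \<kappa> powr (q / (q - 1)) * ((1 + M powr q * 2 powr q) * U) * \<theta>" .
        have e5: "C2 * (\<kappa> powr (- q) * M powr q * Y) = \<alpha> / 2 * Y"
          using \<kappa>q by (metis mult.assoc)
        show ?thesis
          unfolding e1 distrib_left[of C2] e5
          using mult_left_mono[OF e4 less_imp_le[OF C2]] by (simp only: mult.assoc add_le_cancel_left)
      qed
      finally have "\<alpha> / 2 * Y \<le> \<epsilon> + (b - a) * \<epsilon>' + C2 * \<kappa> powr (q / (q - 1)) * ((1 + M powr q * 2 powr q) * U) * \<theta>"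
        by simp
      also have "\<dots> \<le> (2 + C2 * \<kappa> powr (q / (q - 1)) * ((1 + M powr q * 2 powr q) * U)) * \<theta>"
        using \<epsilon>(3) \<epsilon>' by (simp add: ba H_def \<theta>_def distrib_right)
      finally have "Y \<le> K1 * \<theta>"
        using \<alpha> by (simp add: K1_def field_simps)
      also have "\<dots> \<le> (K1 + 2 powr q * U) * \<theta>"
        using U \<theta> by (simp add: distrib_right)
      finally show ?thesis using goal_le_Y by linarith
    qed
    then show ?thesis by (simp add: G_def \<theta>_def)
  qed
  have "K1 + 2 powr q * U > 0" using K1 U by (simp add: add_pos_pos)
  then show ?thesis by (rule that) (rule main)
qed

end

theorem theorem1p3:
  fixes \<omega>\<^sub>1 :: "real set" and \<omega>\<^sub>2 :: "'a::euclidean_space set"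
    and F :: "real \<times> 'a \<Rightarrow> real" and f :: "'a \<Rightarrow> real"
    and q q' \<alpha> lam Lam :: real
    and u :: "real \<Rightarrow> real \<times> 'a \<Rightarrow> real" and u_inf :: "'a \<Rightarrow> real"
  assumes "open \<omega>\<^sub>1" and "bounded \<omega>\<^sub>1"
    and "0 \<in> \<omega>\<^sub>1" and "\<And>x. x \<in> \<omega>\<^sub>1 \<Longrightarrow> closed_segment 0 x \<subseteq> \<omega>\<^sub>1"
    and "open \<omega>\<^sub>2" and "bounded \<omega>\<^sub>2"
    and "q \<ge> 2" and "1 / q + 1 / q' = 1"
    and "\<alpha> > 0" and "lam > 0" and "Lam > 0"
    and "\<And>\<xi> \<eta>. 2 * F ((1 / 2) *\<^sub>R (\<xi> + \<eta>)) + \<alpha> * norm (\<xi> - \<eta>) powr q \<le> F \<xi> + F \<eta>"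
    and "\<And>\<xi>. lam * norm \<xi> powr q \<le> F \<xi>"
    and "\<And>\<xi>. F \<xi> \<le> Lam * norm \<xi> powr q"
    and "f \<in> Lp \<omega>\<^sub>2 q'"
    and "\<And>l. l > 0 \<Longrightarrow>
      is_arg_min (energy (cylinder \<omega>\<^sub>1 \<omega>\<^sub>2 l) F (\<lambda>X. f (snd X)))
        (\<lambda>v. v \<in> W1_0 (cylinder \<omega>\<^sub>1 \<omega>\<^sub>2 l) q) (u l)"
    and "is_arg_min (energy \<omega>\<^sub>2 (\<lambda>\<xi>\<^sub>2. F (0, \<xi>\<^sub>2)) f) (\<lambda>v. v \<in> W1_0 \<omega>\<^sub>2 q) u_inf"
  shows "\<exists>A>0. \<forall>l>0.
    (LINT X|lebesgue_on (cylinder \<omega>\<^sub>1 \<omega>\<^sub>2 (l / 2)).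
       norm (weak_gradient (cylinder \<omega>\<^sub>1 \<omega>\<^sub>2 (l / 2)) (\<lambda>X. u l X - u_inf (snd X)) X) powr q)
    \<le> A / l powr (1 / (q - 1))"
proof -
  obtain A B where AB: "A > 0" "B > 0" and \<omega>\<^sub>1: "\<omega>\<^sub>1 = {- A<..<B}"
    using starshaped_open_interval[OF assms(1-4)] by metis
  obtain R where R: "R > 0" "\<And>y. y \<in> \<omega>\<^sub>2 \<Longrightarrow> norm y \<le> R"
    using assms(6) unfolding bounded_pos by blast
  interpret cylinder_problem F q \<alpha> lam Lam \<omega>\<^sub>2 f q' R
    by unfold_locales (use assms R in auto)
  have cyl: "cylinder \<omega>\<^sub>1 \<omega>\<^sub>2 l = strip (- (l * A)) (l * B)" if "l > 0" for l
  proof -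
    have "(\<lambda>x. l * x) ` {- A<..<B} = {- (l * A)<..<l * B}"
    proof (intro equalityI subsetI)
      fix x assume "x \<in> {- (l * A)<..<l * B}"
      then have "x / l \<in> {- A<..<B}" "x = l * (x / l)"
        using that by (auto simp: field_simps)
      then show "x \<in> (\<lambda>x. l * x) ` {- A<..<B}" by blast
    next
      fix x assume "x \<in> (\<lambda>x. l * x) ` {- A<..<B}"
      then obtain y where "x = l * y" "y \<in> {- A<..<B}" by blast
      then show "x \<in> {- (l * A)<..<l * B}"
        using that mult_strict_left_mono[of "- A" y l] by simp
    qed
    then show ?thesis by (simp add: cylinder_def \<omega>\<^sub>1)
  qed
  have u: "u l \<in> W1_0 (strip (- (l * A)) (l * B)) q"
    "\<And>v. v \<in> W1_0 (strip (- (l * A)) (l * B)) q \<Longrightarrow> E_strip (- (l * A)) (l * B) (u l) \<le> E_strip (- (l * A)) (l * B) v"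
    if "l > 0" for l
    using assms(16)[OF that] by (auto simp: is_arg_min_def cyl[OF that] not_less)
  have u_inf: "u_inf \<in> W1_0 \<omega>\<^sub>2 q" "\<And>v. v \<in> W1_0 \<omega>\<^sub>2 q \<Longrightarrow> E_slice u_inf \<le> E_slice v"
    using assms(17) by (auto simp: is_arg_min_def not_less)
  obtain g_inf where g_inf: "g_inf \<in> Lp \<omega>\<^sub>2 q" "has_weak_gradient \<omega>\<^sub>2 u_inf g_inf" and u_inf_Lp: "u_inf \<in> Lp \<omega>\<^sub>2 q"
    using u_inf(1) by (auto simp: W1_0_def W1_def)
  \<comment> \<open>The gradient of \<psi> is \<open>g_inf\<close> minus an approximation error
    whose integral is at most 1 by the choice of \<open>\<epsilon>'\<close>; hence this bound does
    not depend on \<open>l\<close>.\<close>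
  define Q0 where "Q0 = 2 powr q * ((LINT y|lebesgue_on \<omega>\<^sub>2. norm (g_inf y) powr q) + 1)"
  have Q0: "Q0 \<ge> 0" by (simp add: Q0_def add_nonneg_nonneg)
  obtain K where K: "K > 0"
    "\<And>l \<phi> \<psi>. l > 0 \<Longrightarrow> near_minimizers A B Q0 l \<phi> \<psi> \<Longrightarrow>
      (LINT X|lebesgue_on (strip (- (l / 2 * A)) (l / 2 * B)). norm (gradient \<phi> X - (0, gradient \<psi> (snd X))) powr q)
      \<le> K * l powr (- 1 / (q - 1))"
    using near_minimizers_rate[OF AB Q0] by blast
  define K' where "K' = 2 powr q * (K + 2 powr q * 2)"
  have K': "K' > 0" unfolding K'_def using K(1) by (intro mult_pos_pos add_pos_pos) auto
  have "(LINT X|lebesgue_on (cylinder \<omega>\<^sub>1 \<omega>\<^sub>2 (l / 2)).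
       norm (weak_gradient (cylinder \<omega>\<^sub>1 \<omega>\<^sub>2 (l / 2)) (\<lambda>X. u l X - u_inf (snd X)) X) powr q)
    \<le> K' / l powr (1 / (q - 1))" if l: "l > 0" for l
  proof -
    let ?S = "strip (- (l * A)) (l * B)" and ?T = "strip (- (l / 2 * A)) (l / 2 * B)"
    define \<theta> where "\<theta> = l powr (- 1 / (q - 1))"
    \<comment> \<open>Both errors may depend on \<open>l\<close>. They are taken below the rate
      \<theta>, the slice error after multiplication by the length of the strip.\<close>
    define \<epsilon> where "\<epsilon> = min l \<theta>"
    define \<epsilon>' where "\<epsilon>' = min 1 (\<theta> / (l * (A + B)))"
    have H: "l * (A + B) > 0" using l AB by simp
    have \<theta>: "\<theta> > 0" using l by (simp add: \<theta>_def)
    have \<epsilon>: "\<epsilon> > 0" "\<epsilon> \<le> l" "\<epsilon> \<le> \<theta>" using l \<theta> by (auto simp: \<epsilon>_def)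
    have \<epsilon>': "\<epsilon>' > 0" "\<epsilon>' \<le> 1" "l * (A + B) * \<epsilon>' \<le> \<theta>"
    proof -
      show "\<epsilon>' > 0" "\<epsilon>' \<le> 1" using \<theta> H by (auto simp: \<epsilon>'_def)
      have "l * (A + B) * \<epsilon>' \<le> l * (A + B) * (\<theta> / (l * (A + B)))"
        using H by (intro mult_left_mono) (auto simp: \<epsilon>'_def)
      also have "\<dots> = \<theta>"
        using H by (metis less_irrefl nonzero_mult_div_cancel_left times_divide_eq_right)
      finally show "l * (A + B) * \<epsilon>' \<le> \<theta>" .
    qed
    have lAB: "0 < l * A" "0 < l * B" using l AB by auto
    then have ord: "- (l * A) \<le> l * B" "- (l / 2 * A) < l / 2 * B" by auto
    have TS: "?T \<subseteq> ?S" using lAB by auto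
    have S_sets: "?S \<in> sets lebesgue" "?T \<in> sets lebesgue" using open_strip by auto
    have cyl2: "cylinder \<omega>\<^sub>1 \<omega>\<^sub>2 (l / 2) = ?T" using cyl[of "l / 2"] l by simp
    obtain g where g: "g \<in> Lp ?S q" "has_weak_gradient ?S (u l) g"
      using u(1)[OF l] by (auto simp: W1_0_def W1_def)
    obtain \<phi> where \<phi>: "\<phi> \<in> test_functions ?S"
      "(LINT X|lebesgue_on ?S. norm (g X - gradient \<phi> X) powr q) < \<epsilon>"
      "E_strip (- (l * A)) (l * B) \<phi> < E_strip (- (l * A)) (l * B) (u l) + \<epsilon>"
      by (rule energy_approximation[OF open_strip u(1)[OF l] g f_snd_Lp(1)[OF ord(1)] conjugate \<epsilon>(1)])
    obtain \<psi> where \<psi>: "\<psi> \<in> test_functions \<omega>\<^sub>2"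
      "(LINT y|lebesgue_on \<omega>\<^sub>2. norm (g_inf y - gradient \<psi> y) powr q) < \<epsilon>'"
      "E_slice \<psi> < E_slice u_inf + \<epsilon>'"
      by (rule slice.energy_approximation[OF W u_inf(1) g_inf f conjugate \<epsilon>'(1)])
    note Lp\<phi> = test_functions_Lp(2)[OF open_strip \<phi>(1) q0]
    note Lp\<psi> = test_functions_Lp(2)[OF W \<psi>(1) q0]
    have Q\<psi>: "(LINT y|lebesgue_on \<omega>\<^sub>2. norm (gradient \<psi> y) powr q) \<le> Q0"
    proof -
      have i: "integrable (lebesgue_on \<omega>\<^sub>2) (\<lambda>y. norm (g_inf y - gradient \<psi> y) powr q)"
        by (rule Lp_diff_integrable[OF g_inf(1) Lp\<psi>]) (use q in simp)
      note i' = Lp_D(2)[OF g_inf(1)]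
      have "(LINT y|lebesgue_on \<omega>\<^sub>2. norm (gradient \<psi> y) powr q) \<le>
          (LINT y|lebesgue_on \<omega>\<^sub>2. 2 powr q * (norm (g_inf y) powr q + norm (g_inf y - gradient \<psi> y) powr q))"
      proof (rule integral_mono[OF Lp_D(2)[OF Lp\<psi>]])
        show "integrable (lebesgue_on \<omega>\<^sub>2) (\<lambda>y. 2 powr q * (norm (g_inf y) powr q + norm (g_inf y - gradient \<psi> y) powr q))"
          by (intro integrable_mult_right Bochner_Integration.integrable_add i i')
        show "norm (gradient \<psi> y) powr q \<le> 2 powr q * (norm (g_inf y) powr q + norm (g_inf y - gradient \<psi> y) powr q)" for y
          using norm_diff_powr_le[of q "g_inf y" "g_inf y - gradient \<psi> y"] q by simp
      qed
      also have "\<dots> = 2 powr q * ((LINT y|lebesgue_on \<omega>\<^sub>2. norm (g_inf y) powr q)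
          + (LINT y|lebesgue_on \<omega>\<^sub>2. norm (g_inf y - gradient \<psi> y) powr q))"
        using i i' by simp
      also have "\<dots> \<le> Q0"
        unfolding Q0_def using \<psi>(2) \<epsilon>'(2) by (intro mult_left_mono add_left_mono) auto
      finally show ?thesis .
    qed
    let ?w = "\<lambda>X. gradient \<phi> X - (0, gradient \<psi> (snd X))"
    have "near_minimizers A B Q0 l \<phi> \<psi>"
      unfolding near_minimizers_def
    proof (intro conjI \<phi>(1) \<psi>(1) Q\<psi>, rule exI[of _ \<epsilon>], rule exI[of _ \<epsilon>'], intro conjI ballI \<epsilon>(2))
      show "E_strip (- (l * A)) (l * B) \<phi> \<le> E_strip (- (l * A)) (l * B) \<zeta> + \<epsilon>" if "\<zeta> \<in> test_functions ?S" for \<zeta>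
        using \<phi>(3) u(2)[OF l test_functions_subset_W1_0[OF open_strip that q0]] by linarith
      show "E_slice \<psi> \<le> E_slice \<zeta> + \<epsilon>'" if "\<zeta> \<in> test_functions \<omega>\<^sub>2" for \<zeta>
        using \<psi>(3) u_inf(2)[OF test_functions_subset_W1_0[OF W that q0]] by linarith
      show "0 \<le> \<epsilon>" "\<epsilon> \<le> l powr (- 1 / (q - 1))" "l * (A + B) * \<epsilon>' \<le> l powr (- 1 / (q - 1))"
        using \<epsilon> \<epsilon>'(3) by (simp_all only: \<theta>_def less_imp_le)
    qed
    from K(2)[OF l this] have rate: "(LINT X|lebesgue_on ?T. norm (?w X) powr q) \<le> K * \<theta>"
      by (simp add: \<theta>_def)
    let ?G = "\<lambda>X. g X - (0, g_inf (snd X))"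
    \<comment> \<open>On the half cylinder, restriction gives the weak gradient of
      \<open>u l\<close> and constant extension in X_1 gives that of \<open>u_inf\<close>.\<close>
    have wgT: "has_weak_gradient ?T (\<lambda>X. u l X - u_inf (snd X)) ?G"
    proof (rule has_weak_gradient_diff[OF open_strip])
      show "has_weak_gradient ?T (u l) g"
        by (rule has_weak_gradient_subset[OF open_strip open_strip TS g(2)])
      show "has_weak_gradient ?T (\<lambda>X. u_inf (snd X)) (\<lambda>X. (0, g_inf (snd X)))"
        using W_Lp_integrable[OF u_inf_Lp] W_Lp_integrable[OF g_inf(1)] q
        by (intro has_weak_gradient_compose_snd[OF W ord(2) g_inf(2)]) auto
    qed
    note AE = weak_gradient_AE[OF open_strip wgT]
    have gT: "g \<in> Lp ?T q" by (rule Lp_subset[OF g(1) TS S_sets])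
    note g_infT = slice_gradient_Lp(1)[OF less_imp_le[OF ord(2)] g_inf(1)]
    have [measurable]: "?G \<in> borel_measurable (lebesgue_on ?T)"
      using Lp_D(1)[OF gT] Lp_D(1)[OF g_infT] by (rule borel_measurable_diff)
    have [measurable]: "weak_gradient ?T (\<lambda>X. u l X - u_inf (snd X)) \<in> borel_measurable (lebesgue_on ?T)"
      by (rule borel_measurable_lebesgue_on_AE[OF S_sets(2), of ?G]) (measurable, use AE in \<open>auto elim: eventually_mono\<close>)
    have iw: "integrable (lebesgue_on ?T) (\<lambda>X. norm (?w X) powr q)"
      by (rule Lp_diff_integrable[OF Lp_subset[OF Lp\<phi> TS S_sets] slice_gradient_Lp(1)[OF less_imp_le[OF ord(2)] Lp\<psi>]])
        (use q in simp)
    have iaS: "integrable (lebesgue_on ?S) (\<lambda>X. norm (g X - gradient \<phi> X) powr q)"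
      by (rule Lp_diff_integrable[OF g(1) Lp\<phi>]) (use q in simp)
    note ia = integrable_lebesgue_on_subset[OF iaS TS S_sets]
    have a: "(LINT X|lebesgue_on ?T. norm (g X - gradient \<phi> X) powr q) \<le> \<theta>"
      using integral_lebesgue_on_mono_set[OF iaS TS S_sets] \<phi>(2) \<epsilon>(3) by simp
    have ibW: "integrable (lebesgue_on \<omega>\<^sub>2) (\<lambda>y. norm (g_inf y - gradient \<psi> y) powr q)"
      by (rule Lp_diff_integrable[OF g_inf(1) Lp\<psi>]) (use q in simp)
    note ib = Fubini_strip_snd[OF W less_imp_le[OF ord(2)] ibW]
    have b: "(LINT X|lebesgue_on ?T. norm (g_inf (snd X) - gradient \<psi> (snd X)) powr q) \<le> \<theta>"
    proof -
      have "(LINT X|lebesgue_on ?T. norm (g_inf (snd X) - gradient \<psi> (snd X)) powr q)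
          = l / 2 * (A + B) * (LINT y|lebesgue_on \<omega>\<^sub>2. norm (g_inf y - gradient \<psi> y) powr q)"
        using ib(2) by (simp add: algebra_simps)
      also have "\<dots> \<le> l * (A + B) * \<epsilon>'"
        using \<psi>(2) l AB by (intro mult_mono) auto
      finally show ?thesis using \<epsilon>'(3) by linarith
    qed
    have "(LINT X|lebesgue_on ?T. norm (weak_gradient ?T (\<lambda>X. u l X - u_inf (snd X)) X) powr q) =
        (LINT X|lebesgue_on ?T. norm (?G X) powr q)"
      by (rule integral_cong_AE) (measurable, use AE in \<open>auto elim: eventually_mono\<close>)
    also have "\<dots> \<le> (LINT X|lebesgue_on ?T. 2 powr q * (norm (?w X) powr q +
        2 powr q * (norm (g X - gradient \<phi> X) powr q + norm (g_inf (snd X) - gradient \<psi> (snd X)) powr q)))"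
      (is "_ \<le> ?I")
    proof (rule integral_mono)
      show "integrable (lebesgue_on ?T) (\<lambda>X. norm (?G X) powr q)"
        by (rule Lp_diff_integrable[OF gT g_infT]) (use q in simp)
      show "norm (?G X) powr q \<le> 2 powr q * (norm (?w X) powr q +
        2 powr q * (norm (g X - gradient \<phi> X) powr q + norm (g_inf (snd X) - gradient \<psi> (snd X)) powr q))" for X
      proof -
        \<comment> \<open>The weak gradient of \<open>u l - u_inf\<close> is the gradient difference
          of the near minimizers plus the two approximation errors. Splitting the power twice costs
          \<open>2 powr q\<close> each time, which explains \<open>K'\<close>.\<close>
        let ?a = "g X - gradient \<phi> X" and ?b = "(0 :: real, g_inf (snd X) - gradient \<psi> (snd X))"
        have e: "?w X + (?a - ?b) = ?G X" by (simp add: prod_eq_iff)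
        have "norm (?G X) powr q \<le> 2 powr q * (norm (?w X) powr q + norm (?a - ?b) powr q)"
          using norm_add_powr_le[OF less_imp_le[OF q0], of "?w X" "?a - ?b"] unfolding e .
        also have "\<dots> \<le> 2 powr q * (norm (?w X) powr q + 2 powr q * (norm ?a powr q + norm ?b powr q))"
          using q by (intro mult_left_mono add_left_mono norm_diff_powr_le) auto
        finally show ?thesis by (simp add: norm_Pair)
      qed
      show "integrable (lebesgue_on ?T) (\<lambda>X. 2 powr q * (norm (?w X) powr q +
        2 powr q * (norm (g X - gradient \<phi> X) powr q + norm (g_inf (snd X) - gradient \<psi> (snd X)) powr q)))"
        by (intro integrable_mult_right Bochner_Integration.integrable_add iw ia ib(1))
    qed
    also have "?I \<le> 2 powr q * (K * \<theta> + 2 powr q * (\<theta> + \<theta>))"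
    proof -
      have "?I = 2 powr q * ((LINT X|lebesgue_on ?T. norm (?w X) powr q) +
          2 powr q * ((LINT X|lebesgue_on ?T. norm (g X - gradient \<phi> X) powr q) +
            (LINT X|lebesgue_on ?T. norm (g_inf (snd X) - gradient \<psi> (snd X)) powr q)))"
        using iw ia ib(1) by simp
      also have "\<dots> \<le> 2 powr q * (K * \<theta> + 2 powr q * (\<theta> + \<theta>))"
        using rate a b by (intro mult_left_mono add_mono) auto
      finally show ?thesis .
    qed
    also have "\<dots> = K' * \<theta>" by (simp add: K'_def algebra_simps)
    also have "\<dots> = K' / l powr (1 / (q - 1))"
      by (simp add: \<theta>_def powr_minus divide_inverse)
    finally show ?thesis unfolding cyl2 .
  qed
  with K' show ?thesis by blast
qed

end
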